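(* Let $(X_k)_{k\in\mathbf{Z}}$ be a sequence of i.i.d. real random variables whose common law has a density $f$ that is bounded and is continuous at a fixed point $x\in\mathbf{R}$. Let $K:\mathbf{R}\to\mathbf{R}$ be a function with $\int_{\mathbf{R}}K(u)\,du=1$ for which there is a positive constant $C$ such that $\int_{\mathbf{R}}|K(u)|^m\,du\le m!\,C^m$ for all positive integers $m$. For all $n\ge 1$ let $h_n$ be a strictly positive real number. For each positive integer $n$ and each $t\in[0,1]$ define $$f_{[nt]}(x)=\frac{1}{nh_n}\sum_{k=1}^{[nt]}K\Big(\frac{x-X_k}{h_n}\Big),\qquad U_n(t)=\sqrt{nh_n}\,\big(f_{[nt]}(x)-\mathbf{E}(f_{[nt]}(x))\big).$$ Assume that $a_n\to0$ and $a_nnh_n\to\infty$. Then the processes $U_n(\cdot)$ satisfy the functional moderate deviation principle in $D[0,1]$ (uniform topology) with speed $a_n$ and good rate function $$I_f(z)=\Big(f(x)\int_{\mathbf{R}}K^2(u)\,du\Big)^{-1}I(z),$$ where $I(z)=\tfrac12\int_0^1(z'(u))^2\,du$ if $z(0)=0$ and $z$ is absolutely continuous, and $I(z)=\infty$ otherwise.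
   Context: $[y]$ denotes the integer part of $y$; $(a_n)$ is a sequence of positive numbers; $\log 0=-\infty$; $D[0,1]$ is the space of càdlàg functions on $[0,1]$. Functional moderate deviation principle: a family $\{U_n\}$ of random elements of $D[0,1]$, endowed with the uniform topology, satisfies the functional MDP with speed $a_n\to0$ and good rate function $J$ if the level sets $\{z: J(z)\le\alpha\}$ are compact for all $\alpha<\infty$ and for every Borel set $\Gamma\subset D[0,1]$, with interior $\Gamma^0$ and closure $\bar\Gamma$, $$-\inf_{z\in\Gamma^0}J(z)\le\liminf_n a_n\log\mathbf{P}(\sqrt{a_n}\,U_n\in\Gamma)\le\limsup_n a_n\log\mathbf{P}(\sqrt{a_n}\,U_n\in\Gamma)\le-\inf_{z\in\bar\Gamma}J(z).$$
   Formalization: The assumption that h_n tends to 0 is added; without it the claim fails, e.g. for K the indicator of [-1/2,1/2], f the indicator of [0,1], x=1/2, h_n=1, a_n=n^(-1/2), where U_n=0 almost surely. *)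

theory Defs
  imports "HOL-Probability.Probability"
begin

section \<open>The space D[0,1] with the uniform topology\<close>

text \<open>Elements of D[0,1] are total functions made canonical by being \<^const>\<open>undefined\<close> off [0,1].\<close>

definition D01 :: "(real \<Rightarrow> real) set" where
  "D01 = {z \<in> extensional {0..1}.
            (\<forall>t\<in>{0..<1}. (z \<longlongrightarrow> z t) (at_right t)) \<and>
            (\<forall>t\<in>{0<..1}. \<exists>l. (z \<longlongrightarrow> l) (at_left t))}"

text \<open>The default value off D[0,1] is needed because \<^locale>\<open>Metric_space\<close>
  asks for nonnegativity outside the carrier as well.\<close>

definition sup_dist :: "(real \<Rightarrow> real) \<Rightarrow> (real \<Rightarrow> real) \<Rightarrow> real" where
  "sup_dist z w = (if z \<in> D01 \<and> w \<in> D01 then SUP t\<in>{0..1}. \<bar>z t - w t\<bar> else 0)"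

lemma D01_bounded:
  assumes z: "z \<in> D01"
  shows "\<exists>B. \<forall>t\<in>{0..1}. \<bar>z t\<bar> \<le> B"
proof -
  have loc: "\<exists>T B. open T \<and> t \<in> T \<and> (\<forall>s\<in>T \<inter> {0..1}. \<bar>z s\<bar> \<le> B)" if t: "t \<in> {0..1}" for t
  proof -
    have R: "\<exists>B. \<forall>\<^sub>F s in at_right t. s \<in> {0..1} \<longrightarrow> \<bar>z s\<bar> \<le> B"
    proof (cases "t < 1")
      case True
      then have "(z \<longlongrightarrow> z t) (at_right t)" using z t by (auto simp: D01_def)
      then have "\<forall>\<^sub>F s in at_right t. dist (z s) (z t) < 1" by (rule tendstoD) simp
      then have "\<forall>\<^sub>F s in at_right t. s \<in> {0..1} \<longrightarrow> \<bar>z s\<bar> \<le> \<bar>z t\<bar> + 1"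
        by eventually_elim (auto simp: dist_real_def)
      then show ?thesis by blast
    next
      case False
      have "\<forall>\<^sub>F s in at_right t. t < s" by (simp add: eventually_at_right_less)
      then have "\<forall>\<^sub>F s in at_right t. s \<in> {0..1} \<longrightarrow> \<bar>z s\<bar> \<le> 0"
        by eventually_elim (use False in auto)
      then show ?thesis by blast
    qed
    have L: "\<exists>B. \<forall>\<^sub>F s in at_left t. s \<in> {0..1} \<longrightarrow> \<bar>z s\<bar> \<le> B"
    proof (cases "0 < t")
      case True
      then have "t \<in> {0<..1}" using t by simp
      then obtain l where "(z \<longlongrightarrow> l) (at_left t)" using z unfolding D01_def by blast
      then have "\<forall>\<^sub>F s in at_left t. dist (z s) l < 1" by (rule tendstoD) simp
      then have "\<forall>\<^sub>F s in at_left t. s \<in> {0..1} \<longrightarrow> \<bar>z s\<bar> \<le> \<bar>l\<bar> + 1"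
        by eventually_elim (auto simp: dist_real_def)
      then show ?thesis by blast
    next
      case False
      have "\<forall>\<^sub>F s in at_left t. s < t"
        by (simp add: eventually_at_filter)
      then have "\<forall>\<^sub>F s in at_left t. s \<in> {0..1} \<longrightarrow> \<bar>z s\<bar> \<le> 0"
        by eventually_elim (use False in auto)
      then show ?thesis by blast
    qed
    from R L obtain B1 B2 where
      "\<forall>\<^sub>F s in at_right t. s \<in> {0..1} \<longrightarrow> \<bar>z s\<bar> \<le> B1"
      "\<forall>\<^sub>F s in at_left t. s \<in> {0..1} \<longrightarrow> \<bar>z s\<bar> \<le> B2" by blast
    then have "\<forall>\<^sub>F s in at t. s \<in> {0..1} \<longrightarrow> \<bar>z s\<bar> \<le> max B1 B2"
      unfolding eventually_at_split by (auto elim!: eventually_mono)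
    then obtain T where "open T" "t \<in> T"
      "\<forall>s\<in>T. s \<noteq> t \<longrightarrow> s \<in> {0..1} \<longrightarrow> \<bar>z s\<bar> \<le> max B1 B2"
      unfolding eventually_at_topological by blast
    then show ?thesis
      by (intro exI[of _ T] exI[of _ "max (max B1 B2) \<bar>z t\<bar>"]) (auto simp: le_max_iff_disj)
  qed
  then obtain T B where TB: "\<And>t. t \<in> {0..1} \<Longrightarrow> open (T t) \<and> t \<in> T t \<and> (\<forall>s\<in>T t \<inter> {0..1}. \<bar>z s\<bar> \<le> B t)"
    by metis
  have opn: "\<And>t. t \<in> {0..1} \<Longrightarrow> open (T t)" using TB by simp
  have cov: "{0..1} \<subseteq> (\<Union>t\<in>{0..1}. T t)" using TB by blast
  obtain F where F: "F \<subseteq> {0..1::real}" "finite F" "{0..1} \<subseteq> (\<Union>t\<in>F. T t)"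
    using compactE_image[OF compact_Icc[of 0 1] opn cov] by metis
  show ?thesis
  proof (intro exI ballI)
    fix s :: real assume s: "s \<in> {0..1}"
    then obtain t where t: "t \<in> F" "s \<in> T t" using F by blast
    then have "\<bar>z s\<bar> \<le> B t" using TB F(1) s by blast
    also have "\<dots> \<le> Max (B ` F)" using F(2) t by simp
    finally show "\<bar>z s\<bar> \<le> Max (B ` F)" .
  qed
qed

lemma sup_dist_bdd:
  assumes "z \<in> D01" "w \<in> D01"
  shows "bdd_above ((\<lambda>t. \<bar>z t - w t\<bar>) ` {0..1})"
proof -
  obtain A B where "\<forall>t\<in>{0..1}. \<bar>z t\<bar> \<le> A" "\<forall>t\<in>{0..1}. \<bar>w t\<bar> \<le> B"
    using assms D01_bounded by metis
  then show ?thesis by (intro bdd_aboveI2[of _ _ "A + B"]) (fastforce dest!: bspec)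
qed

lemma sup_dist_upper:
  assumes "z \<in> D01" "w \<in> D01" "t \<in> {0..1}"
  shows "\<bar>z t - w t\<bar> \<le> sup_dist z w"
  unfolding sup_dist_def using assms by (auto intro!: cSUP_upper sup_dist_bdd)

interpretation D01: Metric_space D01 sup_dist
proof
  show "0 \<le> sup_dist z w" for z w
  proof (cases "z \<in> D01 \<and> w \<in> D01")
    case True
    then have "\<bar>z 0 - w 0\<bar> \<le> sup_dist z w" by (intro sup_dist_upper) auto
    then show ?thesis by linarith
  qed (auto simp: sup_dist_def)
  show "sup_dist z w = sup_dist w z" for z w
    by (simp add: sup_dist_def abs_minus_commute conj_commute)
  show "sup_dist z w = 0 \<longleftrightarrow> z = w" if D: "z \<in> D01" "w \<in> D01" for z w
  proof
    assume eq: "sup_dist z w = 0"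
    show "z = w"
    proof (rule extensionalityI)
      show "z \<in> extensional {0..1}" "w \<in> extensional {0..1}" using D by (auto simp: D01_def)
      fix t :: real assume "t \<in> {0..1}"
      then have "\<bar>z t - w t\<bar> \<le> sup_dist z w" by (intro sup_dist_upper D)
      then show "z t = w t" using eq by simp
    qed
  qed (simp add: sup_dist_def)
  show "sup_dist z v \<le> sup_dist z w + sup_dist w v"
    if D: "z \<in> D01" "w \<in> D01" "v \<in> D01" for z w v
  proof -
    have "\<bar>z t - v t\<bar> \<le> sup_dist z w + sup_dist w v" if t: "t \<in> {0..1}" for t
      using sup_dist_upper[OF D(1,2) t] sup_dist_upper[OF D(2,3) t] by linarith
    then have "(SUP t\<in>{0..1}. \<bar>z t - v t\<bar>) \<le> sup_dist z w + sup_dist w v"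
      by (intro cSUP_least) auto
    then show ?thesis using D by (simp add: sup_dist_def[of z v])
  qed
qed

definition D01_top :: "(real \<Rightarrow> real) topology" where
  "D01_top = Metric_space.mtopology D01 sup_dist"

definition D01_borel :: "(real \<Rightarrow> real) measure" where
  "D01_borel = sigma D01 {V. openin D01_top V}"

lemma space_D01_borel: "space D01_borel = D01"
  by (simp add: D01_borel_def space_measure_of_conv)

lemma sets_D01_borel: "sets D01_borel = sigma_sets D01 {V. openin D01_top V}"
  unfolding D01_borel_def
  by (rule sets_measure_of) (use openin_subset in \<open>fastforce simp: D01_top_def\<close>)


section \<open>The functional moderate deviation principle\<close>

definition ln_ext :: "real \<Rightarrow> ereal" where
  "ln_ext p = (if p = 0 then -\<infinity> else ereal (ln p))"

text \<open>Measurability of each \<open>U n\<close> expresses that it is a random element of D[0,1]; it also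
  guarantees that the probabilities below are those of genuine events. The infimum over the
  empty set is \<open>\<infinity>\<close> in \<^typ>\<open>ereal\<close>. Families are indexed by \<open>n \<ge> 1\<close>.\<close>

definition functional_MDP ::
  "'w measure \<Rightarrow> (nat \<Rightarrow> 'w \<Rightarrow> real \<Rightarrow> real) \<Rightarrow> (nat \<Rightarrow> real) \<Rightarrow> ((real \<Rightarrow> real) \<Rightarrow> ereal) \<Rightarrow> bool"
where
  "functional_MDP M U a J \<longleftrightarrow>
     (\<forall>n\<ge>1. U n \<in> measurable M D01_borel) \<and>
     (\<forall>\<alpha>::real. compactin D01_top {z \<in> D01. J z \<le> ereal \<alpha>}) \<and>
     (\<forall>\<Gamma>\<in>sets D01_borel.
        let L = (\<lambda>n. ereal (a n) *
              ln_ext (measure M {\<omega> \<in> space M. (\<lambda>t\<in>{0..1}. sqrt (a n) * U n \<omega> t) \<in> \<Gamma>}))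
        in - (INF z\<in>D01_top interior_of \<Gamma>. J z) \<le> liminf L \<and>
           liminf L \<le> limsup L \<and>
           limsup L \<le> - (INF z\<in>D01_top closure_of \<Gamma>. J z))"


section \<open>The rate function\<close>

definition abs_continuous_on_Icc :: "real \<Rightarrow> real \<Rightarrow> (real \<Rightarrow> real) \<Rightarrow> bool" where
  "abs_continuous_on_Icc a b z \<longleftrightarrow>
     (\<forall>\<epsilon>>0. \<exists>\<delta>>0. \<forall>(N::nat) (s::nat \<Rightarrow> real) (t::nat \<Rightarrow> real).
        (\<forall>i<N. a \<le> s i \<and> s i \<le> t i \<and> t i \<le> b) \<and>
        disjoint_family_on (\<lambda>i. {s i<..<t i}) {..<N} \<and>
        (\<Sum>i<N. t i - s i) < \<delta>
        \<longrightarrow> (\<Sum>i<N. \<bar>z (t i) - z (s i)\<bar>) < \<epsilon>)"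

text \<open>An absolutely continuous \<open>z\<close> is differentiable almost everywhere, so the arbitrary values of
  \<^const>\<open>deriv\<close> elsewhere do not matter. The energy may be infinite.\<close>

definition rate_I :: "(real \<Rightarrow> real) \<Rightarrow> ereal" where
  "rate_I z =
     (if z 0 = 0 \<and> abs_continuous_on_Icc 0 1 z
      then ereal (1/2) * enn2ereal (\<integral>\<^sup>+u\<in>{0..1}. ennreal ((deriv z u)\<^sup>2) \<partial>lebesgue)
      else \<infinity>)"

text \<open>If \<open>f x = 0\<close>, the factor is \<open>\<infinity>\<close>, and \<open>\<infinity> * 0 = 0\<close>: the rate is \<open>0\<close> at
  the zero function and \<open>\<infinity>\<close> elsewhere.\<close>

definition rate_If :: "(real \<Rightarrow> real) \<Rightarrow> (real \<Rightarrow> real) \<Rightarrow> real \<Rightarrow> (real \<Rightarrow> real) \<Rightarrow> ereal" where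
  "rate_If f K x z = inverse (ereal (f x * (\<integral>u. (K u)\<^sup>2 \<partial>lborel))) * rate_I z"


section \<open>The kernel estimator process\<close>

definition kde ::
  "(real \<Rightarrow> real) \<Rightarrow> (nat \<Rightarrow> real) \<Rightarrow> (int \<Rightarrow> 'w \<Rightarrow> real) \<Rightarrow> real \<Rightarrow> nat \<Rightarrow> int \<Rightarrow> 'w \<Rightarrow> real"
where
  "kde K h X x n j \<omega> = 1 / (real n * h n) * (\<Sum>k=1..j. K ((x - X k \<omega>) / h n))"

definition kde_process ::
  "'w measure \<Rightarrow> (real \<Rightarrow> real) \<Rightarrow> (nat \<Rightarrow> real) \<Rightarrow> (int \<Rightarrow> 'w \<Rightarrow> real) \<Rightarrow> real
    \<Rightarrow> nat \<Rightarrow> 'w \<Rightarrow> real \<Rightarrow> real"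
where
  "kde_process M K h X x n \<omega> =
     (\<lambda>t\<in>{0..1}. sqrt (real n * h n) *
        (kde K h X x n \<lfloor>real n * t\<rfloor> \<omega> - (\<integral>\<omega>'. kde K h X x n \<lfloor>real n * t\<rfloor> \<omega>' \<partial>M)))"

end

theory Submission
  imports Defs "HOL-Complex_Analysis.Great_Picard"
begin

text \<open>The level sets of \<open>I\<close> are described without derivatives: \<open>I z \<le> E / 2\<close> holds iff \<open>z 0 = 0\<close> and
  \<open>\<Sum> (z t\<^sub>i - z s\<^sub>i)\<^sup>2 / (t\<^sub>i - s\<^sub>i) \<le> E\<close> for all families of disjoint intervals. This condition passes to
  pointwise limits, so the level sets are compact by Arzela-Ascoli, and it reduces both bounds to
  the increments of the process over \<open>m\<close> equal blocks. A Taylor expansion of the moment generating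
  function of \<open>K ((x - X\<^sub>k) / h\<^sub>n)\<close> shows that the logarithmic moment generating functions of the
  scaled increments converge at speed \<open>a\<^sub>n\<close> to Gaussian ones with variance \<open>f x * \<integral>K\<^sup>2 / m\<close>. The
  increments are independent, and by a maximal inequality the oscillation within the blocks is
  negligible at speed \<open>a\<^sub>n\<close> for large \<open>m\<close>. For the upper bound the process is replaced by the polygon
  through its block values, whose energy is a sum of independent squares; for the lower bound the
  increments are forced to be close to those of the target path.\<close>


section \<open>Absolutely continuous functions\<close>

text \<open>The kernel variables have exponential moments only near 0. The argument that occurs is
  \<open>\<theta> / sqrt (a n * (real n * h n))\<close>, which tends to 0 since
  \<open>a n * (real n * h n)\<close> diverges; so every real \<theta> is eventually admissible and
  the Gaussian limit holds on the whole line. The number of blocks is fixed before n grows;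
  constants and finite unions then disappear because \<open>a n\<close> tends to 0. What remains
  delicate is the meaning of the rate: it is defined through \<open>deriv\<close>, which says
  nothing about limits of paths. The link to interval sums goes through a density of the path, found
  by Jordan decomposition and Radon-Nikodym, with Cauchy-Schwarz in one direction and Fatou in the
  other. The limiting variance \<open>c\<close> may be 0 and the rate degenerate; the bounds keep
  their form because level sets are described by energy at most \<open>2 * \<alpha> * c\<close>
  instead of by a quotient.\<close>

abbreviation AC :: "(real \<Rightarrow> real) \<Rightarrow> bool" where
  "AC \<equiv> abs_continuous_on_Icc 0 1"

text \<open>The index type is left open so that one notion serves for a single interval, for pairs
  produced by refining a family, and for intervals indexing themselves. Only the open interiors are
  disjoint, so neighbours may share endpoints and degenerate intervals are allowed.\<close>

definition interval_family :: "real \<Rightarrow> real \<Rightarrow> 'i set \<Rightarrow> ('i \<Rightarrow> real) \<Rightarrow> ('i \<Rightarrow> real) \<Rightarrow> bool" where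
  "interval_family a b I s t \<longleftrightarrow> finite I \<and> (\<forall>i\<in>I. a \<le> s i \<and> s i \<le> t i \<and> t i \<le> b) \<and>
     disjoint_family_on (\<lambda>i. {s i<..<t i}) I"

lemma interval_familyI:
  assumes "finite I" "\<And>i. i \<in> I \<Longrightarrow> a \<le> s i" "\<And>i. i \<in> I \<Longrightarrow> s i \<le> t i" "\<And>i. i \<in> I \<Longrightarrow> t i \<le> b"
    "\<And>i j x. i \<in> I \<Longrightarrow> j \<in> I \<Longrightarrow> s i < x \<Longrightarrow> x < t i \<Longrightarrow> s j < x \<Longrightarrow> x < t j \<Longrightarrow> i = j"
  shows "interval_family a b I s t"
  using assms unfolding interval_family_def disjoint_family_on_def by fastforce

lemma interval_familyD:
  assumes "interval_family a b I s t"
  shows "finite I" "\<And>i. i \<in> I \<Longrightarrow> a \<le> s i" "\<And>i. i \<in> I \<Longrightarrow> s i \<le> t i" "\<And>i. i \<in> I \<Longrightarrow> t i \<le> b"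
    "\<And>i j x. i \<in> I \<Longrightarrow> j \<in> I \<Longrightarrow> s i < x \<Longrightarrow> x < t i \<Longrightarrow> s j < x \<Longrightarrow> x < t j \<Longrightarrow> i = j"
  using assms unfolding interval_family_def disjoint_family_on_def by fastforce+

lemma interval_family_reindex:
  assumes f: "interval_family a b I s t" and h: "bij_betw h J I"
  shows "interval_family a b J (s \<circ> h) (t \<circ> h)"
proof -
  note D = interval_familyD[OF f]
  have fin: "finite J" using D(1) h by (simp add: bij_betw_finite)
  have mem: "h j \<in> I" if "j \<in> J" for j using h that by (auto simp: bij_betw_def)
  have inj: "i = j" if "i \<in> J" "j \<in> J" "h i = h j" for i j
    using h that by (auto simp: bij_betw_def inj_on_def)
  show ?thesis
  proof (rule interval_familyI, goal_cases)
    case (5 i j x)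
    then show ?case using D(5)[of "h i" "h j" x] mem inj by auto
  qed (use fin mem D(2-4) in auto)
qed

text \<open>Turns a condition on total length into one on Lebesgue measure, so that a family inside
  a set of small measure is seen to be short.\<close>

lemma interval_family_measure:
  assumes f: "interval_family a b I s t"
  shows "(\<Sum>i\<in>I. t i - s i) = measure lborel (\<Union>i\<in>I. {s i<..<t i})"
proof -
  note D = interval_familyD[OF f]
  have "(\<Sum>i\<in>I. t i - s i) = (\<Sum>i\<in>I. measure lborel {s i<..<t i})"
    using D(3) by (intro sum.cong) auto
  also have "\<dots> = measure lborel (\<Union>i\<in>I. {s i<..<t i})"
    using D(3) f by (intro measure_finite_Union[symmetric] D(1)) (auto simp: interval_family_def)
  finally show ?thesis .
qed

lemma interval_family_length:
  assumes f: "interval_family a b I s t" and ab: "a \<le> b"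
  shows "(\<Sum>i\<in>I. t i - s i) \<le> b - a"
proof -
  note D = interval_familyD[OF f]
  have "measure lborel (\<Union>i\<in>I. {s i<..<t i}) \<le> measure lborel {a..b}"
  proof (rule measure_mono_fmeasurable)
    show "(\<Union>i\<in>I. {s i<..<t i}) \<subseteq> {a..b}" using D(2,4) by force
    show "{a..b} \<in> fmeasurable lborel" using ab by (auto intro!: fmeasurableI)
  qed (use D(1) in auto)
  then show ?thesis using ab by (simp add: interval_family_measure[OF f])
qed

text \<open>The definition only knows families indexed by \<open>{..<N}\<close>; a bijection from
  \<open>{..<card I}\<close> carries it over to every finite index set, whatever its type.\<close>

lemma abs_continuous_familyD:
  assumes "AC z" "0 < \<epsilon>"
  obtains \<delta> where "0 < \<delta>"
    "\<And>(I :: 'i set) s t. interval_family 0 1 I s t \<Longrightarrow> (\<Sum>i\<in>I. t i - s i) < \<delta> \<Longrightarrow>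
       (\<Sum>i\<in>I. \<bar>z (t i) - z (s i)\<bar>) < \<epsilon>"
proof -
  obtain \<delta> where d: "\<delta> > 0" and ac: "\<And>N s t. (\<forall>i<N. 0 \<le> s i \<and> s i \<le> t i \<and> t i \<le> 1) \<and>
        disjoint_family_on (\<lambda>i. {s i<..<t i}) {..<N} \<and> (\<Sum>i<N. t i - s i) < \<delta>
        \<longrightarrow> (\<Sum>i<(N::nat). \<bar>z (t i) - z (s i)\<bar>) < \<epsilon>"
    using assms unfolding abs_continuous_on_Icc_def by blast
  have "(\<Sum>i\<in>I. \<bar>z (t i) - z (s i)\<bar>) < \<epsilon>"
    if f: "interval_family 0 1 I s t" and l: "(\<Sum>i\<in>I. t i - s i) < \<delta>" for I :: "'i set" and s t
  proof -
    obtain h where h: "bij_betw h {..<card I} I"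
      using ex_bij_betw_nat_finite[OF interval_familyD(1)[OF f]] by (auto simp: atLeast0LessThan)
    have "interval_family 0 1 {..<card I} (s \<circ> h) (t \<circ> h)"
      by (rule interval_family_reindex[OF f h])
    moreover have "(\<Sum>i<card I. (t \<circ> h) i - (s \<circ> h) i) = (\<Sum>i\<in>I. t i - s i)"
      using sum.reindex_bij_betw[OF h, of "\<lambda>i. t i - s i"] by simp
    moreover have "(\<Sum>i<card I. \<bar>z ((t \<circ> h) i) - z ((s \<circ> h) i)\<bar>) = (\<Sum>i\<in>I. \<bar>z (t i) - z (s i)\<bar>)"
      using sum.reindex_bij_betw[OF h, of "\<lambda>i. \<bar>z (t i) - z (s i)\<bar>"] by simp
    ultimately show ?thesis
      using ac[of "card I" "s \<circ> h" "t \<circ> h"] l by (auto simp: interval_family_def)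
  qed
  with d show thesis by (rule that)
qed

lemma abs_continuousI:
  assumes "\<And>\<epsilon>. 0 < \<epsilon> \<Longrightarrow> \<exists>\<delta>>0. \<forall>(I :: nat set) s t. interval_family 0 1 I s t \<longrightarrow> (\<Sum>i\<in>I. t i - s i) < \<delta> \<longrightarrow>
       (\<Sum>i\<in>I. \<bar>z (t i) - z (s i)\<bar>) < \<epsilon>"
  shows "AC z"
  unfolding abs_continuous_on_Icc_def
proof (intro allI impI)
  fix \<epsilon> :: real assume "0 < \<epsilon>"
  from assms[OF this] obtain \<delta> where "\<delta> > 0"
    and D: "\<And>(I :: nat set) s t. interval_family 0 1 I s t \<Longrightarrow> (\<Sum>i\<in>I. t i - s i) < \<delta> \<Longrightarrow>
       (\<Sum>i\<in>I. \<bar>z (t i) - z (s i)\<bar>) < \<epsilon>" by blast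
  then show "\<exists>\<delta>>0. \<forall>(N::nat) (s::nat \<Rightarrow> real) (t::nat \<Rightarrow> real).
        (\<forall>i<N. 0 \<le> s i \<and> s i \<le> t i \<and> t i \<le> 1) \<and>
        disjoint_family_on (\<lambda>i. {s i<..<t i}) {..<N} \<and> (\<Sum>i<N. t i - s i) < \<delta>
        \<longrightarrow> (\<Sum>i<N. \<bar>z (t i) - z (s i)\<bar>) < \<epsilon>"
    by (intro exI[of _ \<delta>]) (auto simp: interval_family_def)
qed

lemma abs_continuous_close:
  assumes "AC z" "0 < \<epsilon>"
  obtains \<delta> where "0 < \<delta>"
    "\<And>s t. 0 \<le> s \<Longrightarrow> s \<le> t \<Longrightarrow> t \<le> 1 \<Longrightarrow> t - s < \<delta> \<Longrightarrow> \<bar>z t - z s\<bar> < \<epsilon>"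
proof -
  obtain \<delta> where d: "0 < \<delta>" and *: "\<And>(I :: unit set) s t. interval_family 0 1 I s t \<Longrightarrow>
      (\<Sum>i\<in>I. t i - s i) < \<delta> \<Longrightarrow> (\<Sum>i\<in>I. \<bar>z (t i) - z (s i)\<bar>) < \<epsilon>"
    using abs_continuous_familyD[OF assms] by blast
  have "\<bar>z t - z s\<bar> < \<epsilon>" if "0 \<le> s" "s \<le> t" "t \<le> 1" "t - s < \<delta>" for s t
    using *[of UNIV "\<lambda>_. s" "\<lambda>_. t"] that
    by (auto simp: interval_family_def disjoint_family_on_def UNIV_unit)
  with d show thesis by (rule that)
qed

lemma abs_continuous_diff:
  assumes "AC z" "AC w"
  shows "AC (\<lambda>t. z t - w t)"
proof (rule abs_continuousI)
  fix \<epsilon> :: real assume "0 < \<epsilon>"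
  then have e2: "0 < \<epsilon> / 2" by simp
  obtain d1 where d1: "0 < d1" and A: "\<And>(I :: nat set) s t. interval_family 0 1 I s t \<Longrightarrow>
      (\<Sum>i\<in>I. t i - s i) < d1 \<Longrightarrow> (\<Sum>i\<in>I. \<bar>z (t i) - z (s i)\<bar>) < \<epsilon> / 2"
    using abs_continuous_familyD[OF assms(1) e2] by blast
  obtain d2 where d2: "0 < d2" and B: "\<And>(I :: nat set) s t. interval_family 0 1 I s t \<Longrightarrow>
      (\<Sum>i\<in>I. t i - s i) < d2 \<Longrightarrow> (\<Sum>i\<in>I. \<bar>w (t i) - w (s i)\<bar>) < \<epsilon> / 2"
    using abs_continuous_familyD[OF assms(2) e2] by blast
  have "(\<Sum>i\<in>I. \<bar>(z (t i) - w (t i)) - (z (s i) - w (s i))\<bar>) < \<epsilon>"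
    if "interval_family 0 1 I s t" "(\<Sum>i\<in>I. t i - s i) < min d1 d2" for I :: "nat set" and s t
  proof -
    have "(\<Sum>i\<in>I. \<bar>(z (t i) - w (t i)) - (z (s i) - w (s i))\<bar>)
        \<le> (\<Sum>i\<in>I. \<bar>z (t i) - z (s i)\<bar> + \<bar>w (t i) - w (s i)\<bar>)"
      by (intro sum_mono) linarith
    also have "\<dots> < \<epsilon>" using A[OF that(1)] B[OF that(1)] that(2) by (simp add: sum.distrib)
    finally show ?thesis .
  qed
  then show "\<exists>\<delta>>0. \<forall>(I :: nat set) s t. interval_family 0 1 I s t \<longrightarrow> (\<Sum>i\<in>I. t i - s i) < \<delta> \<longrightarrow>
       (\<Sum>i\<in>I. \<bar>(z (t i) - w (t i)) - (z (s i) - w (s i))\<bar>) < \<epsilon>"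
    using d1 d2 by (intro exI[of _ "min d1 d2"]) auto
qed

section \<open>Total variation and Jordan decomposition\<close>

definition variation_sums :: "(real \<Rightarrow> real) \<Rightarrow> real \<Rightarrow> real \<Rightarrow> real set" where
  "variation_sums z a b = {(\<Sum>i\<in>I. \<bar>z (t i) - z (s i)\<bar>) | (I :: nat set) s t. interval_family a b I s t}"

text \<open>Cutting every interval at \<open>b\<close> by \<open>min\<close> and \<open>max\<close>
  leaves a degenerate interval at \<open>b\<close> on a side that it does not meet, and this
  contributes 0; only an interval that straddles \<open>b\<close> needs the triangle
  inequality.\<close>

lemma variation_sums_split:
  assumes x: "x \<in> variation_sums z a c" and abc: "a \<le> b" "b \<le> c"
  obtains y w where "y \<in> variation_sums z a b" "w \<in> variation_sums z b c" "x \<le> y + w"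
proof -
  obtain I :: "nat set" and s t where f: "interval_family a c I s t"
    and xs: "x = (\<Sum>i\<in>I. \<bar>z (t i) - z (s i)\<bar>)" using x unfolding variation_sums_def by blast
  note D = interval_familyD[OF f]
  define s1 t1 s2 t2 where "s1 = (\<lambda>i. min (s i) b)" and "t1 = (\<lambda>i. min (t i) b)"
    and "s2 = (\<lambda>i. max (s i) b)" and "t2 = (\<lambda>i. max (t i) b)"
  note defs = s1_def s2_def t1_def t2_def
  have f1: "interval_family a b I s1 t1"
  proof (rule interval_familyI, goal_cases)
    case (2 i) then show ?case using D(2-4)[OF 2] abc by (auto simp: defs)
  next
    case (3 i) then show ?case using D(2-4)[OF 3] abc by (auto simp: defs)
  next
    case (4 i) then show ?case using D(2-4)[OF 4] abc by (auto simp: defs)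
  next
    case (5 i j x)
    then show ?case using D(5)[of i j x] by (auto simp: defs)
  qed (rule D(1))
  have f2: "interval_family b c I s2 t2"
  proof (rule interval_familyI, goal_cases)
    case (2 i) then show ?case using D(2-4)[OF 2] abc by (auto simp: defs)
  next
    case (3 i) then show ?case using D(2-4)[OF 3] abc by (auto simp: defs)
  next
    case (4 i) then show ?case using D(2-4)[OF 4] abc by (auto simp: defs)
  next
    case (5 i j x)
    then show ?case using D(5)[of i j x] by (auto simp: defs)
  qed (rule D(1))
  have "\<bar>z (t i) - z (s i)\<bar> \<le> \<bar>z (t1 i) - z (s1 i)\<bar> + \<bar>z (t2 i) - z (s2 i)\<bar>" for i
    unfolding defs min_def max_def by auto
  then have "x \<le> (\<Sum>i\<in>I. \<bar>z (t1 i) - z (s1 i)\<bar>) + (\<Sum>i\<in>I. \<bar>z (t2 i) - z (s2 i)\<bar>)"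
    unfolding xs sum.distrib[symmetric] by (intro sum_mono)
  then show thesis
    using f1 f2 by (intro that[of "\<Sum>i\<in>I. \<bar>z (t1 i) - z (s1 i)\<bar>" "\<Sum>i\<in>I. \<bar>z (t2 i) - z (s2 i)\<bar>"])
      (auto simp: variation_sums_def)
qed

lemma variation_sums_append:
  assumes y: "y \<in> variation_sums z a b" and abc: "a \<le> b" "b \<le> c"
  shows "y + \<bar>z c - z b\<bar> \<in> variation_sums z a c"
proof -
  obtain I :: "nat set" and s t where f: "interval_family a b I s t"
    and ys: "y = (\<Sum>i\<in>I. \<bar>z (t i) - z (s i)\<bar>)" using y unfolding variation_sums_def by blast
  note D = interval_familyD[OF f]
  obtain k where k: "k \<notin> I" using ex_new_if_finite[OF infinite_UNIV_nat D(1)] by blast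
  have "interval_family a c (insert k I) (s(k := b)) (t(k := c))"
  proof (rule interval_familyI)
    fix i j x assume *: "i \<in> insert k I" "j \<in> insert k I" "(s(k := b)) i < x" "x < (t(k := c)) i"
      "(s(k := b)) j < x" "x < (t(k := c)) j"
    show "i = j" using * D(4)[of i] D(4)[of j] D(5)[of i j x] k by (auto split: if_splits)
  qed (use D(1-4) abc in \<open>force+\<close>)
  moreover have "(\<Sum>i\<in>insert k I. \<bar>z ((t(k := c)) i) - z ((s(k := b)) i)\<bar>) = \<bar>z c - z b\<bar> + y"
    unfolding ys using k D(1) by (subst sum.insert) (auto intro!: sum.cong)
  ultimately show ?thesis
    unfolding variation_sums_def mem_Collect_eq
    by (intro exI[of _ "insert k I"] exI[of _ "s(k := b)"] exI[of _ "t(k := c)"]) simp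
qed

lemma variation_sums_mono:
  "b \<le> c \<Longrightarrow> variation_sums z a b \<subseteq> variation_sums z a c"
  unfolding variation_sums_def interval_family_def by fastforce

lemma zero_in_variation_sums: "0 \<in> variation_sums z a b"
  unfolding variation_sums_def
  by (auto simp: interval_family_def disjoint_family_on_def intro!: exI[of _ "{}"])

text \<open>Split \<open>{0..1}\<close> into \<open>p\<close> pieces shorter than the \<delta> that
  belongs to \<epsilon> = 1. Each piece has variation below 1, so \<open>k\<close> pieces contribute
  at most \<open>k\<close>.\<close>

lemma bdd_above_variation_sums:
  assumes "AC z" "t \<le> 1"
  shows "bdd_above (variation_sums z 0 t)"
proof -
  obtain \<delta> where d: "0 < \<delta>" and ac: "\<And>(I :: nat set) s t. interval_family 0 1 I s t \<Longrightarrow>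
      (\<Sum>i\<in>I. t i - s i) < \<delta> \<Longrightarrow> (\<Sum>i\<in>I. \<bar>z (t i) - z (s i)\<bar>) < 1"
    using abs_continuous_familyD[OF assms(1), of 1] zero_less_one by blast
  obtain p :: nat where p: "p > 0" "1 / p < \<delta>"
    using d by (metis ex_inverse_of_nat_less inverse_eq_divide)
  have "k \<le> p \<Longrightarrow> x \<in> variation_sums z 0 (k / p) \<Longrightarrow> x \<le> k" for k x
  proof (induction k arbitrary: x)
    case 0
    then obtain I :: "nat set" and s t where f: "interval_family 0 0 I s t"
      and xs: "x = (\<Sum>i\<in>I. \<bar>z (t i) - z (s i)\<bar>)" unfolding variation_sums_def by auto
    have "s i = t i" if "i \<in> I" for i using interval_familyD(2-4)[OF f that] by simp
    then show ?case unfolding xs by simp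
  next
    case (Suc k)
    have le: "real k / p \<le> real (Suc k) / p" using p by (simp add: divide_right_mono)
    obtain y w where yw: "y \<in> variation_sums z 0 (k / p)" "w \<in> variation_sums z (k / p) (Suc k / p)"
      "x \<le> y + w"
      using variation_sums_split[OF Suc.prems(2) _ le] by (metis divide_nonneg_nonneg of_nat_0_le_iff)
    obtain I :: "nat set" and s t where f: "interval_family (k / p) (Suc k / p) I s t"
      and ws: "w = (\<Sum>i\<in>I. \<bar>z (t i) - z (s i)\<bar>)" using yw(2) unfolding variation_sums_def by auto
    have "real (Suc k) / p \<le> 1" using Suc.prems(1) p by simp
    moreover have "0 \<le> real k / p" by simp
    ultimately have f01: "interval_family 0 1 I s t"
      using f unfolding interval_family_def by (meson order_trans)
    have "(\<Sum>i\<in>I. t i - s i) \<le> Suc k / p - k / p" by (rule interval_family_length[OF f le])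
    also have "\<dots> = 1 / p" by (simp add: diff_divide_distrib[symmetric])
    finally have "w < 1" unfolding ws using p(2) by (intro ac[OF f01]) simp
    moreover have "y \<le> k" using Suc.prems(1) yw(1) by (intro Suc.IH) auto
    ultimately show ?case using yw(3) by simp
  qed
  from this[of p] p(1) have "x \<le> p" if "x \<in> variation_sums z 0 1" for x using that by simp
  then show ?thesis using variation_sums_mono[OF assms(2), of z 0] by (intro bdd_aboveI[of _ "real p"]) auto
qed

text \<open>The total variation function inherits absolute continuity: each increment of
  \<open>V\<close> is nearly attained by a family inside its interval, and all these families
  together form one family of no greater total length, to which the absolute continuity of
  \<open>z\<close> applies.\<close>

lemma abs_continuous_variation:
  assumes z: "AC z"
  obtains V where "AC V" "\<And>s t. 0 \<le> s \<Longrightarrow> s \<le> t \<Longrightarrow> t \<le> 1 \<Longrightarrow> \<bar>z t - z s\<bar> \<le> V t - V s"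
proof -
  define V where "V t = Sup (variation_sums z 0 t)" for t
  have ne: "variation_sums z 0 t \<noteq> {}" for t using zero_in_variation_sums by blast
  have le: "\<bar>z t - z s\<bar> \<le> V t - V s" if st: "0 \<le> s" "s \<le> t" "t \<le> 1" for s t
  proof -
    have "V s \<le> V t - \<bar>z t - z s\<bar>"
      unfolding V_def
    proof (rule cSup_least[OF ne])
      fix y assume "y \<in> variation_sums z 0 s"
      from variation_sums_append[OF this st(1,2)]
      show "y \<le> Sup (variation_sums z 0 t) - \<bar>z t - z s\<bar>"
        using cSup_upper[OF _ bdd_above_variation_sums[OF z st(3)]] by fastforce
    qed
    then show ?thesis by simp
  qed
  have "AC V"
  proof (rule abs_continuousI)
    fix \<epsilon> :: real assume e: "0 < \<epsilon>"
    then have e2: "0 < \<epsilon> / 2" by simp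
    obtain \<delta> where d: "0 < \<delta>" and ac: "\<And>(J :: (nat \<times> nat) set) s t. interval_family 0 1 J s t \<Longrightarrow>
        (\<Sum>i\<in>J. t i - s i) < \<delta> \<Longrightarrow> (\<Sum>i\<in>J. \<bar>z (t i) - z (s i)\<bar>) < \<epsilon> / 2"
      using abs_continuous_familyD[OF z e2] by blast
    have "(\<Sum>i\<in>I. \<bar>V (t i) - V (s i)\<bar>) < \<epsilon>"
      if f: "interval_family 0 1 I s t" and l: "(\<Sum>i\<in>I. t i - s i) < \<delta>" for I :: "nat set" and s t
    proof -
      note D = interval_familyD[OF f]
      \<comment> \<open>The approximation error of one interval; over the family the errors add up
        to at most \<open>\<epsilon> / 2\<close>. The \<open>+ 1\<close> covers the empty
        family.\<close>
      define \<eta> where "\<eta> = \<epsilon> / 2 / (card I + 1)"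
      have eta: "\<eta> > 0" using e by (simp add: \<eta>_def)
      have "\<exists>J s' t'. interval_family (s i) (t i) (J :: nat set) s' t' \<and>
          V (t i) - V (s i) \<le> (\<Sum>j\<in>J. \<bar>z (t' j) - z (s' j)\<bar>) + \<eta>" if i: "i \<in> I" for i
      proof -
        obtain x where x: "x \<in> variation_sums z 0 (t i)" "V (t i) - \<eta> < x"
          using less_cSupE[of "V (t i) - \<eta>" "variation_sums z 0 (t i)"] ne eta V_def by auto
        obtain y w where yw: "y \<in> variation_sums z 0 (s i)" "w \<in> variation_sums z (s i) (t i)" "x \<le> y + w"
          using variation_sums_split[OF x(1) D(2,3)[OF i]] by blast
        have "y \<le> V (s i)" unfolding V_def
          using D(2-4)[OF i] by (intro cSup_upper yw bdd_above_variation_sums[OF z]) auto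
        then have "V (t i) - V (s i) \<le> w + \<eta>" using x yw by simp
        then show ?thesis using yw(2) unfolding variation_sums_def by blast
      qed
      then obtain J s' t' where F: "\<And>i. i \<in> I \<Longrightarrow> interval_family (s i) (t i) (J i :: nat set) (s' i) (t' i)"
        and W: "\<And>i. i \<in> I \<Longrightarrow> V (t i) - V (s i) \<le> (\<Sum>j\<in>J i. \<bar>z (t' i j) - z (s' i j)\<bar>) + \<eta>" by metis
      have Jfin: "\<forall>i\<in>I. finite (J i)" using interval_familyD(1)[OF F] by blast
      have F': "interval_family 0 1 (Sigma I J) (\<lambda>(i, j). s' i j) (\<lambda>(i, j). t' i j)"
      proof (rule interval_familyI, goal_cases)
        case 1
        then show ?case using D(1) Jfin by auto
      next
        case (2 p) then show ?case using D(2) interval_familyD(2)[OF F] by (force intro: order_trans)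
      next
        case (3 p) then show ?case using interval_familyD(3)[OF F] by auto
      next
        case (4 p) then show ?case using D(4) interval_familyD(4)[OF F] by (force intro: order_trans)
      next
        case (5 p q x)
        obtain i j i' j' where pq: "p = (i, j)" "q = (i', j')" by fastforce
        with 5 have mem: "i \<in> I" "j \<in> J i" "i' \<in> I" "j' \<in> J i'" by auto
        have "s i < x" "x < t i" "s i' < x" "x < t i'"
          using 5(3-6) pq interval_familyD(2,4)[OF F[OF mem(1)] mem(2)]
            interval_familyD(2,4)[OF F[OF mem(3)] mem(4)] by auto
        then have "i = i'" using D(5) mem by blast
        with 5(3-6) pq interval_familyD(5)[OF F[OF mem(1)] mem(2)] mem show ?case by auto
      qed
      have "(\<Sum>(i, j)\<in>Sigma I J. t' i j - s' i j) = (\<Sum>i\<in>I. \<Sum>j\<in>J i. t' i j - s' i j)"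
        by (rule sum.Sigma[symmetric, OF D(1) Jfin])
      also have "\<dots> \<le> (\<Sum>i\<in>I. t i - s i)"
        by (intro sum_mono interval_family_length F D(3))
      finally have len: "(\<Sum>(i, j)\<in>Sigma I J. t' i j - s' i j) < \<delta>" using l by simp
      have "(\<Sum>i\<in>I. \<bar>V (t i) - V (s i)\<bar>) = (\<Sum>i\<in>I. V (t i) - V (s i))"
      proof (intro sum.cong refl)
        fix i assume "i \<in> I"
        from le[OF D(2-4)[OF this]] show "\<bar>V (t i) - V (s i)\<bar> = V (t i) - V (s i)" by simp
      qed
      also have "\<dots> \<le> (\<Sum>i\<in>I. (\<Sum>j\<in>J i. \<bar>z (t' i j) - z (s' i j)\<bar>) + \<eta>)" by (intro sum_mono W)
      also have "\<dots> = (\<Sum>(i, j)\<in>Sigma I J. \<bar>z (t' i j) - z (s' i j)\<bar>) + card I * \<eta>"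
        by (simp add: sum.distrib sum.Sigma[OF D(1) Jfin])
      also have "\<dots> < \<epsilon> / 2 + \<epsilon> / 2"
      proof (rule add_less_le_mono)
        show "(\<Sum>(i, j)\<in>Sigma I J. \<bar>z (t' i j) - z (s' i j)\<bar>) < \<epsilon> / 2"
          using ac[OF F'] len by (simp add: case_prod_unfold)
        show "card I * \<eta> \<le> \<epsilon> / 2" using e by (simp add: \<eta>_def field_simps)
      qed
      finally show ?thesis by simp
    qed
    then show "\<exists>\<delta>>0. \<forall>(I :: nat set) s t. interval_family 0 1 I s t \<longrightarrow> (\<Sum>i\<in>I. t i - s i) < \<delta> \<longrightarrow>
       (\<Sum>i\<in>I. \<bar>V (t i) - V (s i)\<bar>) < \<epsilon>"
      using d by blast
  qed
  with le show thesis by (intro that)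
qed

text \<open>A null set is enclosed in an open \<open>U\<close> of measure below \<delta>, its
  bounded parts are covered by non-overlapping intervals inside \<open>U\<close>, and finitely many
  of those have \<open>F\<close>-increments summing to less than \<epsilon>; continuity from below
  gives the countable union. \<open>G\<close> continues \<open>F\<close> constantly because
  \<open>interval_measure\<close> lives on the whole line.\<close>

lemma absolutely_continuous_interval_measure:
  assumes F: "AC F" and G_def: "G = (\<lambda>x. F (max 0 (min 1 x)))"
    and mono: "\<And>x y. x \<le> y \<Longrightarrow> G x \<le> G y" and cont: "continuous_on UNIV G"
  shows "absolutely_continuous lborel (interval_measure G)"
proof -
  let ?\<mu> = "interval_measure G"
  note [measurable_cong] = sets_interval_measure
  have small: "emeasure ?\<mu> (A \<inter> {-r..r}) \<le> ennreal \<epsilon>"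
    if A: "A \<in> null_sets lborel" and r: "0 < r" and e: "0 < \<epsilon>" for A r \<epsilon>
  proof -
    obtain \<delta> where d: "0 < \<delta>" and ac: "\<And>(I :: real set set) s t. interval_family 0 1 I s t \<Longrightarrow>
        (\<Sum>i\<in>I. t i - s i) < \<delta> \<Longrightarrow> (\<Sum>i\<in>I. \<bar>F (t i) - F (s i)\<bar>) < \<epsilon>"
      using abs_continuous_familyD[OF F e] by blast
    have Ab: "A \<in> sets borel" using A by auto
    obtain U where U: "open U" "A \<subseteq> U" "emeasure lborel (U - A) < \<delta>"
      using outer_regular_lborel[OF Ab d] by blast
    have U': "emeasure lborel U < \<delta>"
      using U emeasure_Diff_null_set[OF A, of U] by simp
    have mU: "measure lborel U < \<delta>"
      using U' d by (metis emeasure_eq_ennreal_measure ennreal_less_iff measure_nonneg order_less_imp_not_less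
          top.not_eq_extremum ennreal_less_top)
    have box: "box (-r) r \<noteq> {}" using r by simp
    \<comment> \<open>\<open>covering_lemma\<close> wants a gauge at every point. Outside
      \<open>U\<close> any open set will do: each interval comes with a tag in \<open>A\<close>,
      which lies in \<open>U\<close>, and so the interval is inside \<open>U\<close>.\<close>
    obtain \<D> where \<D>: "countable \<D>" "\<And>K. K \<in> \<D> \<Longrightarrow> interior K \<noteq> {} \<and> (\<exists>c d. K = cbox c d)"
      "pairwise (\<lambda>A B. interior A \<inter> interior B = {}) \<D>"
      "\<And>K. K \<in> \<D> \<Longrightarrow> \<exists>x \<in> (A \<inter> {-r..r}) \<inter> K. K \<subseteq> (if x \<in> U then U else UNIV)"
      "A \<inter> {-r..r} \<subseteq> \<Union>\<D>"
    proof (rule covering_lemma[of "A \<inter> {-r..r}" "-r" r "\<lambda>x. if x \<in> U then U else UNIV"])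
      show "gauge (\<lambda>x. if x \<in> U then U else UNIV)" using U(1) by (auto simp: gauge_def)
    qed (use box in auto)
    have KU: "K \<subseteq> U" if KD: "K \<in> \<D>" for K
    proof -
      obtain x where "x \<in> A" "K \<subseteq> (if x \<in> U then U else UNIV)" using \<D>(4)[OF KD] by blast
      then show ?thesis using U(2) by (simp add: subset_iff split: if_splits)
    qed
    \<comment> \<open>The intervals may leave \<open>{0..1}\<close>, where nothing is known of
      \<open>F\<close>. Projecting endpoints to \<open>{0..1}\<close> does not change
      \<open>G\<close>, keeps interiors disjoint and only shortens the intervals.\<close>
    define clamp where "clamp x = max 0 (min 1 x)" for x :: real
    have G: "G x = F (clamp x)" for x by (simp add: G_def clamp_def)
    have K: "K = {Inf K..Sup K}" "Inf K < Sup K" if KD: "K \<in> \<D>" for K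
    proof -
      obtain c d where cd: "K = {c..d}" "interior K \<noteq> {}" using \<D>(2)[OF KD] by auto
      then have "c < d" by (cases "c < d") auto
      then show "K = {Inf K..Sup K}" "Inf K < Sup K" using cd by auto
    qed
    have fin: "emeasure ?\<mu> (\<Union>E) \<le> ennreal \<epsilon>" if E: "finite E" "E \<subseteq> \<D>" for E
    proof -
      let ?s = "\<lambda>K. clamp (Inf K)" and ?t = "\<lambda>K. clamp (Sup K)"
      have int: "{?s K<..<?t K} \<subseteq> interior K" if "K \<in> E" for K
      proof -
        have "{?s K<..<?t K} \<subseteq> {Inf K<..<Sup K}" by (auto simp: clamp_def)
        also have "\<dots> = interior K" using K(1)[of K] that E interior_atLeastAtMost_real by (metis subsetD)
        finally show ?thesis .
      qed
      have f: "interval_family 0 1 E ?s ?t"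
        unfolding interval_family_def
      proof (intro conjI ballI)
        show "disjoint_family_on (\<lambda>i. {clamp (Inf i)<..<clamp (Sup i)}) E"
          using int \<D>(3) E unfolding disjoint_family_on_def pairwise_def by blast
        fix K assume "K \<in> E"
        then show "clamp (Inf K) \<le> clamp (Sup K)" using K(2)[of K] E by (auto simp: clamp_def)
      qed (use E in \<open>auto simp: clamp_def\<close>)
      have "(\<Sum>K\<in>E. ?t K - ?s K) = measure lborel (\<Union>K\<in>E. {?s K<..<?t K})"
        by (rule interval_family_measure[OF f])
      also have "\<dots> \<le> measure lborel U"
      proof (rule measure_mono_fmeasurable)
        show "(\<Union>K\<in>E. {?s K<..<?t K}) \<subseteq> U" using int KU E interior_subset by blast
        show "U \<in> fmeasurable lborel"
          using U(1) U' by (intro fmeasurableI) (auto intro: order_less_trans)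
      qed (use E in auto)
      finally have len: "(\<Sum>K\<in>E. ?t K - ?s K) < \<delta>" using mU by simp
      have "emeasure ?\<mu> (\<Union>E) = emeasure ?\<mu> (\<Union>K\<in>E. K)" by simp
      also have "\<dots> \<le> (\<Sum>K\<in>E. emeasure ?\<mu> K)"
      proof (rule emeasure_subadditive_finite)
        have "K \<in> sets borel" if "K \<in> E" for K using K(1)[of K] that E
          by (metis atLeastAtMost_borel subsetD)
        then show "(\<lambda>K. K) ` E \<subseteq> sets ?\<mu>" by auto
      qed (rule E)
      also have "\<dots> = (\<Sum>K\<in>E. ennreal \<bar>F (?t K) - F (?s K)\<bar>)"
      proof (rule sum.cong[OF refl])
        fix Q assume Q: "Q \<in> E"
        have "emeasure ?\<mu> Q = emeasure ?\<mu> {Inf Q..Sup Q}" using K(1)[of Q] Q E by auto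
        also have "\<dots> = G (Sup Q) - G (Inf Q)"
          using K(2)[of Q] Q E by (intro emeasure_interval_measure_Icc mono cont) auto
        also have "G (Sup Q) - G (Inf Q) = \<bar>F (?t Q) - F (?s Q)\<bar>"
          using mono[of "Inf Q" "Sup Q"] K(2)[of Q] Q E unfolding G by auto
        finally show "emeasure ?\<mu> Q = ennreal \<bar>F (?t Q) - F (?s Q)\<bar>" .
      qed
      also have "\<dots> = ennreal (\<Sum>K\<in>E. \<bar>F (?t K) - F (?s K)\<bar>)" by simp
      also have "\<dots> \<le> ennreal \<epsilon>" using ac[OF f len] by (intro ennreal_leI) simp
      finally show ?thesis .
    qed
    show ?thesis
    proof (cases "\<D> = {}")
      case True
      then have "A \<inter> {-r..r} = {}" using \<D>(5) by auto
      then show ?thesis by simp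
    next
      case False
      define B where "B n = \<Union>(from_nat_into \<D> ` {..<n})" for n
      have Ksets: "K \<in> sets borel" if "K \<in> \<D>" for K using K(1)[OF that] by (metis atLeastAtMost_borel)
      have mem: "from_nat_into \<D> i \<in> \<D>" for i using False by (rule from_nat_into)
      have "(\<Union>n. B n) = \<Union>\<D>"
      proof
        show "(\<Union>n. B n) \<subseteq> \<Union>\<D>" using mem by (auto simp: B_def)
        have "from_nat_into \<D> i \<subseteq> B (Suc i)" for i by (auto simp: B_def)
        then have "\<Union>(range (from_nat_into \<D>)) \<subseteq> (\<Union>n. B n)" by blast
        then show "\<Union>\<D> \<subseteq> (\<Union>n. B n)" by (simp add: range_from_nat_into[OF False \<D>(1)])
      qed
      moreover have "incseq B"
        unfolding incseq_def B_def by (intro allI impI Union_mono image_mono) auto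
      moreover have "range B \<subseteq> sets ?\<mu>" using Ksets mem by (auto simp: B_def)
      ultimately have "emeasure ?\<mu> (\<Union>\<D>) = (SUP n. emeasure ?\<mu> (B n))"
        by (metis SUP_emeasure_incseq)
      also have "\<dots> \<le> ennreal \<epsilon>"
        by (rule SUP_least) (auto simp: B_def intro!: fin mem)
      finally have "emeasure ?\<mu> (\<Union>\<D>) \<le> ennreal \<epsilon>" .
      moreover have "emeasure ?\<mu> (A \<inter> {-r..r}) \<le> emeasure ?\<mu> (\<Union>\<D>)"
        using \<D>(1,5) Ksets by (intro emeasure_mono) (auto intro!: sets.countable_Union)
      ultimately show ?thesis by (rule order_trans[rotated])
    qed
  qed
  show ?thesis
    unfolding absolutely_continuous_def
  proof
    fix A :: "real set" assume A: "A \<in> null_sets lborel"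
    have Ab: "A \<in> sets borel" using A by auto
    have "emeasure ?\<mu> (A \<inter> {- real (Suc n)..real (Suc n)}) = 0" for n
    proof -
      have "emeasure ?\<mu> (A \<inter> {- real (Suc n)..real (Suc n)}) \<le> 0"
      proof (rule ennreal_le_epsilon)
        fix e :: real assume "0 < e"
        then show "emeasure ?\<mu> (A \<inter> {- real (Suc n)..real (Suc n)}) \<le> 0 + ennreal e"
          using small[OF A _ \<open>0 < e\<close>, of "real (Suc n)"] by simp
      qed
      then show ?thesis by simp
    qed
    then have "(\<Union>n. A \<inter> {- real (Suc n)..real (Suc n)}) \<in> null_sets ?\<mu>"
      using Ab by (intro null_sets_UN null_setsI) auto
    moreover have "(\<Union>n. A \<inter> {- real (Suc n)..real (Suc n)}) = A"
    proof -
      have "\<exists>n. - real (Suc n) \<le> x \<and> x \<le> real (Suc n)" for x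
        using real_arch_simple[of "\<bar>x\<bar>"] by (metis abs_le_iff le_SucI minus_le_iff of_nat_le_iff order_trans le_refl)
      then show ?thesis by (auto simp del: of_nat_Suc)
    qed
    ultimately show "A \<in> null_sets ?\<mu>" by simp
  qed
qed

text \<open>The density is the Radon-Nikodym derivative of the Stieltjes measure of \<open>F\<close>
  with respect to Lebesgue measure.\<close>

lemma mono_abs_continuous_density:
  assumes F: "AC F" and mono: "\<And>s t. 0 \<le> s \<Longrightarrow> s \<le> t \<Longrightarrow> t \<le> 1 \<Longrightarrow> F s \<le> F t"
  obtains g where "integrable lborel g"
    "\<And>s t. 0 \<le> s \<Longrightarrow> s \<le> t \<Longrightarrow> t \<le> 1 \<Longrightarrow> F t - F s = (LINT u:{s..t}|lborel. g u)"
proof -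
  define G where "G = (\<lambda>x. F (max 0 (min 1 x)))"
  have Gmono: "G x \<le> G y" if "x \<le> y" for x y
    unfolding G_def using that by (intro mono) auto
  have Gcont: "continuous_on UNIV G"
    unfolding continuous_on_iff
  proof (intro ballI allI impI)
    fix x e :: real assume "0 < e"
    from abs_continuous_close[OF F this] obtain \<delta> where d: "0 < \<delta>"
      "\<And>s t. 0 \<le> s \<Longrightarrow> s \<le> t \<Longrightarrow> t \<le> 1 \<Longrightarrow> t - s < \<delta> \<Longrightarrow> \<bar>F t - F s\<bar> < e" by blast
    have "\<bar>G y - G x\<bar> < e" if "dist y x < \<delta>" for y
    proof (cases "x \<le> y")
      case True
      then show ?thesis unfolding G_def
        using that by (intro d(2)) (auto simp: dist_real_def)
    next
      case False
      then have "\<bar>G x - G y\<bar> < e" unfolding G_def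
        using that by (intro d(2)) (auto simp: dist_real_def)
      then show ?thesis by simp
    qed
    then show "\<exists>d>0. \<forall>y\<in>UNIV. dist y x < d \<longrightarrow> dist (G y) (G x) < e"
      using d(1) by (auto simp: dist_real_def)
  qed
  have "absolutely_continuous lborel (interval_measure G)"
    by (rule absolutely_continuous_interval_measure[OF F G_def Gmono Gcont])
  then obtain f where f: "f \<in> borel_measurable lborel" "density lborel f = interval_measure G"
    using sigma_finite_measure.Radon_Nikodym[OF sigma_finite_lborel, of "interval_measure G"] by auto
  have f': "(\<integral>\<^sup>+u. f u * indicator {s..t} u \<partial>lborel) = ennreal (F t - F s)"
    if st: "0 \<le> s" "s \<le> t" "t \<le> 1" for s t
  proof -
    have "(\<integral>\<^sup>+u. f u * indicator {s..t} u \<partial>lborel) = emeasure (density lborel f) {s..t}"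
      using f(1) by (subst emeasure_density) auto
    also have "\<dots> = G t - G s" unfolding f(2)
      by (intro emeasure_interval_measure_Icc Gmono Gcont st)
    also have "G t - G s = F t - F s" using st by (simp add: G_def)
    finally show ?thesis .
  qed
  have fin: "AE u in lborel. f u * indicator {0..1} u \<noteq> \<infinity>"
    using f(1) f'[of 0 1] by (intro nn_integral_PInf_AE) auto
  \<comment> \<open>The infinite values of \<open>f\<close> on \<open>{0..1}\<close> form a null set
    by \<open>fin\<close>; \<open>enn2real\<close> sends them to 0 and so yields a real
    density.\<close>
  define g where "g u = enn2real (f u * indicator {0..1} u)" for u
  have g[measurable]: "g \<in> borel_measurable borel" using f(1) unfolding g_def by measurable
  have gf: "(\<integral>\<^sup>+u. ennreal (indicator {s..t} u * g u) \<partial>lborel) = ennreal (F t - F s)"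
    if st: "0 \<le> s" "s \<le> t" "t \<le> 1" for s t
  proof -
    have "(\<integral>\<^sup>+u. ennreal (indicator {s..t} u * g u) \<partial>lborel) = (\<integral>\<^sup>+u. f u * indicator {s..t} u \<partial>lborel)"
    proof (rule nn_integral_cong_AE, use fin in eventually_elim)
      case (elim u)
      then show ?case using st
        by (auto simp: g_def indicator_def ennreal_enn2real_if split: if_splits)
    qed
    with f'[OF st] show ?thesis by simp
  qed
  have gnn: "0 \<le> g u" for u by (simp add: g_def)
  have g01: "indicator {0..1} u * g u = g u" for u by (auto simp: g_def indicator_def)
  have "integrable lborel g"
    using gf[of 0 1] gnn by (intro integrableI_nonneg) (auto simp: g01)
  moreover have "F t - F s = (LINT u:{s..t}|lborel. g u)" if st: "0 \<le> s" "s \<le> t" "t \<le> 1" for s t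
    unfolding set_lebesgue_integral_def
    using gf[OF st] gnn mono[OF st] by (subst integral_eq_nn_integral) auto
  ultimately show thesis by (rule that)
qed

text \<open>Jordan decomposition: \<open>z = V - (V - z)\<close>, where both terms are absolutely
  continuous, and monotone because the increments of the variation function \<open>V\<close>
  dominate those of \<open>z\<close>.\<close>

lemma abs_continuous_density:
  assumes z: "AC z"
  obtains g where "integrable lborel g"
    "\<And>s t. 0 \<le> s \<Longrightarrow> s \<le> t \<Longrightarrow> t \<le> 1 \<Longrightarrow> z t - z s = (LINT u:{s..t}|lborel. g u)"
proof -
  obtain V where V: "AC V" "\<And>s t. 0 \<le> s \<Longrightarrow> s \<le> t \<Longrightarrow> t \<le> 1 \<Longrightarrow> \<bar>z t - z s\<bar> \<le> V t - V s"
    using abs_continuous_variation[OF z] by blast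
  obtain g where g: "integrable lborel g"
    "\<And>s t. 0 \<le> s \<Longrightarrow> s \<le> t \<Longrightarrow> t \<le> 1 \<Longrightarrow> V t - V s = (LINT u:{s..t}|lborel. g u)"
  proof (rule mono_abs_continuous_density[OF V(1)])
    fix s t :: real assume "0 \<le> s" "s \<le> t" "t \<le> 1"
    from V(2)[OF this] show "V s \<le> V t" by linarith
  qed blast
  obtain k where k: "integrable lborel k"
    "\<And>s t. 0 \<le> s \<Longrightarrow> s \<le> t \<Longrightarrow> t \<le> 1 \<Longrightarrow> (V t - z t) - (V s - z s) = (LINT u:{s..t}|lborel. k u)"
  proof (rule mono_abs_continuous_density[OF abs_continuous_diff[OF V(1) z]])
    fix s t :: real assume "0 \<le> s" "s \<le> t" "t \<le> 1"
    from V(2)[OF this] show "V s - z s \<le> V t - z t" by linarith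
  qed blast
  show thesis
  proof (rule that)
    show "integrable lborel (\<lambda>u. g u - k u)" using g k by simp
    fix s t :: real assume st: "0 \<le> s" "s \<le> t" "t \<le> 1"
    have "set_integrable lborel {s..t} g" "set_integrable lborel {s..t} k"
      unfolding set_integrable_def by (intro integrable_mult_indicator g k; simp)+
    then show "z t - z s = (LINT u:{s..t}|lborel. g u - k u)"
      using g(2)[OF st] k(2)[OF st] by (simp add: set_integral_diff)
  qed
qed

section \<open>Energy of a path\<close>

text \<open>Lebesgue differentiation. \<open>integrable_ccontinuous_explicit\<close> concerns
  averages to the right; averages to the left are right averages of the reflected function
  \<open>\<lambda>x. g (- x)\<close>, whose exceptional set is mirrored back.\<close>

lemma has_derivative_integral_AE:
  fixes z g :: "real \<Rightarrow> real"
  assumes g: "integrable lborel g"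
    and z: "\<And>s t. 0 \<le> s \<Longrightarrow> s \<le> t \<Longrightarrow> t \<le> 1 \<Longrightarrow> z t - z s = (LINT u:{s..t}|lborel. g u)"
  shows "AE u in lborel. u \<in> {0<..<1} \<longrightarrow> (z has_real_derivative g u) (at u)"
proof -
  have si: "set_integrable lborel {a..b} g" for a b
    unfolding set_integrable_def by (intro integrable_mult_indicator g) simp
  have gi: "g integrable_on cbox a b" for a b using set_borel_integral_eq_integral[OF si] by simp
  have zi: "z t - z s = integral {s..t} g" if "0 \<le> s" "s \<le> t" "t \<le> 1" for s t
    using z[OF that] set_borel_integral_eq_integral(2)[OF si] by simp
  obtain N1 where N1: "negligible N1" "\<And>x e. \<lbrakk>x \<notin> N1; 0 < e\<rbrakk> \<Longrightarrow> \<exists>d>0. \<forall>h. 0 < h \<and> h < d \<longrightarrow>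
      norm (integral (cbox x (x + h *\<^sub>R One)) g /\<^sub>R h ^ DIM(real) - g x) < e"
    using integrable_ccontinuous_explicit[OF gi] by blast
  have gi': "(\<lambda>x. g (- x)) integrable_on cbox a b" for a b
    using Henstock_Kurzweil_Integration.integrable_reflect_real[where f = g and a = "-b" and b = "-a"] gi by simp
  obtain N2 where N2: "negligible N2" "\<And>x e. \<lbrakk>x \<notin> N2; 0 < e\<rbrakk> \<Longrightarrow> \<exists>d>0. \<forall>h. 0 < h \<and> h < d \<longrightarrow>
      norm (integral (cbox x (x + h *\<^sub>R One)) (\<lambda>x. g (- x)) /\<^sub>R h ^ DIM(real) - g (- x)) < e"
    using integrable_ccontinuous_explicit[OF gi'] by blast
  have "negligible (uminus ` N2)"
    by (rule negligible_differentiable_image_negligible[OF order_refl N2(1)]) simp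
  then have "N1 \<union> uminus ` N2 \<in> null_sets lebesgue"
    using N1(1) negligible_Un negligible_iff_null_sets by blast
  then have "AE u in lebesgue. u \<notin> N1 \<union> uminus ` N2" by (rule AE_not_in)
  then have "AE u in lborel. u \<notin> N1 \<union> uminus ` N2" by (simp add: AE_completion_iff)
  then show ?thesis
  proof eventually_elim
    case (elim u)
    show ?case
    proof
      assume "u \<in> {0<..<1}"
      with elim have u: "u \<notin> N1 \<union> uminus ` N2" "u \<in> {0<..<1}" by auto
      then have u2: "- u \<notin> N2" by force
      show "(z has_real_derivative g u) (at u)"
        unfolding DERIV_def LIM_eq
      proof (intro allI impI)
        fix e :: real assume e: "0 < e"
        obtain d1 where d1: "d1 > 0" "\<And>k. 0 < k \<Longrightarrow> k < d1 \<Longrightarrow> \<bar>integral {u..u + k} g / k - g u\<bar> < e"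
          using N1(2)[of u e] u(1) e by (auto simp: divide_inverse mult.commute)
        obtain d2 where d2: "d2 > 0" "\<And>k. 0 < k \<Longrightarrow> k < d2 \<Longrightarrow>
            \<bar>integral {-u..-u + k} (\<lambda>x. g (- x)) / k - g u\<bar> < e"
          using N2(2)[of "-u" e] u2 e by (auto simp: divide_inverse mult.commute)
        \<comment> \<open>The bounds \<open>u\<close> and \<open>1 - u\<close> keep
          \<open>u + k\<close> inside \<open>{0..1}\<close>, the range in which \<open>z\<close> is
          an integral of \<open>g\<close>.\<close>
        define d where "d = Min {d1, d2, u, 1 - u}"
        have d: "0 < d" "d \<le> d1" "d \<le> d2" "d \<le> u" "d \<le> 1 - u"
          using d1(1) d2(1) u(2) by (auto simp: d_def)
        have "norm ((z (u + k) - z u) / k - g u) < e" if k: "k \<noteq> 0" "norm (k - 0) < d" for k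
        proof (cases "0 < k")
          case True
          then have "z (u + k) - z u = integral {u..u + k} g" using k d u by (intro zi) auto
          then show ?thesis using d1(2)[OF True] k d True by simp
        next
          case False
          then have "z u - z (u + k) = integral {u + k..u} g" using k d u by (intro zi) auto
          also have "\<dots> = integral {-u..-u + (-k)} (\<lambda>x. g (- x))"
            using Henstock_Kurzweil_Integration.integral_reflect_real[where f = g and a = "u + k" and b = u] by simp
          finally have eq: "z u - z (u + k) = integral {-u..-u + (-k)} (\<lambda>x. g (- x))" .
          have "(z (u + k) - z u) / k = (z u - z (u + k)) / (- k)" using k by (simp add: field_simps)
          with d2(2)[of "-k"] False k d eq show ?thesis by simp
        qed
        then show "\<exists>s>0. \<forall>x. x \<noteq> 0 \<and> norm (x - 0) < s \<longrightarrow> norm ((z (u + x) - z u) / x - g u) < e"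
          using d(1) by blast
      qed
    qed
  qed
qed

text \<open>These are the sums in F. Riesz's characterization of primitives of square integrable
  functions; the least admissible \<open>E\<close>, if there is one, is the integral of the squared
  derivative. A degenerate interval contributes 0 because division by 0 gives 0.\<close>

definition energy_le :: "(real \<Rightarrow> real) \<Rightarrow> real \<Rightarrow> bool" where
  "energy_le z E \<longleftrightarrow> (\<forall>(I :: nat set) s t. interval_family 0 1 I s t \<longrightarrow>
     (\<Sum>i\<in>I. (z (t i) - z (s i))\<^sup>2 / (t i - s i)) \<le> E)"

lemma energy_leD:
  assumes "energy_le z E" "0 \<le> s" "s \<le> t" "t \<le> 1"
  shows "(z t - z s)\<^sup>2 \<le> E * (t - s)"
proof (cases "s = t")
  case False
  then have "(z t - z s)\<^sup>2 / (t - s) \<le> E"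
    using assms(1)[unfolded energy_le_def, rule_format, of "{0}" "\<lambda>_. s" "\<lambda>_. t"] assms(2-4)
    by (simp add: interval_family_def disjoint_family_on_def)
  then show ?thesis using assms(3) False by (simp add: divide_le_eq)
qed simp

lemma energy_le_nonneg: "energy_le z E \<Longrightarrow> 0 \<le> E"
  unfolding energy_le_def by (auto dest!: spec[of _ "{}"] simp: interval_family_def disjoint_family_on_def)

lemma energy_le_mono: "energy_le z E \<Longrightarrow> E \<le> E' \<Longrightarrow> energy_le z E'"
  unfolding energy_le_def by (meson order_trans)

text \<open>For an absolute increment \<open>d\<close> over length \<open>l\<close>,
  \<open>d \<le> \<eta> / 2 * (d\<^sup>2 / l) + l / (2 * \<eta>)\<close> by expanding
  \<open>(\<eta> * d - l)\<^sup>2\<close>. In the sum, the energy bounds the first part and the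
  total length the second.\<close>

lemma energy_le_imp_abs_continuous:
  assumes E: "energy_le z E"
  shows "AC z"
proof (rule abs_continuousI)
  fix \<epsilon> :: real assume e: "0 < \<epsilon>"
  have E0: "0 \<le> E" by (rule energy_le_nonneg[OF E])
  \<comment> \<open>Chosen so that \<open>\<eta> * E \<le> \<epsilon>\<close>; the
    \<open>+ 1\<close> allows \<open>E = 0\<close>.\<close>
  define \<eta> where "\<eta> = \<epsilon> / (E + 1)"
  have eta: "0 < \<eta>" using e E0 by (simp add: \<eta>_def)
  have "(\<Sum>i\<in>I. \<bar>z (t i) - z (s i)\<bar>) < \<epsilon>"
    if f: "interval_family 0 1 I s t" and l: "(\<Sum>i\<in>I. t i - s i) < \<epsilon> * \<eta>" for I :: "nat set" and s t
  proof -
    have amgm: "\<bar>z (t i) - z (s i)\<bar> \<le> \<eta> / 2 * ((z (t i) - z (s i))\<^sup>2 / (t i - s i)) + (t i - s i) / (2 * \<eta>)"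
      if "i \<in> I" for i
    proof (cases "s i = t i")
      case False
      define l where "l = t i - s i"
      define d where "d = \<bar>z (t i) - z (s i)\<bar>"
      have lp: "0 < l" using False interval_familyD(3)[OF f that] by (simp add: l_def)
      have "0 \<le> (\<eta> * d - l)\<^sup>2 / (2 * \<eta> * l)" using lp eta by simp
      also have "\<dots> = \<eta> / 2 * (d\<^sup>2 / l) + l / (2 * \<eta>) - d"
        using lp eta by (simp add: field_simps power2_eq_square)
      finally show ?thesis by (simp add: d_def l_def)
    qed simp
    have "(\<Sum>i\<in>I. \<bar>z (t i) - z (s i)\<bar>) \<le>
        (\<Sum>i\<in>I. \<eta> / 2 * ((z (t i) - z (s i))\<^sup>2 / (t i - s i)) + (t i - s i) / (2 * \<eta>))"
      by (intro sum_mono amgm)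
    also have "\<dots> = \<eta> / 2 * (\<Sum>i\<in>I. (z (t i) - z (s i))\<^sup>2 / (t i - s i)) + (\<Sum>i\<in>I. t i - s i) / (2 * \<eta>)"
      by (simp add: sum.distrib sum_distrib_left sum_divide_distrib)
    also have "\<dots> < \<eta> / 2 * E + \<epsilon> * \<eta> / (2 * \<eta>)"
      using E[unfolded energy_le_def, rule_format, OF f] l eta
      by (intro add_le_less_mono mult_left_mono divide_strict_right_mono) auto
    also have "\<dots> = (\<eta> * E + \<epsilon>) / 2" using eta by (simp add: field_simps)
    also have "\<eta> * E \<le> \<epsilon>" using E0 e by (simp add: \<eta>_def field_simps)
    finally show ?thesis by simp
  qed
  then show "\<exists>\<delta>>0. \<forall>(I :: nat set) s t. interval_family 0 1 I s t \<longrightarrow> (\<Sum>i\<in>I. t i - s i) < \<delta> \<longrightarrow>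
       (\<Sum>i\<in>I. \<bar>z (t i) - z (s i)\<bar>) < \<epsilon>"
    using e eta by (intro exI[of _ "\<epsilon> * \<eta>"]) auto
qed

text \<open>Cauchy-Schwarz on each interval, from \<open>0 \<le> \<integral> (g - l)\<^sup>2\<close> with \<open>l\<close> the mean of \<open>g\<close>.\<close>

lemma energy_le_integral:
  assumes g: "integrable lborel g"
    and z: "\<And>s t. 0 \<le> s \<Longrightarrow> s \<le> t \<Longrightarrow> t \<le> 1 \<Longrightarrow> z t - z s = (LINT u:{s..t}|lborel. g u)"
    and E: "(\<integral>\<^sup>+u\<in>{0..1}. ennreal ((g u)\<^sup>2) \<partial>lborel) \<le> ennreal E" and E0: "0 \<le> E"
  shows "energy_le z E"
  unfolding energy_le_def
proof (intro allI impI)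
  fix I :: "nat set" and s t assume f: "interval_family 0 1 I s t"
  note D = interval_familyD[OF f]
  note [measurable] = borel_measurable_integrable[OF g]
  have E': "(\<integral>\<^sup>+u. ennreal ((g u)\<^sup>2 * indicator {0..1} u) \<partial>lborel) \<le> ennreal E"
    using E by (simp add: ennreal_mult' ennreal_indicator[symmetric])
  have int2: "integrable lborel (\<lambda>u. (g u)\<^sup>2 * indicator {0..1} u)"
    by (rule integrableI_nonneg) (use E' in \<open>auto intro: le_less_trans\<close>)
  have int2': "integrable lborel (\<lambda>u. (g u)\<^sup>2 * indicator {a<..<b} u)" if "0 \<le> a" "b \<le> 1" for a b
    by (rule Bochner_Integration.integrable_bound[OF int2]) (use that in \<open>auto simp: indicator_def\<close>)
  have int1: "integrable lborel (\<lambda>u. g u * indicator {a<..<b} u)" for a b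
    by (rule integrable_real_mult_indicator[OF _ g]) simp
  have single: "(z b - z a)\<^sup>2 / (b - a) \<le> (LINT u|lborel. (g u)\<^sup>2 * indicator {a<..<b} u)"
    if ab: "0 \<le> a" "a \<le> b" "b \<le> 1" for a b
  proof (cases "a = b")
    case True
    then show ?thesis by (simp add: Bochner_Integration.integral_nonneg)
  next
    case False
    define l where "l = (z b - z a) / (b - a)"
    have "z b - z a = (LINT u:{a..b}|lborel. g u)" by (rule z[OF ab])
    also have "\<dots> = (LINT u|lborel. g u * indicator {a<..<b} u)"
      unfolding set_lebesgue_integral_def
    proof (rule integral_cong_AE)
      show "AE u in lborel. indicator {a..b} u *\<^sub>R g u = g u * indicator {a<..<b} u"
        using AE_lborel_singleton[of a] AE_lborel_singleton[of b]
        by eventually_elim (auto simp: indicator_def)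
    qed auto
    finally have zg: "z b - z a = (LINT u|lborel. g u * indicator {a<..<b} u)" .
    have "0 \<le> (LINT u|lborel. (g u - l)\<^sup>2 * indicator {a<..<b} u)"
      by (intro Bochner_Integration.integral_nonneg) simp
    also have "\<dots> = (LINT u|lborel. (g u)\<^sup>2 * indicator {a<..<b} u - 2 * l * (g u * indicator {a<..<b} u)
        + l\<^sup>2 * indicator {a<..<b} u)"
      by (intro Bochner_Integration.integral_cong) (auto simp: power2_eq_square algebra_simps)
    also have "\<dots> = (LINT u|lborel. (g u)\<^sup>2 * indicator {a<..<b} u) - 2 * l * (z b - z a) + l\<^sup>2 * (b - a)"
      using ab int2' int1 by (simp add: zg)
    also have "\<dots> = (LINT u|lborel. (g u)\<^sup>2 * indicator {a<..<b} u) - (z b - z a)\<^sup>2 / (b - a)"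
      using False ab by (simp add: l_def power2_eq_square)
    finally show ?thesis by simp
  qed
  have "(\<Sum>i\<in>I. (z (t i) - z (s i))\<^sup>2 / (t i - s i)) \<le>
      (\<Sum>i\<in>I. LINT u|lborel. (g u)\<^sup>2 * indicator {s i<..<t i} u)"
    by (intro sum_mono single D)
  also have "\<dots> = (LINT u|lborel. (\<Sum>i\<in>I. (g u)\<^sup>2 * indicator {s i<..<t i} u))"
    by (intro Bochner_Integration.integral_sum[symmetric] int2' D)
  also have "\<dots> \<le> (LINT u|lborel. (g u)\<^sup>2 * indicator {0..1} u)"
  proof (rule integral_mono)
    show "integrable lborel (\<lambda>u. \<Sum>i\<in>I. (g u)\<^sup>2 * indicator {s i<..<t i} u)"
      by (intro Bochner_Integration.integrable_sum int2' D)
    fix u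
    \<comment> \<open>Disjointness keeps the sum of indicators at most 1, so the separate integrals
      add up to at most the integral over \<open>{0..1}\<close>.\<close>
    have "(\<Sum>i\<in>I. indicator {s i<..<t i} u) = (indicator (\<Union>i\<in>I. {s i<..<t i}) u :: real)"
      using f by (intro indicator_UN_disjoint[symmetric]) (auto simp: interval_family_def)
    also have "\<dots> \<le> indicator {0..1} u" using D(2,4) by (force simp: indicator_def)
    finally show "(\<Sum>i\<in>I. (g u)\<^sup>2 * indicator {s i<..<t i} u) \<le> (g u)\<^sup>2 * indicator {0..1} u"
      by (simp add: sum_distrib_left[symmetric] mult_left_mono)
  qed (rule int2)
  also have "\<dots> \<le> E"
    using E' E0 by (subst integral_eq_nn_integral) (auto intro: enn2real_leI)
  finally show "(\<Sum>i\<in>I. (z (t i) - z (s i))\<^sup>2 / (t i - s i)) \<le> E" .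
qed

text \<open>The linearization errors at the two endpoints are at most \<open>e / 2\<close> times
  their distances from \<open>u\<close>, and since \<open>u\<close> lies between the endpoints these
  distances add up to \<open>r n - l n\<close>.\<close>

lemma DERIV_straddle:
  fixes z :: "real \<Rightarrow> real"
  assumes D: "(z has_real_derivative D) (at u)"
    and lr: "\<And>n. l n \<le> u" "\<And>n. u < r n" and lim: "(\<lambda>n. r n - l n) \<longlonglongrightarrow> 0"
  shows "(\<lambda>n. (z (r n) - z (l n)) / (r n - l n)) \<longlonglongrightarrow> D"
proof (rule LIMSEQ_I)
  fix e :: real assume e: "0 < e"
  then have e2: "0 < e / 2" by simp
  then have "\<exists>d>0. \<forall>y. norm (y - u) < d \<longrightarrow> norm (z y - z u - D * (y - u)) \<le> e / 2 * norm (y - u)"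
    using D[unfolded has_field_derivative_def has_derivative_at_alt] by blast
  then obtain d where d: "0 < d" "\<And>y. \<bar>y - u\<bar> < d \<Longrightarrow> \<bar>z y - z u - D * (y - u)\<bar> \<le> e / 2 * \<bar>y - u\<bar>"
    by auto
  obtain n0 where n0: "\<And>n. n \<ge> n0 \<Longrightarrow> \<bar>r n - l n\<bar> < d"
    using LIMSEQ_D[OF lim d(1)] by auto
  have "norm ((z (r n) - z (l n)) / (r n - l n) - D) < e" if "n \<ge> n0" for n
  proof -
    have len: "0 < r n - l n" "r n - l n < d" using lr[of n] n0[OF that] by auto
    have "\<bar>z (r n) - z (l n) - D * (r n - l n)\<bar> \<le>
        \<bar>z (r n) - z u - D * (r n - u)\<bar> + \<bar>z (l n) - z u - D * (l n - u)\<bar>"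
      by (simp add: algebra_simps)
    also have "\<dots> \<le> e / 2 * \<bar>r n - u\<bar> + e / 2 * \<bar>l n - u\<bar>"
      using lr[of n] len by (intro add_mono d(2)) auto
    also have "\<dots> = e / 2 * (\<bar>r n - u\<bar> + \<bar>l n - u\<bar>)" by (rule distrib_left[symmetric])
    also have "\<bar>r n - u\<bar> + \<bar>l n - u\<bar> = r n - l n" using lr[of n] by simp
    finally have *: "\<bar>z (r n) - z (l n) - D * (r n - l n)\<bar> \<le> e / 2 * (r n - l n)" .
    have "\<bar>(z (r n) - z (l n)) / (r n - l n) - D\<bar> = \<bar>z (r n) - z (l n) - D * (r n - l n)\<bar> / (r n - l n)"
      using len by (simp add: field_simps)
    also have "\<dots> \<le> e / 2" using * len by (simp add: divide_le_eq)
    finally show ?thesis using e by simp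
  qed
  then show "\<exists>n0. \<forall>n\<ge>n0. norm ((z (r n) - z (l n)) / (r n - l n) - D) < e" by blast
qed

text \<open>\<open>Q n\<close> is the step function of squared difference quotients on the grid of
  mesh \<open>1 / (n + 1)\<close>. Its integral is an energy sum, hence at most \<open>E\<close>,
  and it tends to \<open>(g u)\<^sup>2\<close> wherever \<open>g u\<close> is the derivative;
  Fatou's lemma concludes.\<close>

lemma energy_le_Fatou:
  assumes E: "energy_le z E" and g[measurable]: "g \<in> borel_measurable borel"
    and D: "AE u in lborel. u \<in> {0<..<1} \<longrightarrow> (z has_real_derivative g u) (at u)"
  shows "(\<integral>\<^sup>+u\<in>{0..1}. ennreal ((g u)\<^sup>2) \<partial>lborel) \<le> ennreal E"
proof -
  define q where "q N i = ((z (real (Suc i) / N) - z (real i / N)) * N)\<^sup>2" for N i :: nat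
  define Q where "Q n u = (\<Sum>i<Suc n. ennreal (q (Suc n) i) *
      indicator {real i / Suc n..<real (Suc i) / Suc n} u)" for n u
  have [measurable]: "Q n \<in> borel_measurable lborel" for n unfolding Q_def by measurable
  have le: "(\<integral>\<^sup>+u. Q n u \<partial>lborel) \<le> ennreal E" for n
  proof -
    let ?N = "real (Suc n)"
    have "(\<integral>\<^sup>+u. Q n u \<partial>lborel) = (\<Sum>i<Suc n. ennreal (q (Suc n) i) *
        emeasure lborel {real i / ?N..<real (Suc i) / ?N})"
      unfolding Q_def by (subst nn_integral_sum) (auto simp: nn_integral_cmult)
    also have "\<dots> = (\<Sum>i<Suc n. ennreal ((z (real (Suc i) / ?N) - z (real i / ?N))\<^sup>2
        / (real (Suc i) / ?N - real i / ?N)))"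
    proof (rule sum.cong[OF refl])
      fix i
      have "emeasure lborel {real i / ?N..<real (Suc i) / ?N} = ennreal (1 / ?N)"
        by (simp add: divide_right_mono diff_divide_distrib[symmetric])
      moreover have "q (Suc n) i * (1 / ?N) = (z (real (Suc i) / ?N) - z (real i / ?N))\<^sup>2
        / (real (Suc i) / ?N - real i / ?N)"
        by (simp add: q_def diff_divide_distrib[symmetric] power2_eq_square)
      ultimately show "ennreal (q (Suc n) i) * emeasure lborel {real i / ?N..<real (Suc i) / ?N} =
          ennreal ((z (real (Suc i) / ?N) - z (real i / ?N))\<^sup>2 / (real (Suc i) / ?N - real i / ?N))"
        by (metis ennreal_mult' q_def zero_le_power2)
    qed
    also have "\<dots> = ennreal (\<Sum>i<Suc n. (z (real (Suc i) / ?N) - z (real i / ?N))\<^sup>2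
        / (real (Suc i) / ?N - real i / ?N))"
      by (rule sum_ennreal) (auto intro!: divide_nonneg_nonneg divide_right_mono)
    also have "\<dots> \<le> ennreal E"
    proof (intro ennreal_leI E[unfolded energy_le_def, rule_format] interval_familyI)
      fix i j x assume "real i / ?N < x" "x < real (Suc i) / ?N" "real j / ?N < x" "x < real (Suc j) / ?N"
      then have "real i / ?N < real (Suc j) / ?N" "real j / ?N < real (Suc i) / ?N" by linarith+
      then show "i = j" by (simp add: divide_less_cancel)
    qed (auto simp: divide_right_mono field_simps)
    finally show ?thesis .
  qed
  have lim: "(\<lambda>n. Q n u) \<longlonglongrightarrow> ennreal ((g u)\<^sup>2)" 
    if u: "u \<in> {0<..<1}" and d: "(z has_real_derivative g u) (at u)" for u
  proof -
    \<comment> \<open>The index of the cell that contains \<open>u\<close>; the cells are half-open,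
      so exactly one term of \<open>Q n u\<close> survives.\<close>
    define i where "i n = nat \<lfloor>u * Suc n\<rfloor>" for n
    have i: "real (i n) \<le> u * Suc n" "u * Suc n < real (Suc (i n))" for n
      using u unfolding i_def by (auto simp: of_nat_nat) linarith+
    have in_le: "i n < Suc n" for n
    proof -
      have "real (i n) \<le> u * Suc n" by (rule i)
      also have "\<dots> < real (Suc n)" using u by (simp del: of_nat_Suc)
      finally show ?thesis by (simp only: of_nat_less_iff)
    qed
    have Qeq: "Q n u = ennreal (q (Suc n) (i n))" for n
    proof -
      have ind: "indicator {real j / Suc n..<real (Suc j) / Suc n} u = (if j = i n then 1 else 0 :: ennreal)" for j
      proof -
        have "u \<in> {real j / Suc n..<real (Suc j) / Suc n} \<longleftrightarrow> real j \<le> u * Suc n \<and> u * Suc n < real (Suc j)"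
          by (simp add: divide_le_eq less_divide_eq del: of_nat_Suc)
        also have "\<dots> \<longleftrightarrow> j = i n"
        proof
          assume "real j \<le> u * Suc n \<and> u * Suc n < real (Suc j)"
          with i[of n] have "real j < real (Suc (i n))" "real (i n) < real (Suc j)" by linarith+
          then show "j = i n" by simp
        qed (use i[of n] in auto)
        finally show ?thesis by (simp add: indicator_def)
      qed
      then have "Q n u = (\<Sum>j<Suc n. if j = i n then ennreal (q (Suc n) j) else 0)"
        unfolding Q_def by (intro sum.cong refl) (subst ind, simp)
      then show ?thesis using in_le[of n] by (simp only: sum.delta' sum.delta finite_lessThan lessThan_iff if_True)
    qed
    have "(\<lambda>n. (z (real (Suc (i n)) / Suc n) - z (real (i n) / Suc n)) / (real (Suc (i n)) / Suc n - real (i n) / Suc n))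
        \<longlonglongrightarrow> g u"
    proof (rule DERIV_straddle[OF d])
      show "real (i n) / real (Suc n) \<le> u" "u < real (Suc (i n)) / real (Suc n)" for n
        using i[of n] by (simp_all add: divide_le_eq less_divide_eq del: of_nat_Suc)
      have "(\<lambda>n. 1 / real (Suc n)) \<longlonglongrightarrow> 0" using LIMSEQ_inverse_real_of_nat by (simp add: inverse_eq_divide)
      then show "(\<lambda>n. real (Suc (i n)) / real (Suc n) - real (i n) / real (Suc n)) \<longlonglongrightarrow> 0"
        by (simp add: diff_divide_distrib[symmetric])
    qed
    then have "(\<lambda>n. (z (real (Suc (i n)) / Suc n) - z (real (i n) / Suc n)) * Suc n) \<longlonglongrightarrow> g u"
      by (simp add: diff_divide_distrib[symmetric])
    then show ?thesis unfolding Qeq q_def by (intro tendsto_intros)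
  qed
  have "(\<integral>\<^sup>+u\<in>{0..1}. ennreal ((g u)\<^sup>2) \<partial>lborel) \<le> (\<integral>\<^sup>+u. liminf (\<lambda>n. Q n u) \<partial>lborel)"
  proof (rule nn_integral_mono_AE)
    show "AE u in lborel. ennreal ((g u)\<^sup>2) * indicator {0..1} u \<le> liminf (\<lambda>n. Q n u)"
      using D AE_lborel_singleton[of "0 :: real"] AE_lborel_singleton[of "1 :: real"]
    proof eventually_elim
      case (elim u)
      show ?case
      proof (cases "u \<in> {0<..<1}")
        case True
        then show ?thesis using lim_imp_Liminf[OF sequentially_bot lim[OF True]] elim by simp
      qed (use elim in \<open>auto simp: indicator_def\<close>)
    qed
  qed
  also have "\<dots> \<le> liminf (\<lambda>n. \<integral>\<^sup>+u. Q n u \<partial>lborel)"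
    by (rule nn_integral_liminf) measurable
  also have "\<dots> \<le> ennreal E"
    using Liminf_mono[of "\<lambda>n. \<integral>\<^sup>+u. Q n u \<partial>lborel" "\<lambda>_. ennreal E" sequentially] le
    by (simp add: Liminf_const)
  finally show ?thesis .
qed

text \<open>Almost everywhere on \<open>{0..1}\<close>, \<open>deriv z\<close> equals the density.
  This suffices for \<open>nn_integral\<close> without any measurability of \<open>deriv z\<close>,
  and the Borel density brings the integral from \<open>lebesgue\<close> back to
  \<open>lborel\<close>.\<close>

lemma rate_I_eq_integral:
  assumes z: "AC z" "z 0 = 0"
  obtains g where "integrable lborel g" 
    "\<And>s t. 0 \<le> s \<Longrightarrow> s \<le> t \<Longrightarrow> t \<le> 1 \<Longrightarrow> z t - z s = (LINT u:{s..t}|lborel. g u)"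
    "rate_I z = ereal (1/2) * enn2ereal (\<integral>\<^sup>+u\<in>{0..1}. ennreal ((g u)\<^sup>2) \<partial>lborel)"
proof -
  obtain g where g: "integrable lborel g"
    "\<And>s t. 0 \<le> s \<Longrightarrow> s \<le> t \<Longrightarrow> t \<le> 1 \<Longrightarrow> z t - z s = (LINT u:{s..t}|lborel. g u)"
    using abs_continuous_density[OF z(1)] by blast
  note [measurable] = borel_measurable_integrable[OF g(1)]
  have "AE u in lborel. u \<in> {0<..<1} \<longrightarrow> (z has_real_derivative g u) (at u)"
    using g by (rule has_derivative_integral_AE)
  then have "AE u in lborel. u \<in> {0<..<1} \<longrightarrow> deriv z u = g u"
    by eventually_elim (auto intro: DERIV_imp_deriv)
  then have "AE u in lborel. ennreal ((deriv z u)\<^sup>2) * indicator {0..1} u = ennreal ((g u)\<^sup>2) * indicator {0..1} u"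
    using AE_lborel_singleton[of "0 :: real"] AE_lborel_singleton[of "1 :: real"]
    by eventually_elim (auto simp: indicator_def)
  then have "(\<integral>\<^sup>+u\<in>{0..1}. ennreal ((deriv z u)\<^sup>2) \<partial>lebesgue) = (\<integral>\<^sup>+u\<in>{0..1}. ennreal ((g u)\<^sup>2) \<partial>lebesgue)"
    by (intro nn_integral_cong_AE AE_completion)
  also have "\<dots> = (\<integral>\<^sup>+u\<in>{0..1}. ennreal ((g u)\<^sup>2) \<partial>lborel)"
    by (rule nn_integral_completion)
  finally have "rate_I z = ereal (1/2) * enn2ereal (\<integral>\<^sup>+u\<in>{0..1}. ennreal ((g u)\<^sup>2) \<partial>lborel)"
    using z by (simp add: rate_I_def)
  with g show thesis by (intro that)
qed

lemma half_enn2ereal_le_iff: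
  assumes "0 \<le> E"
  shows "ereal (1/2) * enn2ereal N \<le> ereal (E / 2) \<longleftrightarrow> N \<le> ennreal E"
proof (cases N)
  case (real r)
  then show ?thesis using assms by (simp add: enn2ereal_ennreal)
qed (use assms in \<open>simp add: top_unique\<close>)

text \<open>A bound on the rate gives one on the energy by Cauchy-Schwarz. Conversely, finite energy
  first gives absolute continuity, which rules out the default value \<infinity>, and then Fatou's
  lemma bounds the integral.\<close>

lemma rate_I_le_iff:
  assumes E: "0 \<le> E"
  shows "rate_I z \<le> ereal (E / 2) \<longleftrightarrow> z 0 = 0 \<and> energy_le z E"
proof
  assume r: "rate_I z \<le> ereal (E / 2)"
  then have z: "AC z" "z 0 = 0" by (auto simp: rate_I_def split: if_splits)
  obtain g where g: "integrable lborel g" 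
    "\<And>s t. 0 \<le> s \<Longrightarrow> s \<le> t \<Longrightarrow> t \<le> 1 \<Longrightarrow> z t - z s = (LINT u:{s..t}|lborel. g u)"
    "rate_I z = ereal (1/2) * enn2ereal (\<integral>\<^sup>+u\<in>{0..1}. ennreal ((g u)\<^sup>2) \<partial>lborel)"
    using rate_I_eq_integral[OF z] by blast
  have "(\<integral>\<^sup>+u\<in>{0..1}. ennreal ((g u)\<^sup>2) \<partial>lborel) \<le> ennreal E"
    using r g(3) half_enn2ereal_le_iff[OF E] by simp
  with g(1,2) have "energy_le z E" using E by (rule energy_le_integral)
  with z show "z 0 = 0 \<and> energy_le z E" by simp
next
  assume z: "z 0 = 0 \<and> energy_le z E"
  then have ac: "AC z" by (auto intro: energy_le_imp_abs_continuous)
  obtain g where g: "integrable lborel g" 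
    "\<And>s t. 0 \<le> s \<Longrightarrow> s \<le> t \<Longrightarrow> t \<le> 1 \<Longrightarrow> z t - z s = (LINT u:{s..t}|lborel. g u)"
    "rate_I z = ereal (1/2) * enn2ereal (\<integral>\<^sup>+u\<in>{0..1}. ennreal ((g u)\<^sup>2) \<partial>lborel)"
    using rate_I_eq_integral[OF ac] z by blast
  have "(\<integral>\<^sup>+u\<in>{0..1}. ennreal ((g u)\<^sup>2) \<partial>lborel) \<le> ennreal E"
  proof (rule energy_le_Fatou)
    show "AE u in lborel. u \<in> {0<..<1} \<longrightarrow> (z has_real_derivative g u) (at u)"
      using g(1,2) by (rule has_derivative_integral_AE)
  qed (use z borel_measurable_integrable[OF g(1)] in auto)
  then show "rate_I z \<le> ereal (E / 2)" using g(3) half_enn2ereal_le_iff[OF E] by simp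
qed

section \<open>Compactness of the level sets in D[0,1]\<close>

definition energy_level :: "real \<Rightarrow> (real \<Rightarrow> real) set" where
  "energy_level E = {z \<in> D01. z 0 = 0 \<and> energy_le z E}"

lemma sup_dist_least:
  assumes "z \<in> D01" "w \<in> D01" "\<And>t. 0 \<le> t \<Longrightarrow> t \<le> 1 \<Longrightarrow> \<bar>z t - w t\<bar> \<le> e"
  shows "sup_dist z w \<le> e"
  unfolding sup_dist_def using assms by (auto intro!: cSUP_least)

lemma D01_continuousI:
  assumes ext: "z \<in> extensional {0..1}" and cont: "continuous_on {0..1} z"
  shows "z \<in> D01"
proof -
  have "(z \<longlongrightarrow> z t) (at_right t)" if t: "t \<in> {0..<1}" for t
  proof -
    have "continuous_on {t..1} z" using t by (intro continuous_on_subset[OF cont]) auto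
    then show ?thesis using t by (intro continuous_on_Icc_at_rightD) auto
  qed
  moreover have "(z \<longlongrightarrow> z t) (at_left t)" if t: "t \<in> {0<..1}" for t
  proof -
    have "continuous_on {0..t} z" using t by (intro continuous_on_subset[OF cont]) auto
    then show ?thesis using t by (intro continuous_on_Icc_at_leftD) auto
  qed
  ultimately show ?thesis using ext unfolding D01_def by blast
qed

text \<open>All paths with the same energy bound share a Hoelder modulus of exponent 1/2, which
  makes the level sets equicontinuous.\<close>

lemma energy_le_modulus:
  assumes E: "energy_le z E" and st: "s \<in> {0..1}" "t \<in> {0..1}"
  shows "\<bar>z t - z s\<bar> \<le> sqrt (E * \<bar>t - s\<bar>)"
proof -
  have "(z t - z s)\<^sup>2 \<le> E * \<bar>t - s\<bar>"
  proof (cases "s \<le> t")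
    case True
    then show ?thesis using energy_leD[OF E, of s t] st by auto
  next
    case False
    then show ?thesis using energy_leD[OF E, of t s] st by (auto simp: power2_commute)
  qed
  then show ?thesis by (metis real_le_rsqrt real_sqrt_abs real_sqrt_le_mono)
qed

lemma sqrt_modulus_delta:
  fixes E e :: real
  assumes "0 \<le> E" "0 < e"
  obtains d where "0 < d" "\<And>u. \<bar>u\<bar> < d \<Longrightarrow> sqrt (E * \<bar>u\<bar>) < e"
proof -
  define d where "d = e\<^sup>2 / (E + 1)"
  have "sqrt (E * \<bar>u\<bar>) < e" if "\<bar>u\<bar> < d" for u
  proof -
    have "E * \<bar>u\<bar> \<le> (E + 1) * \<bar>u\<bar>" by (simp add: distrib_right)
    also have "\<dots> < (E + 1) * d" using that assms by (intro mult_strict_left_mono) auto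
    also have "\<dots> = e\<^sup>2" using assms by (simp add: d_def)
    finally show ?thesis using assms by (simp add: real_less_lsqrt)
  qed
  moreover have "0 < d" using assms by (simp add: d_def)
  ultimately show thesis by (intro that)
qed

lemma energy_le_continuous_on:
  assumes E: "energy_le z E"
  shows "continuous_on {0..1} z"
  unfolding continuous_on_iff
proof (intro ballI allI impI)
  fix t e :: real assume t: "t \<in> {0..1}" and e: "0 < e"
  obtain d where d: "0 < d" "\<And>u. \<bar>u\<bar> < d \<Longrightarrow> sqrt (E * \<bar>u\<bar>) < e"
    using sqrt_modulus_delta[OF energy_le_nonneg[OF E] e] by blast
  have "\<bar>z s - z t\<bar> < e" if "s \<in> {0..1}" "\<bar>s - t\<bar> < d" for s
    using energy_le_modulus[OF E t that(1)] d(2)[OF that(2)] by simp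
  with d(1) show "\<exists>d>0. \<forall>s\<in>{0..1}. dist s t < d \<longrightarrow> dist (z s) (z t) < e"
    by (auto simp: dist_real_def)
qed

lemma energy_le_limit:
  assumes E: "\<forall>\<^sub>F n in sequentially. energy_le (\<sigma> n) E"
    and lim: "\<And>t. 0 \<le> t \<Longrightarrow> t \<le> 1 \<Longrightarrow> (\<lambda>n. \<sigma> n t) \<longlonglongrightarrow> z t"
  shows "energy_le z E"
  unfolding energy_le_def
proof (intro allI impI)
  fix I :: "nat set" and s t assume f: "interval_family 0 1 I s t"
  have "(\<lambda>n. \<Sum>i\<in>I. (\<sigma> n (t i) - \<sigma> n (s i))\<^sup>2 / (t i - s i)) \<longlonglongrightarrow> (\<Sum>i\<in>I. (z (t i) - z (s i))\<^sup>2 / (t i - s i))"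
  proof (rule tendsto_sum)
    fix i assume "i \<in> I"
    note D = interval_familyD(2-4)[OF f this]
    then show "(\<lambda>n. (\<sigma> n (t i) - \<sigma> n (s i))\<^sup>2 / (t i - s i)) \<longlonglongrightarrow> (z (t i) - z (s i))\<^sup>2 / (t i - s i)"
      \<comment> \<open>Multiplication by the constant \<open>inverse (t i - s i)\<close> also
        covers degenerate intervals, where a quotient rule would need a nonzero denominator.\<close>
      unfolding divide_inverse by (intro tendsto_mult tendsto_power tendsto_diff lim tendsto_const) auto
  qed
  then show "(\<Sum>i\<in>I. (z (t i) - z (s i))\<^sup>2 / (t i - s i)) \<le> E"
    by (rule tendsto_upperbound) (use E f in \<open>auto simp: energy_le_def elim!: eventually_mono\<close>)
qed

lemma limitin_D01_iff:
  "limitin D01_top \<sigma> l sequentially \<longleftrightarrow>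
     l \<in> D01 \<and> (\<forall>e>0. \<forall>\<^sub>F n in sequentially. \<sigma> n \<in> D01 \<and> sup_dist (\<sigma> n) l < e)"
  unfolding D01_top_def by (rule D01.limit_metric_sequentially[unfolded eventually_sequentially[symmetric]])

lemma limitin_D01_pointwise:
  assumes "limitin D01_top \<sigma> l sequentially" "0 \<le> t" "t \<le> 1"
  shows "(\<lambda>n. \<sigma> n t) \<longlonglongrightarrow> l t"
proof (rule tendstoI)
  fix e :: real assume "0 < e"
  with assms(1) have l: "l \<in> D01" and "\<forall>\<^sub>F n in sequentially. \<sigma> n \<in> D01 \<and> sup_dist (\<sigma> n) l < e"
    by (auto simp: limitin_D01_iff)
  from this(2) show "\<forall>\<^sub>F n in sequentially. dist (\<sigma> n t) (l t) < e"
  proof eventually_elim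
    case (elim n)
    then show ?case using sup_dist_upper[of "\<sigma> n" l t] l assms(2,3) by (simp add: dist_real_def)
  qed
qed

lemma compactin_energy_level: "compactin D01_top (energy_level E)"
  unfolding D01_top_def D01.compactin_sequentially
proof (intro conjI allI impI)
  show "energy_level E \<subseteq> D01" by (auto simp: energy_level_def)
  fix \<sigma> :: "nat \<Rightarrow> real \<Rightarrow> real" assume s: "range \<sigma> \<subseteq> energy_level E"
  then have \<sigma>: "\<sigma> n \<in> D01" "\<sigma> n 0 = 0" "energy_le (\<sigma> n) E" for n by (auto simp: energy_level_def)
  have E: "0 \<le> E" by (rule energy_le_nonneg[OF \<sigma>(3)])
  have mod: "norm (\<sigma> n s - \<sigma> n t) \<le> sqrt (E * \<bar>s - t\<bar>)" if "s \<in> {0..1}" "t \<in> {0..1}" for n s t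
    using energy_le_modulus[OF \<sigma>(3) that(2,1)] by simp
  obtain g k where g: "continuous_on {0..1} g" and k: "strict_mono (k :: nat \<Rightarrow> nat)" and
    lim: "\<And>e. 0 < e \<Longrightarrow> \<exists>N. \<forall>n x. n \<ge> N \<and> x \<in> {0..1} \<longrightarrow> norm (\<sigma> (k n) x - g x) < e"
  proof (rule Arzela_Ascoli[of "{0..1::real}" \<sigma> "sqrt E"])
    show "norm (\<sigma> n x) \<le> sqrt E" if "x \<in> {0..1}" for n x
    proof -
      have "norm (\<sigma> n x) \<le> sqrt (E * \<bar>x\<bar>)" using mod[of x 0 n] that \<sigma>(2) by simp
      also have "\<dots> \<le> sqrt E" using that E by (intro real_sqrt_le_mono) (simp add: mult_left_le)
      finally show ?thesis .
    qed
    show "\<exists>d. 0 < d \<and> (\<forall>n y. y \<in> {0..1} \<and> norm (x - y) < d \<longrightarrow> norm (\<sigma> n x - \<sigma> n y) < e)"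
      if x: "x \<in> {0..1}" and e: "0 < e" for x e
    proof -
      obtain d where d: "0 < d" "\<And>u. \<bar>u\<bar> < d \<Longrightarrow> sqrt (E * \<bar>u\<bar>) < e"
        using sqrt_modulus_delta[OF E e] by blast
      have "norm (\<sigma> n x - \<sigma> n y) < e" if "y \<in> {0..1}" "norm (x - y) < d" for n y
        using mod[OF x that(1), of n] d(2)[of "x - y"] that(2) by simp
      with d(1) show ?thesis by blast
    qed
  qed auto
  \<comment> \<open>Arzela-Ascoli determines the limit on \<open>{0..1}\<close> only; restriction
    gives the representative that belongs to \<open>D01\<close>.\<close>
  define l where "l = restrict g {0..1}"
  have "continuous_on {0..1} l" using g by (subst continuous_on_cong[of _ _ _ g]) (auto simp: l_def)
  then have lD: "l \<in> D01" by (intro D01_continuousI) (auto simp: l_def)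
  have L: "limitin D01_top (\<sigma> \<circ> k) l sequentially"
    unfolding limitin_D01_iff
  proof (intro conjI allI impI)
    fix e :: real assume "0 < e"
    then have "0 < e / 2" by simp
    from lim[OF this] obtain N where N: "\<And>n x. n \<ge> N \<Longrightarrow> x \<in> {0..1} \<Longrightarrow> norm (\<sigma> (k n) x - g x) < e / 2" by blast
    have "sup_dist ((\<sigma> \<circ> k) n) l < e" if "n \<ge> N" for n
    proof -
      have "sup_dist ((\<sigma> \<circ> k) n) l \<le> e / 2"
        using N[OF that] \<sigma>(1) lD by (intro sup_dist_least) (auto simp: l_def intro!: less_imp_le)
      with \<open>0 < e\<close> show ?thesis by simp
    qed
    then show "\<forall>\<^sub>F n in sequentially. (\<sigma> \<circ> k) n \<in> D01 \<and> sup_dist ((\<sigma> \<circ> k) n) l < e"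
      using \<sigma>(1) by (auto simp: eventually_sequentially)
  qed (rule lD)
  have "energy_le l E"
    using limitin_D01_pointwise[OF L] \<sigma>(3) by (intro energy_le_limit[of "\<sigma> \<circ> k"]) auto
  moreover have "l 0 = 0"
    using limitin_D01_pointwise[OF L, of 0] \<sigma>(2) by (simp add: LIMSEQ_const_iff)
  ultimately have "l \<in> energy_level E" using lD by (simp add: energy_level_def)
  then show "\<exists>l r. l \<in> energy_level E \<and> strict_mono r \<and> limitin D01.mtopology (\<sigma> \<circ> r) l sequentially"
    using k L unfolding D01_top_def by blast
qed

text \<open>By contradiction: otherwise points of \<open>F\<close> come arbitrarily close to paths
  with energy at most \<open>E + r n\<close>; by compactness these paths have a limit point, of
  energy at most \<open>E\<close> and, \<open>F\<close> being closed, in \<open>F\<close>. The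
  margin \<open>E < E'\<close> later pays for the losses in the upper bound.\<close>

lemma closed_energy_level_separation:
  assumes F: "closedin D01_top F" and disj: "F \<inter> energy_level E = {}"
  obtains \<delta> E' where "0 < \<delta>" "E < E'"
    "\<And>w z. w \<in> F \<Longrightarrow> z \<in> D01 \<Longrightarrow> z 0 = 0 \<Longrightarrow> sup_dist w z < \<delta> \<Longrightarrow> \<not> energy_le z E'"
proof (rule ccontr)
  assume no: "\<not> thesis"
  define r where "r n = inverse (real (Suc n))" for n
  have r: "0 < r n" "r n \<le> 1" for n by (auto simp: r_def field_simps)
  have rlim: "r \<longlonglongrightarrow> 0" unfolding r_def by (rule LIMSEQ_inverse_real_of_nat)
  have "\<exists>w z. w \<in> F \<and> z \<in> D01 \<and> z 0 = 0 \<and> sup_dist w z < r n \<and> energy_le z (E + r n)" for n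
  proof (rule ccontr)
    assume "\<not> ?thesis"
    then have thesis by (intro that[of "r n" "E + r n"]) (use r in auto)
    with no show False ..
  qed
  then obtain w z where wz: "\<And>n. w n \<in> F" "\<And>n. z n \<in> D01" "\<And>n. z n 0 = 0"
    "\<And>n. sup_dist (w n) (z n) < r n" "\<And>n. energy_le (z n) (E + r n)" by metis
  \<comment> \<open>All approximating paths lie in one compact level set because
    \<open>r n \<le> 1\<close>.\<close>
  have "energy_le (z n) (E + 1)" for n using wz(5) by (rule energy_le_mono) (simp add: r)
  then have "range z \<subseteq> energy_level (E + 1)" using wz by (auto simp: energy_level_def)
  then obtain l k where lk: "strict_mono (k :: nat \<Rightarrow> nat)" "limitin D01_top (z \<circ> k) l sequentially"
    using compactin_energy_level[of "E + 1"] unfolding D01_top_def D01.compactin_sequentially by blast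
  note pt = limitin_D01_pointwise[OF lk(2)]
  have lD: "l \<in> D01" using lk(2) by (simp add: limitin_D01_iff)
  have rk: "(\<lambda>n. r (k n)) \<longlonglongrightarrow> 0" using LIMSEQ_subseq_LIMSEQ[OF rlim lk(1)] by (simp add: comp_def)
  have "energy_le l (E + e)" if e: "0 < e" for e
  proof (rule energy_le_limit[of "z \<circ> k"])
    have "\<forall>\<^sub>F n in sequentially. r (k n) < e" using rk e by (rule order_tendstoD)
    then show "\<forall>\<^sub>F n in sequentially. energy_le ((z \<circ> k) n) (E + e)"
      by eventually_elim (auto intro!: energy_le_mono[OF wz(5)])
  qed (use pt in auto)
  then have "energy_le l E" unfolding energy_le_def by (auto intro: field_le_epsilon)
  moreover have "l 0 = 0" using pt[of 0] wz(3) by (simp add: LIMSEQ_const_iff)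
  ultimately have lE: "l \<in> energy_level E" using lD by (simp add: energy_level_def)
  have FD: "F \<subseteq> D01" using F closedin_subset by (force simp: D01_top_def)
  have "limitin D01_top (w \<circ> k) l sequentially"
    unfolding limitin_D01_iff
  proof (intro conjI allI impI)
    fix e :: real assume "0 < e"
    then have e2: "0 < e / 2" by simp
    have "\<forall>\<^sub>F n in sequentially. (z \<circ> k) n \<in> D01 \<and> sup_dist ((z \<circ> k) n) l < e / 2"
      using lk(2) e2 unfolding limitin_D01_iff by blast
    moreover have "\<forall>\<^sub>F n in sequentially. r (k n) < e / 2" using rk e2 by (rule order_tendstoD)
    ultimately show "\<forall>\<^sub>F n in sequentially. (w \<circ> k) n \<in> D01 \<and> sup_dist ((w \<circ> k) n) l < e"
    proof eventually_elim
      case (elim n)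
      have wD: "w (k n) \<in> D01" using wz(1) FD by auto
      have "sup_dist (w (k n)) l \<le> sup_dist (w (k n)) (z (k n)) + sup_dist (z (k n)) l"
        by (rule D01.triangle[OF wD wz(2) lD])
      also have "\<dots> < e / 2 + e / 2" using elim wz(4)[of "k n"] by (intro add_strict_mono) auto
      finally show ?case using wD by simp
    qed
  qed (rule lD)
  then have "l \<in> F"
    using F wz(1) unfolding D01_top_def D01.metric_closedin_iff_sequentially_closed
    by (metis comp_apply image_subset_iff)
  with lE disj show False by blast
qed

lemma rate_I_nonneg: "0 \<le> rate_I z"
  by (simp add: rate_I_def)

lemma inverse_times_le_iff:
  fixes c \<alpha> :: real
  assumes "0 \<le> c" "0 \<le> r"
  shows "inverse (ereal c) * r \<le> ereal \<alpha> \<longleftrightarrow> 0 \<le> \<alpha> \<and> r \<le> ereal (\<alpha> * c)"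
proof (cases "c = 0")
  case True
  then show ?thesis using assms(2) by (cases r) (auto simp: zero_ereal_def)
next
  case False
  with assms(1) have c: "0 < c" by simp
  show ?thesis
  proof (cases r)
    case (real x)
    then have x: "0 \<le> x" using assms(2) by simp
    have "x / c \<le> \<alpha> \<longleftrightarrow> 0 \<le> \<alpha> \<and> x \<le> \<alpha> * c"
      using c x by (auto simp: divide_le_eq intro: order_trans[OF divide_nonneg_pos[OF x c]])
    then show ?thesis using real c by (simp add: divide_inverse mult.commute)
  qed (use c assms(2) in auto)
qed

text \<open>For \<open>c = 0\<close> the right-hand side forces \<open>z = 0\<close>, in accordance with \<open>\<infinity> * 0 = 0\<close> in the rate.\<close>

lemma rate_If_le_iff:
  fixes f K x \<alpha>
  defines "c \<equiv> f x * (\<integral>u. (K u)\<^sup>2 \<partial>lborel)"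
  assumes c: "0 \<le> c"
  shows "rate_If f K x z \<le> ereal \<alpha> \<longleftrightarrow> 0 \<le> \<alpha> \<and> z 0 = 0 \<and> energy_le z (2 * \<alpha> * c)"
proof -
  have "rate_If f K x z \<le> ereal \<alpha> \<longleftrightarrow> 0 \<le> \<alpha> \<and> rate_I z \<le> ereal (\<alpha> * c)"
    unfolding rate_If_def c_def[symmetric] by (rule inverse_times_le_iff[OF c rate_I_nonneg])
  also have "\<dots> \<longleftrightarrow> 0 \<le> \<alpha> \<and> z 0 = 0 \<and> energy_le z (2 * \<alpha> * c)"
    using rate_I_le_iff[of "2 * \<alpha> * c" z] c by auto
  finally show ?thesis .
qed

section \<open>Exponential estimates for sums of independent variables\<close>

context prob_space
begin

lemma indep_vars_exp_sum:
  fixes Y :: "nat \<Rightarrow> 'a \<Rightarrow> real"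
  assumes indep: "indep_vars (\<lambda>_. borel) Y UNIV" and I: "finite I"
    and int: "\<And>k. k \<in> I \<Longrightarrow> integrable M (\<lambda>\<omega>. exp (Y k \<omega>))"
  shows "integrable M (\<lambda>\<omega>. exp (\<Sum>k\<in>I. Y k \<omega>))"
    and "expectation (\<lambda>\<omega>. exp (\<Sum>k\<in>I. Y k \<omega>)) = (\<Prod>k\<in>I. expectation (\<lambda>\<omega>. exp (Y k \<omega>)))"
proof -
  have ind: "indep_vars (\<lambda>_. borel) (\<lambda>k \<omega>. exp (Y k \<omega>)) I"
    by (rule indep_vars_compose2[OF indep_vars_subset[OF indep]]) auto
  show "integrable M (\<lambda>\<omega>. exp (\<Sum>k\<in>I. Y k \<omega>))"
    using indep_vars_integrable[OF I ind int] by (simp add: exp_sum[OF I])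
  show "expectation (\<lambda>\<omega>. exp (\<Sum>k\<in>I. Y k \<omega>)) = (\<Prod>k\<in>I. expectation (\<lambda>\<omega>. exp (Y k \<omega>)))"
    using indep_vars_lebesgue_integral[OF I ind int] by (simp add: exp_sum[OF I])
qed

text \<open>Doob's maximal inequality for the nonnegative submartingale formed by the exponentials
  of the partial sums; \<open>ge1\<close> is the submartingale property.\<close>

lemma exp_sum_maximal_inequality:
  fixes Y :: "nat \<Rightarrow> 'a \<Rightarrow> real"
  assumes indep: "indep_vars (\<lambda>_. borel) Y UNIV" and pq: "p \<le> q"
    and int: "\<And>k. integrable M (\<lambda>\<omega>. exp (Y k \<omega>))"
    and ge1: "\<And>k. 1 \<le> expectation (\<lambda>\<omega>. exp (Y k \<omega>))"
  shows "prob {\<omega> \<in> space M. \<exists>j\<in>{p..q}. u \<le> (\<Sum>k\<in>{p..<j}. Y k \<omega>)} \<le>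
    exp (- u) * (\<Prod>k\<in>{p..<q}. expectation (\<lambda>\<omega>. exp (Y k \<omega>)))"
proof -
  have rv [measurable]: "Y k \<in> borel_measurable M" for k
    using indep by (auto simp: indep_vars_def)
  define T where "T j \<omega> = (\<Sum>k\<in>{p..<j}. Y k \<omega>)" for j \<omega>
  define B where "B q = {\<omega> \<in> space M. \<exists>j\<in>{p..q}. u \<le> T j \<omega>}" for q
  have [measurable]: "T j \<in> borel_measurable M" for j unfolding T_def by measurable
  have Bm [measurable]: "B q \<in> sets M" for q unfolding B_def by measurable
  have Tint: "integrable M (\<lambda>\<omega>. exp (T j \<omega>))" for j
    unfolding T_def by (rule indep_vars_exp_sum(1)[OF indep _ int]) simp
  have TBint: "integrable M (\<lambda>\<omega>. exp (T j \<omega>) * indicator A \<omega>)" if "A \<in> sets M" for j A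
    by (rule integrable_real_mult_indicator[OF that Tint])
  have cint: "integrable M (\<lambda>\<omega>. exp u * indicator A \<omega>)" if "A \<in> sets M" for A
    by (rule integrable_real_mult_indicator[OF that]) simp
  \<comment> \<open>The indicator on the right makes the induction work: at the next index the
    contribution of the old event is multiplied by an independent factor of mean at least 1, and on
    the newly added event the bound holds pointwise.\<close>
  have key: "exp u * prob (B q) \<le> expectation (\<lambda>\<omega>. exp (T q \<omega>) * indicator (B q) \<omega>)" if "p \<le> q" for q
    using that
  proof (induction q rule: dec_induct)
    case base
    have "exp u * prob (B p) = expectation (\<lambda>\<omega>. exp u * indicator (B p) \<omega>)" by simp
    also have "\<dots> \<le> expectation (\<lambda>\<omega>. exp (T p \<omega>) * indicator (B p) \<omega>)"
      by (intro integral_mono TBint cint Bm) (auto simp: B_def indicator_def)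
    finally show ?case .
  next
    case (step n)
    define C where "C = {\<omega> \<in> space M. \<omega> \<notin> B n \<and> u \<le> T (Suc n) \<omega>}"
    have Cm [measurable]: "C \<in> sets M" unfolding C_def by measurable
    have BS: "B (Suc n) = B n \<union> C" and dj: "B n \<inter> C = {}"
      using step(1) by (auto simp: B_def C_def atLeastAtMostSuc_conv)
    \<comment> \<open>Written as a function of the earlier coordinates alone, so that its
      independence from \<open>Y n\<close> follows by composition.\<close>
    let ?\<Phi> = "\<lambda>x. exp (\<Sum>k\<in>{p..<n}. x k) * indicator {x. \<exists>j\<in>{p..n}. u \<le> (\<Sum>k\<in>{p..<j}. x k)} x"
    let ?H = "{\<omega>. \<exists>j\<in>{p..n}. u \<le> T j \<omega>}"
    let ?E = "expectation (\<lambda>\<omega>. exp (T n \<omega>) * indicator (B n) \<omega>) * expectation (\<lambda>\<omega>. exp (Y n \<omega>))"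
    let ?P = "Pi\<^sub>M {p..<n} (\<lambda>_. borel :: real measure)"
    have "indep_var borel
        (?\<Phi> \<circ>
           (\<lambda>\<omega>. restrict (\<lambda>i. Y i \<omega>) {p..<n}))
        borel ((\<lambda>x. exp (x n)) \<circ> (\<lambda>\<omega>. restrict (\<lambda>i. Y i \<omega>) {n}))"
    proof (rule indep_var_compose[OF indep_var_restrict[OF indep]])
      have "(\<lambda>x. \<Sum>k\<in>{p..<j}. x k) \<in> borel_measurable ?P"
        if "j \<in> {p..n}" for j
        using that by (intro borel_measurable_sum measurable_component_singleton) auto
      then have "(\<lambda>x. exp (\<Sum>k\<in>{p..<n}. x k) * indicator {x \<in> space (Pi\<^sub>M {p..<n} (\<lambda>_. borel)). \<exists>j\<in>{p..n}. u \<le> (\<Sum>k\<in>{p..<j}. x k)} x)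
        \<in> borel_measurable ?P"
        using step(1) by (intro borel_measurable_times borel_measurable_indicator sets.sets_Collect_finite_Ex
            borel_measurable_le borel_measurable_const borel_measurable_exp) auto
      then show "?\<Phi>
        \<in> borel_measurable ?P"
        by (rule measurable_cong[THEN iffD1, rotated]) (auto simp: indicator_def)
    qed auto
    also have "(?\<Phi> \<circ>
           (\<lambda>\<omega>. restrict (\<lambda>i. Y i \<omega>) {p..<n})) =
        (\<lambda>\<omega>. exp (T n \<omega>) * indicator ?H \<omega>)"
    proof
      fix \<omega>
      have eq: "(\<Sum>k\<in>{p..<j}. restrict (\<lambda>i. Y i \<omega>) {p..<n} k) = T j \<omega>" if "j \<le> n" for j
        unfolding T_def using that by (intro sum.cong) auto
      have "(\<exists>j\<in>{p..n}. u \<le> (\<Sum>k\<in>{p..<j}. restrict (\<lambda>i. Y i \<omega>) {p..<n} k)) \<longleftrightarrow> (\<exists>j\<in>{p..n}. u \<le> T j \<omega>)"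
        using eq by (intro bex_cong) auto
      then show "(?\<Phi> \<circ>
           (\<lambda>\<omega>. restrict (\<lambda>i. Y i \<omega>) {p..<n})) \<omega> = exp (T n \<omega>) * indicator ?H \<omega>"
        by (simp only: comp_apply eq[OF order_refl] indicator_def mem_Collect_eq)
    qed
    also have "((\<lambda>x. exp (x n)) \<circ> (\<lambda>\<omega>. restrict (\<lambda>i. Y i \<omega>) {n})) = (\<lambda>\<omega>. exp (Y n \<omega>))" by auto
    finally have ind: "indep_var borel (\<lambda>\<omega>. exp (T n \<omega>) * indicator ?H \<omega>)
        borel (\<lambda>\<omega>. exp (Y n \<omega>))" .
    \<comment> \<open>\<open>?H\<close> lacks the intersection with \<open>space M\<close> that
      \<open>B n\<close> carries; under the integral the two agree.\<close>
    have Bind: "exp (T n \<omega>) * indicator ?H \<omega> = exp (T n \<omega>) * indicator (B n) \<omega>"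
      if "\<omega> \<in> space M" for \<omega> using that by (simp add: B_def indicator_def)
    have int1: "integrable M (\<lambda>\<omega>. exp (T n \<omega>) * indicator ?H \<omega>)"
      using TBint[OF Bm[of n], of n] by (subst Bochner_Integration.integrable_cong[OF refl Bind])
    have "exp u * prob (B (Suc n)) = exp u * prob (B n) + exp u * prob C"
      unfolding BS using dj by (subst finite_measure_Union) (auto simp: algebra_simps)
    also have "\<dots> \<le> ?E
        + expectation (\<lambda>\<omega>. exp (T (Suc n) \<omega>) * indicator C \<omega>)"
    proof (rule add_mono)
      have "exp u * prob (B n) * 1 \<le> ?E"
        by (intro mult_mono step.IH ge1 Bochner_Integration.integral_nonneg) auto
      then show "exp u * prob (B n) \<le> ?E"
        by simp
      have "exp u * prob C = expectation (\<lambda>\<omega>. exp u * indicator C \<omega>)" by simp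
      also have "\<dots> \<le> expectation (\<lambda>\<omega>. exp (T (Suc n) \<omega>) * indicator C \<omega>)"
        by (intro integral_mono TBint cint Cm) (auto simp: C_def indicator_def)
      finally show "exp u * prob C \<le> expectation (\<lambda>\<omega>. exp (T (Suc n) \<omega>) * indicator C \<omega>)" .
    qed
    also have "?E =
        expectation (\<lambda>\<omega>. exp (T n \<omega>) * indicator ?H \<omega>) * expectation (\<lambda>\<omega>. exp (Y n \<omega>))"
      by (intro arg_cong2[where f = "(*)"] Bochner_Integration.integral_cong refl Bind[symmetric])
    also have "\<dots> = expectation (\<lambda>\<omega>. (exp (T n \<omega>) * indicator ?H \<omega>) * exp (Y n \<omega>))"
      by (rule indep_var_lebesgue_integral[OF ind int1 int, symmetric])
    also have "\<dots> = expectation (\<lambda>\<omega>. exp (T (Suc n) \<omega>) * indicator (B n) \<omega>)"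
      using step(1) by (intro Bochner_Integration.integral_cong refl)
        (simp add: T_def B_def indicator_def exp_add)
    also have "\<dots> + expectation (\<lambda>\<omega>. exp (T (Suc n) \<omega>) * indicator C \<omega>) =
        expectation (\<lambda>\<omega>. exp (T (Suc n) \<omega>) * indicator (B (Suc n)) \<omega>)"
      unfolding BS Bochner_Integration.integral_add[OF TBint[OF Bm] TBint[OF Cm], symmetric] using dj
      by (intro Bochner_Integration.integral_cong refl) (auto simp: indicator_def)
    finally show ?case .
  qed
  have "exp u * prob (B q) \<le> expectation (\<lambda>\<omega>. exp (T q \<omega>) * indicator (B q) \<omega>)" by (rule key[OF pq])
  also have "\<dots> \<le> expectation (\<lambda>\<omega>. exp (T q \<omega>))"
    by (intro integral_mono TBint Tint Bm) (auto simp: indicator_def)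
  also have "\<dots> = (\<Prod>k\<in>{p..<q}. expectation (\<lambda>\<omega>. exp (Y k \<omega>)))"
    unfolding T_def by (rule indep_vars_exp_sum(2)[OF indep _ int]) simp
  finally show ?thesis
    unfolding B_def T_def by (simp add: exp_minus field_simps)
qed

end

text \<open>Constants are subexponential at speed \<open>a\<close>:
  \<open>exp (\<eta> / a n)\<close> is at least \<open>\<eta> / a n\<close>, which diverges.
  Counting factors are removed in this way.\<close>

lemma eventually_exp_absorb:
  fixes a :: "nat \<Rightarrow> real"
  assumes a: "a \<longlonglongrightarrow> 0" "\<forall>\<^sub>F n in sequentially. 0 < a n" and \<eta>: "0 < \<eta>"
  shows "\<forall>\<^sub>F n in sequentially. C \<le> exp (\<eta> / a n)"
proof -
  define d where "d = \<eta> / (\<bar>C\<bar> + 1)"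
  have d: "0 < d" using \<eta> by (simp add: d_def)
  have "\<forall>\<^sub>F n in sequentially. a n < d" using a(1) d by (rule order_tendstoD)
  then show ?thesis using a(2)
  proof eventually_elim
    case (elim n)
    have "\<bar>C\<bar> + 1 \<le> \<eta> / a n"
      using elim \<eta> by (simp add: d_def field_simps)
    also have "\<dots> \<le> exp (\<eta> / a n)" using exp_ge_add_one_self[of "\<eta> / a n"] by linarith
    finally show ?case by linarith
  qed
qed

text \<open>Exponential change of measure without changing the measure: the mass that
  \<open>exp (\<theta> v / a)\<close> puts outside \<open>\<bar>v - u\<bar> < \<epsilon>\<close> is negligible by Markov's inequality at
  \<open>\<theta> \<plusminus> s\<close>. The parametrization \<open>u = \<kappa> \<theta>\<close> covers \<open>\<kappa> = 0\<close>.\<close>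

lemma (in prob_space) gaussian_log_mgf_lower_bound:
  fixes v :: "nat \<Rightarrow> 'a \<Rightarrow> real" and a :: "nat \<Rightarrow> real"
  assumes v [measurable]: "\<And>n. v n \<in> borel_measurable M"
    and a: "a \<longlonglongrightarrow> 0" "\<forall>\<^sub>F n in sequentially. 0 < a n" and \<kappa>: "0 \<le> \<kappa>"
    and mgf: "\<And>\<theta>. \<forall>\<^sub>F n in sequentially. integrable M (\<lambda>\<omega>. exp (\<theta> / a n * v n \<omega>)) \<and>
        expectation (\<lambda>\<omega>. exp (\<theta> / a n * v n \<omega>)) = exp (H n \<theta>)"
    and lim: "\<And>\<theta>. (\<lambda>n. a n * H n \<theta>) \<longlonglongrightarrow> \<kappa> * \<theta>\<^sup>2 / 2"
    and \<epsilon>: "0 < \<epsilon>" and \<eta>: "0 < \<eta>"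
  shows "\<forall>\<^sub>F n in sequentially. exp (- (\<kappa> * \<theta>\<^sup>2 / 2 + \<eta>) / a n) \<le>
    prob {\<omega> \<in> space M. \<bar>v n \<omega> - \<kappa> * \<theta>\<bar> < \<epsilon>}"
proof -
  \<comment> \<open>The radius is shrunk until \<open>\<theta> * v n\<close> varies by at most
    \<open>\<eta> / 4\<close> around \<open>\<theta> * (\<kappa> * \<theta>)\<close> on the
    event.\<close>
  define e where "e = min \<epsilon> (\<eta> / (4 * (\<bar>\<theta>\<bar> + 1)))"
  have e: "0 < e" "e \<le> \<epsilon>" "\<bar>\<theta>\<bar> * e \<le> \<eta> / 4"
  proof -
    show "0 < e" "e \<le> \<epsilon>" using \<epsilon> \<eta> by (auto simp: e_def)
    have "\<bar>\<theta>\<bar> * e \<le> (\<bar>\<theta>\<bar> + 1) * (\<eta> / (4 * (\<bar>\<theta>\<bar> + 1)))"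
      using \<eta> \<open>0 < e\<close> by (intro mult_mono) (auto simp: e_def)
    also have "\<dots> = \<eta> / 4" by (simp add: field_simps)
    finally show "\<bar>\<theta>\<bar> * e \<le> \<eta> / 4" .
  qed
  \<comment> \<open>A further tilt by \<open>s\<close> gains \<open>s * e\<close> in the exponent
    and loses \<open>\<kappa> * s\<^sup>2 / 2\<close>. The first bound makes the loss at most a
    quarter of the gain, the second keeps the gain at most \<eta>.\<close>
  define s where "s = min (e / (2 * (\<kappa> + 1))) (\<eta> / e)"
  have s: "0 < s" "\<kappa> * s \<le> e / 2" "s * e \<le> \<eta>"
  proof -
    show "0 < s" using e \<eta> \<kappa> by (simp add: s_def)
    have "\<kappa> * s \<le> (\<kappa> + 1) * (e / (2 * (\<kappa> + 1)))"
      using \<kappa> \<open>0 < s\<close> by (intro mult_mono) (auto simp: s_def)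
    also have "\<dots> = e / 2" using \<kappa> by (simp add: field_simps)
    finally show "\<kappa> * s \<le> e / 2" .
    have "s * e \<le> \<eta> / e * e" using e by (intro mult_right_mono) (auto simp: s_def)
    then show "s * e \<le> \<eta>" using e by simp
  qed
  \<comment> \<open>The gain is \<open>4 * r\<close>: one \<open>r\<close> covers the quadratic
    loss, one the error of the limit, and \<open>2 * r\<close> remain, to be compared with a total
    mass of at least \<open>exp ((P - r) / b)\<close> where
    \<open>P = \<kappa> * \<theta>\<^sup>2 / 2\<close> and \<open>b = a n\<close>.\<close>
  define r where "r = s * e / 4"
  have r: "0 < r" "r \<le> \<eta> / 4" "\<kappa> * s\<^sup>2 / 2 \<le> r"
    using s e mult_right_mono[OF s(2), of s] by (auto simp: r_def power2_eq_square mult_ac)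
  have up: "\<forall>\<^sub>F n in sequentially. a n * H n t < \<kappa> * t\<^sup>2 / 2 + r" for t
    using lim[of t] r(1) by (intro order_tendstoD(2)) auto
  have low: "\<forall>\<^sub>F n in sequentially. \<kappa> * \<theta>\<^sup>2 / 2 - r < a n * H n \<theta>"
    using lim[of \<theta>] r(1) by (intro order_tendstoD(1)) auto
  have a4: "\<forall>\<^sub>F n in sequentially. 4 \<le> exp (r / a n)" by (rule eventually_exp_absorb[OF a r(1)])
  have a2: "\<forall>\<^sub>F n in sequentially. 2 \<le> exp ((\<eta> / 4) / a n)"
    by (rule eventually_exp_absorb[OF a]) (use \<eta> in simp)
  show ?thesis
    using mgf[of \<theta>] mgf[of "\<theta> + s"] mgf[of "\<theta> - s"] up[of "\<theta> + s"] up[of "\<theta> - s"] low a4 a2 a(2)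
  proof eventually_elim
    case (elim n)
    define b where "b = a n"
    have b: "0 < b" using elim by (simp add: b_def)
    define u where "u = \<kappa> * \<theta>"
    define V where "V = v n"
    have [measurable]: "V \<in> borel_measurable M" by (simp add: V_def)
    let ?G = "{\<omega> \<in> space M. \<bar>V \<omega> - u\<bar> < e}"
    have int0: "integrable M (\<lambda>\<omega>. exp (\<theta> / b * V \<omega>))"
      and int1: "integrable M (\<lambda>\<omega>. exp ((\<theta> + s) / b * V \<omega>))"
      and int2: "integrable M (\<lambda>\<omega>. exp ((\<theta> - s) / b * V \<omega>))"
      using elim by (simp_all add: b_def V_def)
    define P where "P = \<kappa> * \<theta>\<^sup>2 / 2"
    let ?c\<^sub>0 = "exp ((\<theta> * u + \<bar>\<theta>\<bar> * e) / b)"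
    let ?c\<^sub>1 = "exp (- (s * (u + e)) / b)"
    let ?c\<^sub>2 = "exp (- (s * (e - u)) / b)"
    let ?f = "\<lambda>t \<omega>. exp (t / b * V \<omega>)"
    have E0: "exp ((P - r) / b) \<le> expectation (?f \<theta>)"
      using elim b by (simp add: b_def V_def P_def divide_le_eq mult.commute)
    have E1: "expectation (?f (\<theta> + s)) \<le> exp ((\<kappa> * (\<theta> + s)\<^sup>2 / 2 + r) / b)"
      using elim b by (simp add: b_def V_def le_divide_eq mult.commute)
    have E2: "expectation (?f (\<theta> - s)) \<le> exp ((\<kappa> * (\<theta> - s)\<^sup>2 / 2 + r) / b)"
      using elim b by (simp add: b_def V_def le_divide_eq mult.commute)
    have Gm: "?G \<in> sets M" by measurable
    have Gint: "integrable M (\<lambda>\<omega>. ?c\<^sub>0 * indicator ?G \<omega>)"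
      by (rule integrable_real_mult_indicator[OF Gm]) simp
    \<comment> \<open>Outside the window the factor
      \<open>exp (s * (V \<omega> - u - e) / b)\<close>, or its mirror image, is at least 1 and
      turns the tilt \<theta> into \<open>\<theta> + s\<close> or
      \<open>\<theta> - s\<close>.\<close>
    have pw: "?f \<theta> \<omega> \<le> ?c\<^sub>0 * indicator ?G \<omega>
        + ?c\<^sub>1 * ?f (\<theta> + s) \<omega>
        + ?c\<^sub>2 * ?f (\<theta> - s) \<omega>" if "\<omega> \<in> space M" for \<omega>
    proof -
      consider "\<bar>V \<omega> - u\<bar> < e" | "u + e \<le> V \<omega>" | "V \<omega> \<le> u - e" by linarith
      then show ?thesis
      proof cases
        case 1
        have "\<theta> * V \<omega> = \<theta> * u + \<theta> * (V \<omega> - u)" by (simp add: algebra_simps)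
        also have "\<theta> * (V \<omega> - u) \<le> \<bar>\<theta>\<bar> * e"
          using 1 by (metis abs_ge_self abs_ge_zero abs_mult less_imp_le mult_left_mono order_trans)
        finally have "?f \<theta> \<omega> \<le> ?c\<^sub>0"
          using b by (simp add: divide_right_mono)
        then show ?thesis using 1 that by (simp add: indicator_def add_increasing2)
      next
        case 2
        then have "s * (u + e) \<le> s * V \<omega>" using s by (intro mult_left_mono) auto
        then have "\<theta> * V \<omega> / b \<le> (- (s * (u + e)) + (\<theta> + s) * V \<omega>) / b"
          using b by (intro divide_right_mono) (auto simp: distrib_right)
        then have "\<theta> / b * V \<omega> \<le> - (s * (u + e)) / b + (\<theta> + s) / b * V \<omega>"
          by (simp add: add_divide_distrib distrib_right diff_divide_distrib left_diff_distrib)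
        then have "?f \<theta> \<omega> \<le> ?c\<^sub>1 * ?f (\<theta> + s) \<omega>"
          by (simp flip: exp_add)
        then show ?thesis by (simp add: add_increasing add_increasing2)
      next
        case 3
        then have "s * V \<omega> \<le> s * (u - e)" using s by (intro mult_left_mono) auto
        then have "\<theta> * V \<omega> / b \<le> (- (s * (e - u)) + (\<theta> - s) * V \<omega>) / b"
          using b by (intro divide_right_mono) (auto simp: algebra_simps)
        then have "\<theta> / b * V \<omega> \<le> - (s * (e - u)) / b + (\<theta> - s) / b * V \<omega>"
          by (simp add: add_divide_distrib distrib_right diff_divide_distrib left_diff_distrib)
        then have "?f \<theta> \<omega> \<le> ?c\<^sub>2 * ?f (\<theta> - s) \<omega>"
          by (simp flip: exp_add)
        then show ?thesis by (simp add: add_increasing add_increasing2)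
      qed
    qed
    have "expectation (?f \<theta>) \<le> expectation (\<lambda>\<omega>. ?c\<^sub>0 * indicator ?G \<omega>
        + ?c\<^sub>1 * ?f (\<theta> + s) \<omega>
        + ?c\<^sub>2 * ?f (\<theta> - s) \<omega>)"
    proof (rule integral_mono)
      show "integrable M (\<lambda>\<omega>. ?c\<^sub>0 * indicator ?G \<omega>
        + ?c\<^sub>1 * ?f (\<theta> + s) \<omega>
        + ?c\<^sub>2 * ?f (\<theta> - s) \<omega>)"
        by (intro Bochner_Integration.integrable_add integrable_mult_right int1 int2 Gint)
    qed (use int0 pw in auto)
    also have "\<dots> = ?c\<^sub>0 * prob ?G
        + ?c\<^sub>1 * expectation (?f (\<theta> + s))
        + ?c\<^sub>2 * expectation (?f (\<theta> - s))"
      using int1 int2 Gint by (simp add: Bochner_Integration.integral_add integrable_mult_right)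
    also have "\<dots> \<le> ?c\<^sub>0 * prob ?G + exp ((P - 2 * r) / b) + exp ((P - 2 * r) / b)"
    proof (intro add_mono order_refl)
      have "?c\<^sub>1 * expectation (?f (\<theta> + s))
          \<le> ?c\<^sub>1 * exp ((\<kappa> * (\<theta> + s)\<^sup>2 / 2 + r) / b)"
        by (intro mult_left_mono E1) simp
      also have "\<dots> = exp ((P + \<kappa> * s\<^sup>2 / 2 - 4 * r + r) / b)"
        by (simp add: P_def u_def r_def power2_eq_square algebra_simps add_divide_distrib
            diff_divide_distrib flip: exp_add)
      also have "\<dots> \<le> exp ((P - 2 * r) / b)"
        using r(3) b by (simp add: divide_right_mono)
      finally show "?c\<^sub>1 * expectation (?f (\<theta> + s)) \<le> exp ((P - 2 * r) / b)" .
      have "?c\<^sub>2 * expectation (?f (\<theta> - s))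
          \<le> ?c\<^sub>2 * exp ((\<kappa> * (\<theta> - s)\<^sup>2 / 2 + r) / b)"
        by (intro mult_left_mono E2) simp
      also have "\<dots> = exp ((P + \<kappa> * s\<^sup>2 / 2 - 4 * r + r) / b)"
        by (simp add: P_def u_def r_def power2_eq_square algebra_simps add_divide_distrib
            diff_divide_distrib flip: exp_add)
      also have "\<dots> \<le> exp ((P - 2 * r) / b)"
        using r(3) b by (simp add: divide_right_mono)
      finally show "?c\<^sub>2 * expectation (?f (\<theta> - s)) \<le> exp ((P - 2 * r) / b)" .
    qed
    finally have main: "exp ((P - r) / b) \<le> ?c\<^sub>0 * prob ?G + 2 * exp ((P - 2 * r) / b)"
      using E0 by simp
    \<comment> \<open>The two outer parts together are at most half of the total mass, so the
      central part carries at least the other half.\<close>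
    have "4 * exp ((P - 2 * r) / b) \<le> exp (r / b) * exp ((P - 2 * r) / b)"
      using elim by (intro mult_right_mono) (auto simp: b_def)
    also have "\<dots> = exp ((P - r) / b)" by (simp add: add_divide_distrib[symmetric] flip: exp_add)
    finally have "exp ((P - r) / b) \<le> 2 * (?c\<^sub>0 * prob ?G)" using main by simp
    also have "\<dots> \<le> exp ((\<eta> / 4) / b) * (?c\<^sub>0 * prob ?G)"
      using elim by (intro mult_right_mono) (auto simp: b_def)
    finally have "exp (- (\<eta> / 4 + \<theta> * u + \<bar>\<theta>\<bar> * e) / b) * exp ((P - r) / b) \<le>
       exp (- (\<eta> / 4 + \<theta> * u + \<bar>\<theta>\<bar> * e) / b) * (exp ((\<eta> / 4) / b) * (?c\<^sub>0 * prob ?G))"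
      by (intro mult_left_mono) auto
    also have "\<dots> = prob ?G"
      by (simp add: mult.assoc[symmetric] flip: exp_add)
        (simp add: diff_divide_distrib add_divide_distrib)
    finally have "exp (- (\<eta> / 4 + \<theta> * u + \<bar>\<theta>\<bar> * e) / b) * exp ((P - r) / b) \<le> prob ?G" .
    moreover have "exp (- (P + \<eta>) / b) \<le> exp (- (\<eta> / 4 + \<theta> * u + \<bar>\<theta>\<bar> * e) / b) * exp ((P - r) / b)"
    proof -
      \<comment> \<open>At \<open>u = \<kappa> * \<theta>\<close> the cost
        \<open>\<theta> * u - P\<close> equals \<open>P\<close>, the value there of the Legendre
        transform of the limit.\<close>
      have "\<theta> * u = 2 * P" by (simp add: P_def u_def power2_eq_square)
      then have "- (P + \<eta>) \<le> - (\<eta> / 4 + \<theta> * u + \<bar>\<theta>\<bar> * e) + (P - r)" using e(3) r(2) \<eta> by linarith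
      then have "- (P + \<eta>) / b \<le> (- (\<eta> / 4 + \<theta> * u + \<bar>\<theta>\<bar> * e) + (P - r)) / b"
        using b by (intro divide_right_mono) auto
      then show ?thesis by (simp only: exp_add[symmetric] add_divide_distrib[symmetric] exp_le_cancel_iff)
    qed
    moreover have "prob ?G \<le> prob {\<omega> \<in> space M. \<bar>v n \<omega> - \<kappa> * \<theta>\<bar> < \<epsilon>}"
      using e(2) by (intro finite_measure_mono) (auto simp: V_def u_def)
    ultimately show ?case by (simp add: P_def b_def)
  qed
qed

text \<open>The slack between \<open>s'\<close> and \<open>s\<close> absorbs all factors that are subexponential at speed \<open>a\<close>.\<close>

definition (in prob_space) exp_tail :: "(nat \<Rightarrow> real) \<Rightarrow> (nat \<Rightarrow> 'a \<Rightarrow> real) \<Rightarrow> bool" where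
  "exp_tail a A \<longleftrightarrow> (\<forall>s s'. s' < s \<longrightarrow>
     (\<forall>\<^sub>F n in sequentially. prob {\<omega> \<in> space M. s \<le> A n \<omega>} \<le> exp (- s' / a n)))"

text \<open>For \<open>s \<le> 0\<close> the required bound is at least 1, so only positive levels
  carry content.\<close>

lemma (in prob_space) exp_tailI:
  assumes a: "\<forall>\<^sub>F n in sequentially. 0 < a n"
    and "\<And>s s'. 0 < s \<Longrightarrow> s' < s \<Longrightarrow>
      \<forall>\<^sub>F n in sequentially. prob {\<omega> \<in> space M. s \<le> A n \<omega>} \<le> exp (- s' / a n)"
  shows "exp_tail a A"
  unfolding exp_tail_def
proof (intro allI impI)
  fix s s' :: real assume s: "s' < s"
  show "\<forall>\<^sub>F n in sequentially. prob {\<omega> \<in> space M. s \<le> A n \<omega>} \<le> exp (- s' / a n)"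
  proof (cases "0 < s")
    case False
    from a show ?thesis
    proof eventually_elim
      case (elim n)
      have "prob {\<omega> \<in> space M. s \<le> A n \<omega>} \<le> 1" by simp
      also have "1 \<le> exp (- s' / a n)" using elim s False by (simp add: divide_le_0_iff)
      finally show ?case .
    qed
  qed (use assms(2) s in blast)
qed

text \<open>Slicing by the value of \<open>A\<close> in steps of \<open>s / N\<close>: if the sum
  reaches \<open>s\<close>, some \<open>j \<le> N\<close> has \<open>A\<close> at least
  \<open>j * s / N\<close> and \<open>B\<close> at least \<open>s - (j + 1) * s / N\<close>.
  Independence adds the two exponents, which together miss \<open>s\<close> by one mesh width and
  the slack of the tails.\<close>

lemma (in prob_space) exp_tail_add:
  assumes a: "a \<longlonglongrightarrow> 0" "\<forall>\<^sub>F n in sequentially. 0 < a n"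
    and A: "exp_tail a A" "\<And>n \<omega>. 0 \<le> A n \<omega>" and B: "exp_tail a B" "\<And>n \<omega>. 0 \<le> B n \<omega>"
    and indep: "\<And>n. indep_var borel (A n) borel (B n)"
  shows "exp_tail a (\<lambda>n \<omega>. A n \<omega> + B n \<omega>)"
proof (rule exp_tailI[OF a(2)])
  fix s s' :: real assume s: "0 < s" "s' < s"
  have [measurable]: "A n \<in> borel_measurable M" "B n \<in> borel_measurable M" for n
    using indep_var_rv1[OF indep] indep_var_rv2[OF indep] by simp_all
  \<comment> \<open>Four losses of \<eta>: one for each of the two tail bounds, one for the mesh,
    one for the \<open>N + 1\<close> slices.\<close>
  define \<eta> where "\<eta> = (s - s') / 4"
  have eta: "0 < \<eta>" and s'_eq: "s' = s - 4 * \<eta>" using s by (simp_all add: \<eta>_def field_simps)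
  obtain N :: nat where N: "0 < N" "s / N < \<eta>"
    using reals_Archimedean2[of "s / \<eta>"] s eta
    by (metis divide_less_eq divide_pos_pos less_trans mult.commute of_nat_0_less_iff)
  have evA: "\<forall>\<^sub>F n in sequentially. \<forall>j\<in>{..N}. prob {\<omega> \<in> space M. j * s / N \<le> A n \<omega>} \<le> exp (- (j * s / N - \<eta>) / a n)"
  proof (intro eventually_ball_finite ballI)
    fix j
    show "\<forall>\<^sub>F n in sequentially. prob {\<omega> \<in> space M. real j * s / N \<le> A n \<omega>} \<le> exp (- (real j * s / N - \<eta>) / a n)"
      using eta by (intro A(1)[unfolded exp_tail_def, rule_format]) simp
  qed simp
  have evB: "\<forall>\<^sub>F n in sequentially. \<forall>j\<in>{..N}. prob {\<omega> \<in> space M. s - real (Suc j) * s / N \<le> B n \<omega>}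
      \<le> exp (- (s - real (Suc j) * s / N - \<eta>) / a n)"
  proof (intro eventually_ball_finite ballI)
    fix j
    show "\<forall>\<^sub>F n in sequentially. prob {\<omega> \<in> space M. s - real (Suc j) * s / N \<le> B n \<omega>}
        \<le> exp (- (s - real (Suc j) * s / N - \<eta>) / a n)"
      using eta by (intro B(1)[unfolded exp_tail_def, rule_format]) simp
  qed simp
  have evN: "\<forall>\<^sub>F n in sequentially. real N + 1 \<le> exp (\<eta> / a n)"
    by (rule eventually_exp_absorb[OF a eta])
  show "\<forall>\<^sub>F n in sequentially. prob {\<omega> \<in> space M. s \<le> A n \<omega> + B n \<omega>} \<le> exp (- s' / a n)"
    using evA evB evN a(2)
  proof eventually_elim
    case (elim n)
    define R where "R j = {\<omega> \<in> space M. j * s / N \<le> A n \<omega>} \<inter> {\<omega> \<in> space M. s - real (Suc j) * s / N \<le> B n \<omega>}" for j :: nat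
    have [measurable]: "R j \<in> sets M" for j unfolding R_def by measurable
    have "{\<omega> \<in> space M. s \<le> A n \<omega> + B n \<omega>} \<subseteq> (\<Union>j\<in>{..N}. R j)"
    proof
      fix \<omega> assume w: "\<omega> \<in> {\<omega> \<in> space M. s \<le> A n \<omega> + B n \<omega>}"
      show "\<omega> \<in> (\<Union>j\<in>{..N}. R j)"
      proof (cases "s \<le> A n \<omega>")
        case True
        \<comment> \<open>The last slice asks nothing of \<open>B\<close>, which is nonnegative; it
          catches all large values of \<open>A\<close>.\<close>
        have "s - real (Suc N) * s / N \<le> 0" using N s by (simp add: field_simps)
        then have "s - real (Suc N) * s / N \<le> B n \<omega>" using B(2)[of n \<omega>] by linarith
        then have "\<omega> \<in> R N" using True w N by (simp add: R_def add.commute)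
        then show ?thesis by blast
      next
        case False
        define j where "j = nat \<lfloor>A n \<omega> * N / s\<rfloor>"
        have "0 \<le> A n \<omega> * N / s" using A(2)[of n \<omega>] s by simp
        then have j: "real j \<le> A n \<omega> * N / s" "A n \<omega> * N / s < real j + 1"
          unfolding j_def by linarith+
        have j1: "j * s / N \<le> A n \<omega>" "A n \<omega> < real (Suc j) * s / N"
          using j N s by (simp_all add: field_simps)
        have "j * s / N < s" using j1(1) False by simp
        then have "j \<le> N" using N s by (simp add: divide_less_eq)
        moreover have "\<omega> \<in> R j" using j1 w by (auto simp: R_def)
        ultimately show ?thesis by blast
      qed
    qed
    then have "prob {\<omega> \<in> space M. s \<le> A n \<omega> + B n \<omega>} \<le> prob (\<Union>j\<in>{..N}. R j)"
      by (intro finite_measure_mono) auto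
    also have "\<dots> \<le> (\<Sum>j\<in>{..N}. prob (R j))"
      by (intro finite_measure_subadditive_finite) auto
    also have "\<dots> \<le> (\<Sum>j\<in>{..N}. exp (- (s' + \<eta>) / a n))"
    proof (rule sum_mono)
      fix j assume j: "j \<in> {..N}"
      have "prob (R j) = prob {\<omega> \<in> space M. j * s / N \<le> A n \<omega>} * prob {\<omega> \<in> space M. s - real (Suc j) * s / N \<le> B n \<omega>}"
        using indep_varD[OF indep[of n], of "{real j * s / N..}" "{s - real (Suc j) * s / N..}"]
        by (simp add: R_def vimage_def Int_def conj_ac add.commute)
      also have "\<dots> \<le> exp (- (j * s / N - \<eta>) / a n) * exp (- (s - real (Suc j) * s / N - \<eta>) / a n)"
        by (intro mult_mono bspec[OF elim(1) j] bspec[OF elim(2) j]) auto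
      also have "\<dots> = exp (- (s - s / N - 2 * \<eta>) / a n)"
        by (simp add: add_divide_distrib[symmetric] diff_divide_distrib[symmetric] algebra_simps flip: exp_add)
      also have "\<dots> \<le> exp (- (s' + \<eta>) / a n)"
      proof -
        have "- (s - s / N - 2 * \<eta>) \<le> - (s' + \<eta>)" using N(2) s'_eq by linarith
        then show ?thesis using elim by (simp only: exp_le_cancel_iff) (intro divide_right_mono, auto)
      qed
      finally show "prob (R j) \<le> exp (- (s' + \<eta>) / a n)" .
    qed
    also have "\<dots> = (real N + 1) * exp (- (s' + \<eta>) / a n)" by simp
    also have "\<dots> \<le> exp (\<eta> / a n) * exp (- (s' + \<eta>) / a n)"
      using elim by (intro mult_right_mono) auto
    also have "\<dots> = exp (- s' / a n)"
      by (simp add: add_divide_distrib[symmetric] flip: exp_add)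
    finally show ?case .
  qed
qed

lemma (in prob_space) exp_tail_sum:
  fixes A :: "nat \<Rightarrow> nat \<Rightarrow> 'a \<Rightarrow> real"
  assumes a: "a \<longlonglongrightarrow> 0" "\<forall>\<^sub>F n in sequentially. 0 < a n"
    and A: "\<And>i. i < m \<Longrightarrow> exp_tail a (\<lambda>n. A n i)" "\<And>n i \<omega>. 0 \<le> A n i \<omega>"
    and indep: "\<And>n. indep_vars (\<lambda>_. borel) (A n) {..<m}"
  shows "exp_tail a (\<lambda>n \<omega>. \<Sum>i<m. A n i \<omega>)"
  using A(1) indep
proof (induction m)
  case 0
  show ?case by (rule exp_tailI[OF a(2)]) auto
next
  case (Suc m)
  have "indep_var borel (A n m) borel (\<lambda>\<omega>. \<Sum>i<m. A n i \<omega>)" for n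
    using Suc.prems(2)[of n] by (intro indep_vars_sum) (auto simp: lessThan_Suc)
  moreover have "exp_tail a (\<lambda>n \<omega>. \<Sum>i<m. A n i \<omega>)"
  proof (rule Suc.IH)
    show "indep_vars (\<lambda>_. borel) (A n) {..<m}" for n
      by (rule indep_vars_subset[OF Suc.prems(2)]) auto
  qed (use Suc.prems(1) in auto)
  ultimately have "exp_tail a (\<lambda>n \<omega>. A n m \<omega> + (\<Sum>i<m. A n i \<omega>))"
    using Suc.prems(1) A(2) by (intro exp_tail_add a) (auto intro: sum_nonneg)
  then show ?case by (simp add: add.commute)
qed

section \<open>Step paths and polygons\<close>

definition step_path :: "nat \<Rightarrow> (nat \<Rightarrow> real) \<Rightarrow> real \<Rightarrow> real" where
  "step_path n A = (\<lambda>t\<in>{0..1}. A (nat \<lfloor>real n * t\<rfloor>))"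

lemma floor_index_le: "t \<le> 1 \<Longrightarrow> nat \<lfloor>real n * t\<rfloor> \<le> n"
  by (simp add: nat_le_iff floor_le_iff mult_left_le order_le_less_trans[of _ "real n"])

lemma step_path_in_D01:
  assumes n: "0 < n"
  shows "step_path n A \<in> D01"
  unfolding D01_def
proof (intro CollectI conjI ballI)
  show "step_path n A \<in> extensional {0..1}" by (simp add: step_path_def)
  fix t :: real
  show "(step_path n A \<longlongrightarrow> step_path n A t) (at_right t)" if t: "t \<in> {0..<1}"
  proof (rule tendsto_eventually)
    define j where "j = \<lfloor>real n * t\<rfloor>"
    have j: "of_int j \<le> real n * t" "real n * t < of_int j + 1" unfolding j_def by linarith+
    show "\<forall>\<^sub>F s in at_right t. step_path n A s = step_path n A t"
    proof (rule eventually_at_rightI)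
      show "t < min 1 ((of_int j + 1) / n)" using t j n by (simp add: less_divide_eq mult.commute)
      fix s assume s: "s \<in> {t<..<min 1 ((of_int j + 1) / n)}"
      then have "real n * t \<le> real n * s" "real n * s < of_int j + 1"
        using n by (simp_all add: less_divide_eq mult.commute)
      then have "\<lfloor>real n * s\<rfloor> = j" using j by linarith
      then show "step_path n A s = step_path n A t" using s t by (simp add: step_path_def j_def)
    qed
  qed
  show "\<exists>l. (step_path n A \<longlongrightarrow> l) (at_left t)" if t: "t \<in> {0<..1}"
  proof (intro exI tendsto_eventually)
    define j where "j = \<lceil>real n * t\<rceil> - 1"
    have j: "of_int j < real n * t" "real n * t \<le> of_int j + 1" unfolding j_def by linarith+
    show "\<forall>\<^sub>F s in at_left t. step_path n A s = A (nat j)"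
    proof (rule eventually_at_leftI)
      show "max 0 (of_int j / n) < t" using t j n by (simp add: divide_less_eq mult.commute)
      fix s assume s: "s \<in> {max 0 (of_int j / n)<..<t}"
      then have "real n * s < real n * t" "of_int j < real n * s"
        using n by (simp_all add: divide_less_eq mult.commute)
      then have "\<lfloor>real n * s\<rfloor> = j" using j by linarith
      then show "step_path n A s = A (nat j)" using s t by (simp add: step_path_def)
    qed
  qed
qed

text \<open>The uniform topology is not separable, so checking balls would not be enough for the
  Borel sets. But \<open>step_path n\<close> reads only the coordinates up to \<open>n\<close> and
  is continuous from the product topology, so preimages of open sets are open.\<close>

lemma step_path_measurable:
  assumes n: "0 < n"
  shows "step_path n \<in> measurable borel D01_borel"
  unfolding D01_borel_def
proof (rule measurable_measure_of)
  show "{V. openin D01_top V} \<subseteq> Pow D01" using openin_subset by (fastforce simp: D01_top_def)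
  show "step_path n \<in> space borel \<rightarrow> D01" using step_path_in_D01[OF n] by auto
  fix V assume "V \<in> {V. openin D01_top V}"
  then have V: "openin D01.mtopology V" by (simp add: D01_top_def)
  have "open (step_path n -` V)"
    unfolding open_subopen[of "step_path n -` V"]
  proof
    fix A assume A: "A \<in> step_path n -` V"
    then obtain r where r: "0 < r" "D01.mball (step_path n A) r \<subseteq> V"
      using V unfolding D01.openin_mtopology by auto
    define T where "T = (\<Inter>j\<in>{..n}. (\<lambda>B :: nat \<Rightarrow> real. B j) -` ball (A j) (r / 2))"
    have "open T"
      unfolding T_def by (intro open_INT ballI open_vimage continuous_on_product_coordinates) auto
    moreover have "A \<in> T" using r by (simp add: T_def)
    moreover have "step_path n B \<in> V" if B: "B \<in> T" for B
    proof -
      have "sup_dist (step_path n A) (step_path n B) \<le> r / 2"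
      proof (rule sup_dist_least[OF step_path_in_D01[OF n] step_path_in_D01[OF n]])
        fix t :: real assume t: "0 \<le> t" "t \<le> 1"
        have "B \<in> (\<lambda>B. B (nat \<lfloor>real n * t\<rfloor>)) -` ball (A (nat \<lfloor>real n * t\<rfloor>)) (r / 2)"
          using B floor_index_le[OF t(2), of n] unfolding T_def by blast
        then show "\<bar>step_path n A t - step_path n B t\<bar> \<le> r / 2"
          using t by (simp add: step_path_def dist_real_def)
      qed
      then have "step_path n B \<in> D01.mball (step_path n A) r"
        using r step_path_in_D01[OF n] by (simp add: D01.in_mball)
      with r show ?thesis by blast
    qed
    ultimately show "\<exists>T. open T \<and> A \<in> T \<and> T \<subseteq> step_path n -` V" by blast
  qed
  then show "step_path n -` V \<inter> space borel \<in> sets borel" by simp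
qed

section \<open>Blocks of the time axis and interpolation\<close>

definition block :: "nat \<Rightarrow> nat \<Rightarrow> nat \<Rightarrow> nat" where
  "block n m i = n * i div m"

lemma block_0 [simp]: "block n m 0 = 0"
  by (simp add: block_def)

lemma block_mono: "i \<le> j \<Longrightarrow> block n m i \<le> block n m j"
  by (simp add: block_def div_le_mono)

text \<open>\<open>block n m i\<close> is the integer part of \<open>n * i / m\<close>, the index
  read at time \<open>i / m\<close>, and the integer part is monotone. The range is closed on the
  right because \<open>t\<close> may be the next grid point.\<close>

lemma block_bounds:
  assumes m: "0 < m" and t: "real i / m \<le> t" "t \<le> real (Suc i) / m"
  shows "nat \<lfloor>real n * t\<rfloor> \<in> {block n m i..block n m (Suc i)}"
proof -
  have eq: "int (block n m k) = \<lfloor>real n * (real k / m)\<rfloor>" for k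
    using floor_divide_of_nat_eq[of "n * k" m, where 'a = real] by (simp add: block_def)
  have "real n * (real i / m) \<le> real n * t" "real n * t \<le> real n * (real (Suc i) / m)"
    by (intro mult_left_mono t of_nat_0_le_iff)+
  then have "int (block n m i) \<le> \<lfloor>real n * t\<rfloor>" "\<lfloor>real n * t\<rfloor> \<le> int (block n m (Suc i))"
    unfolding eq by (auto intro: floor_mono simp del: of_nat_Suc)
  then show ?thesis by auto
qed

lemma block_cover:
  assumes m: "0 < m" and t: "0 \<le> t" "t \<le> 1"
  obtains i where "i < m" "real i / m \<le> t" "t \<le> real (Suc i) / m"
proof (cases "t = 1")
  case True
  then show thesis using m by (intro that[of "m - 1"]) auto
next
  case False
  have i: "real (nat \<lfloor>real m * t\<rfloor>) \<le> real m * t" "real m * t < real (Suc (nat \<lfloor>real m * t\<rfloor>))"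
    using t by (auto simp: of_nat_nat) linarith+
  show thesis
  proof (rule that)
    have "real m * t < real m" using False t m by simp
    then show "nat \<lfloor>real m * t\<rfloor> < m" using i by linarith
    show "real (nat \<lfloor>real m * t\<rfloor>) / m \<le> t" "t \<le> real (Suc (nat \<lfloor>real m * t\<rfloor>)) / m"
      using i m by (simp_all add: divide_le_eq le_divide_eq mult.commute del: of_nat_Suc)
  qed
qed

lemma block_asymptotics:
  assumes m: "0 < m"
  shows "(\<lambda>n. real (block n m (Suc i) - block n m i) / real n) \<longlonglongrightarrow> 1 / m"
proof -
  have lim: "(\<lambda>n. real (block n m k) / real n) \<longlonglongrightarrow> real k / m" for k
  proof (rule tendsto_sandwich)
    have "(\<lambda>n. real k / m - 1 / real n) \<longlonglongrightarrow> real k / m - 0"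
      by (intro tendsto_diff tendsto_const lim_1_over_n)
    then show "(\<lambda>n. real k / m - 1 / real n) \<longlonglongrightarrow> real k / m" by simp
    show "\<forall>\<^sub>F n in sequentially. real k / m - 1 / real n \<le> real (block n m k) / real n"
      using eventually_gt_at_top[of 0]
    proof eventually_elim
      case (elim n)
      have "n * k < Suc (block n m k) * m"
        unfolding block_def using m by (metis dividend_less_div_times mult.commute mult_Suc add.commute)
      then have "real n * real k < (real (block n m k) + 1) * real m"
        by (metis of_nat_Suc of_nat_less_iff of_nat_mult add.commute)
      then have "real n * real k / m - 1 \<le> real (block n m k)"
        using m by (simp add: divide_less_eq less_imp_le diff_le_eq)
      then have "(real n * real k / m - 1) / n \<le> real (block n m k) / n" by (intro divide_right_mono) auto
      then show ?case using elim by (simp add: diff_divide_distrib)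
    qed
    show "\<forall>\<^sub>F n in sequentially. real (block n m k) / real n \<le> real k / m"
      using eventually_gt_at_top[of 0]
    proof eventually_elim
      case (elim n)
      have "block n m k * m \<le> n * k" by (simp add: block_def)
      then have "real (block n m k) * real m \<le> real n * real k" by (metis of_nat_le_iff of_nat_mult)
      then show ?case using elim m by (simp add: field_simps)
    qed
  qed (rule tendsto_const)
  have "(\<lambda>n. real (block n m (Suc i)) / real n - real (block n m i) / real n) \<longlonglongrightarrow> real (Suc i) / m - real i / m"
    by (intro tendsto_diff lim)
  then show ?thesis
    using block_mono[of i "Suc i"] by (simp add: of_nat_diff diff_divide_distrib[symmetric] del: of_nat_Suc) simp
qed

text \<open>The polygon is the integral of the step function with value \<open>m * v i\<close> on
  the interval number \<open>i\<close>, so its energy is bounded as for any integral: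
  \<open>(m * v i)\<^sup>2\<close> over length \<open>1 / m\<close>.\<close>

lemma polygon:
  fixes v :: "nat \<Rightarrow> real"
  assumes m: "0 < m"
  obtains p where "p \<in> D01" "p 0 = 0" "energy_le p (\<Sum>i<m. real m * (v i)\<^sup>2)"
    "\<And>i t. i < m \<Longrightarrow> real i / m \<le> t \<Longrightarrow> t \<le> real (Suc i) / m \<Longrightarrow>
       p t = (\<Sum>k<i. v k) + v i * (real m * t - real i)"
proof -
  define Q where "Q i = {real i / m..<real (Suc i) / m}" for i
  have [measurable]: "Q i \<in> sets borel" for i by (simp add: Q_def)
  have emQ: "emeasure lborel (Q i) = ennreal (1 / m)" for i
    by (simp add: Q_def divide_right_mono diff_divide_distrib[symmetric])
  have Qdisj: "u \<in> Q j \<longleftrightarrow> j = i" if "u \<in> Q i" for i j u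
  proof
    assume "u \<in> Q j"
    with that have "real i / m < real (Suc j) / m" "real j / m < real (Suc i) / m"
      unfolding Q_def by (auto intro: order_le_less_trans)
    then show "j = i" using m by (simp add: divide_less_cancel)
  qed (use that in simp)
  define g where "g u = (\<Sum>i<m. real m * v i * indicator (Q i) u)" for u
  have gQ: "g u = real m * v i" if "i < m" "u \<in> Q i" for i u
  proof -
    have "g u = (\<Sum>j<m. if j = i then real m * v j else 0)"
      unfolding g_def using Qdisj[OF that(2)] by (intro sum.cong refl) (auto simp: indicator_def)
    then show ?thesis using that(1) by simp
  qed
  have g: "integrable lborel g"
    unfolding g_def
    by (intro Bochner_Integration.integrable_sum integrable_mult_right integrable_real_indicator) (auto simp: emQ)
  have si: "set_integrable lborel {a..b} g" for a b
    unfolding set_integrable_def by (intro integrable_mult_indicator g) simp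
  define P where "P t = (LINT u:{0..t}|lborel. g u)" for t
  have Pdiff: "P t - P s = (LINT u:{s..t}|lborel. g u)" if "0 \<le> s" "s \<le> t" for s t
    using Henstock_Kurzweil_Integration.integral_combine[OF that set_borel_integral_eq_integral(1)[OF si]]
    by (simp add: P_def set_borel_integral_eq_integral(2)[OF si])
  have P0: "P 0 = 0" using Pdiff[of 0 0] by (simp add: P_def)
  have Pblock: "P t - P s = real m * v i * (t - s)"
    if i: "i < m" and st: "real i / m \<le> s" "s \<le> t" "t \<le> real (Suc i) / m" for i s t
  proof -
    have s0: "0 \<le> s" using st(1) by (metis divide_nonneg_nonneg of_nat_0_le_iff order_trans)
    have "P t - P s = (LINT u:{s..t}|lborel. g u)" using s0 st(2) by (rule Pdiff)
    also have "\<dots> = (LINT u:{s..t}|lborel. real m * v i)"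
      unfolding set_lebesgue_integral_def
    proof (rule integral_cong_AE)
      show "AE u in lborel. indicator {s..t} u *\<^sub>R g u = indicator {s..t} u *\<^sub>R (real m * v i)"
        using AE_lborel_singleton[of t]
      proof eventually_elim
        case (elim u)
        show ?case
        proof (cases "u \<in> {s..t}")
          case True
          then have "u \<in> Q i" using st elim by (auto simp: Q_def)
          then show ?thesis using gQ[OF i] by simp
        qed simp
      qed
    qed (use borel_measurable_integrable[OF g] in auto)
    also have "\<dots> = real m * v i * (t - s)" using st(2) by (simp add: set_lebesgue_integral_def)
    finally show ?thesis .
  qed
  have Pgrid: "i \<le> m \<Longrightarrow> P (real i / m) = (\<Sum>k<i. v k)" for i
  proof (induction i)
    case (Suc i)
    have "P (real (Suc i) / m) - P (real i / m) = real m * v i * (real (Suc i) / m - real i / m)"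
      using Suc.prems by (intro Pblock) (auto simp: divide_right_mono)
    also have "\<dots> = v i" using m by (simp add: diff_divide_distrib[symmetric])
    finally show ?case using Suc by simp
  qed (simp add: P0)
  define p where "p = restrict P {0..1}"
  have pP: "p t = P t" if "0 \<le> t" "t \<le> 1" for t using that by (simp add: p_def)
  have en: "energy_le p (\<Sum>i<m. real m * (v i)\<^sup>2)"
  proof (rule energy_le_integral[OF g])
    show "p t - p s = (LINT u:{s..t}|lborel. g u)" if "0 \<le> s" "s \<le> t" "t \<le> 1" for s t
      using that by (simp add: pP Pdiff)
    have "(\<integral>\<^sup>+u\<in>{0..1}. ennreal ((g u)\<^sup>2) \<partial>lborel) \<le> (\<integral>\<^sup>+u. (\<Sum>i<m. ennreal ((real m * v i)\<^sup>2) * indicator (Q i) u) \<partial>lborel)"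
    proof (rule nn_integral_mono_AE)
      show "AE u in lborel. ennreal ((g u)\<^sup>2) * indicator {0..1} u \<le> (\<Sum>i<m. ennreal ((real m * v i)\<^sup>2) * indicator (Q i) u)"
        using AE_lborel_singleton[of 1]
      proof eventually_elim
        case (elim u)
        show ?case
        proof (cases "u \<in> {0..1}")
          case True
          then have u: "0 \<le> u" "u < 1" using elim by auto
          define i where "i = nat \<lfloor>real m * u\<rfloor>"
          have i: "real i \<le> real m * u" "real m * u < real (Suc i)"
            using u unfolding i_def by (auto simp: of_nat_nat) linarith+
          have "real m * u < real m" using u m by simp
          then have im: "i < m" using i by linarith
          have uQ: "u \<in> Q i"
            unfolding Q_def using i m by (simp add: divide_le_eq less_divide_eq mult.commute del: of_nat_Suc)
          have "ennreal ((g u)\<^sup>2) * indicator {0..1} u = ennreal ((real m * v i)\<^sup>2) * indicator (Q i) u"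
            using True uQ gQ[OF im uQ] by simp
          also have "\<dots> \<le> (\<Sum>i<m. ennreal ((real m * v i)\<^sup>2) * indicator (Q i) u)"
            using im by (intro member_le_sum) auto
          finally show ?thesis .
        qed simp
      qed
    qed
    also have "\<dots> = (\<Sum>i<m. ennreal ((real m * v i)\<^sup>2) * emeasure lborel (Q i))"
      by (subst nn_integral_sum) (auto simp: nn_integral_cmult)
    also have "\<dots> = (\<Sum>i<m. ennreal (real m * (v i)\<^sup>2))"
    proof (rule sum.cong[OF refl])
      fix i
      have "(real m * v i)\<^sup>2 * (1 / m) = real m * (v i)\<^sup>2" using m by (simp add: power2_eq_square)
      then show "ennreal ((real m * v i)\<^sup>2) * emeasure lborel (Q i) = ennreal (real m * (v i)\<^sup>2)"
        unfolding emQ by (metis ennreal_mult' zero_le_power2)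
    qed
    also have "\<dots> = ennreal (\<Sum>i<m. real m * (v i)\<^sup>2)" by (simp add: sum_ennreal)
    finally show "(\<integral>\<^sup>+u\<in>{0..1}. ennreal ((g u)\<^sup>2) \<partial>lborel) \<le> ennreal (\<Sum>i<m. real m * (v i)\<^sup>2)" .
  qed (simp add: sum_nonneg)
  show thesis
  proof (rule that)
    show "p \<in> D01" by (rule D01_continuousI[OF _ energy_le_continuous_on[OF en]]) (simp add: p_def)
    show "p 0 = 0" by (simp add: pP P0)
    show "energy_le p (\<Sum>i<m. real m * (v i)\<^sup>2)" by (rule en)
    fix i t assume i: "i < m" and t: "real i / m \<le> t" "t \<le> real (Suc i) / m"
    have "0 \<le> t" using t(1) by (metis divide_nonneg_nonneg of_nat_0_le_iff order_trans)
    moreover have "real (Suc i) / m \<le> 1" using i m by simp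
    then have "t \<le> 1" using t(2) by simp
    ultimately have "p t = P t" by (rule pP)
    also have "\<dots> = P (real i / m) + real m * v i * (t - real i / m)" using Pblock[OF i order_refl t] by simp
    also have "\<dots> = (\<Sum>k<i. v k) + v i * (real m * t - real i)"
      using Pgrid[of i] i m by (simp add: field_simps)
    finally show "p t = (\<Sum>k<i. v k) + v i * (real m * t - real i)" .
  qed
qed

text \<open>One \<delta> bounds the motion of the step path inside a block, the other that of the
  polygon, whose increment over the block is itself one of the controlled differences.\<close>

lemma step_path_near_polygon:
  assumes n: "0 < n" and m: "0 < m" and A0: "A 0 = 0"
    and osc: "\<And>i j. i < m \<Longrightarrow> j \<in> {block n m i..block n m (Suc i)} \<Longrightarrow> \<bar>A j - A (block n m i)\<bar> \<le> \<delta>"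
  obtains p where "p \<in> D01" "p 0 = 0" "sup_dist (step_path n A) p \<le> 2 * \<delta>"
    "energy_le p (\<Sum>i<m. real m * (A (block n m (Suc i)) - A (block n m i))\<^sup>2)"
proof -
  define v where "v i = A (block n m (Suc i)) - A (block n m i)" for i
  have tele: "(\<Sum>k<i. v k) = A (block n m i)" for i
    using sum_lessThan_telescope[of "\<lambda>k. A (block n m k)" i] A0 by (simp add: v_def)
  obtain p where p: "p \<in> D01" "p 0 = 0" "energy_le p (\<Sum>i<m. real m * (v i)\<^sup>2)"
    "\<And>i t. i < m \<Longrightarrow> real i / m \<le> t \<Longrightarrow> t \<le> real (Suc i) / m \<Longrightarrow>
       p t = (\<Sum>k<i. v k) + v i * (real m * t - real i)"
    using polygon[OF m, of v] by blast
  have "sup_dist (step_path n A) p \<le> 2 * \<delta>"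
  proof (rule sup_dist_least[OF step_path_in_D01[OF n] p(1)])
    fix t :: real assume t: "0 \<le> t" "t \<le> 1"
    obtain i where i: "i < m" "real i / m \<le> t" "t \<le> real (Suc i) / m" using block_cover[OF m t] by blast
    have "\<bar>v i\<bar> \<le> \<delta>" unfolding v_def using block_mono[of i "Suc i" n m] by (intro osc i) auto
    moreover have "\<bar>real m * t - real i\<bar> \<le> 1"
      using i m by (simp add: divide_le_eq le_divide_eq mult.commute)
    ultimately have "\<bar>v i * (real m * t - real i)\<bar> \<le> \<delta>"
      unfolding abs_mult by (metis abs_ge_zero mult_left_le order_trans)
    moreover have "\<bar>A (nat \<lfloor>real n * t\<rfloor>) - A (block n m i)\<bar> \<le> \<delta>"
      by (intro osc i block_bounds m)
    ultimately show "\<bar>step_path n A t - p t\<bar> \<le> 2 * \<delta>"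
      unfolding p(4)[OF i] tele using t by (simp add: step_path_def)
  qed
  with p show thesis by (intro that[of p]) (simp_all add: v_def)
qed

text \<open>One \<delta> each for the error at grid points, the motion of the step path inside a
  block, and the modulus of \<open>z\<close>. Increments are allowed errors of
  \<open>\<delta> / m\<close> because up to \<open>m\<close> of them accumulate at a grid
  point.\<close>

lemma step_path_near_path:
  assumes n: "0 < n" and m: "0 < m" and A0: "A 0 = 0" and z: "z \<in> D01" "z 0 = 0"
    and osc: "\<And>i j. i < m \<Longrightarrow> j \<in> {block n m i..block n m (Suc i)} \<Longrightarrow> \<bar>A j - A (block n m i)\<bar> \<le> \<delta>"
    and inc: "\<And>i. i < m \<Longrightarrow>
      \<bar>(A (block n m (Suc i)) - A (block n m i)) - (z (real (Suc i) / m) - z (real i / m))\<bar> \<le> \<delta> / m"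
    and mod: "\<And>s t. s \<in> {0..1} \<Longrightarrow> t \<in> {0..1} \<Longrightarrow> \<bar>t - s\<bar> \<le> 1 / m \<Longrightarrow> \<bar>z t - z s\<bar> \<le> \<delta>"
  shows "sup_dist (step_path n A) z \<le> 3 * \<delta>"
proof (rule sup_dist_least[OF step_path_in_D01[OF n] z(1)])
  have grid: "i \<le> m \<Longrightarrow> \<bar>A (block n m i) - z (real i / m)\<bar> \<le> real i * (\<delta> / m)" for i
  proof (induction i)
    case (Suc i)
    then have "\<bar>A (block n m (Suc i)) - z (real (Suc i) / m)\<bar> \<le> real i * (\<delta> / m) + \<delta> / m"
      using inc[of i] by linarith
    then show ?case by (simp add: distrib_right add_divide_distrib add.commute)
  qed (simp add: A0 z)
  fix t :: real assume t: "0 \<le> t" "t \<le> 1"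
  obtain i where i: "i < m" "real i / m \<le> t" "t \<le> real (Suc i) / m" using block_cover[OF m t] by blast
  have "0 \<le> \<delta>" using osc[of 0 0] m by simp
  then have "real i * (\<delta> / m) \<le> \<delta>" using i(1) m by (simp add: divide_le_eq mult.commute mult_left_mono)
  then have "\<bar>A (block n m i) - z (real i / m)\<bar> \<le> \<delta>" using grid[of i] i(1) by simp
  moreover have "\<bar>A (nat \<lfloor>real n * t\<rfloor>) - A (block n m i)\<bar> \<le> \<delta>"
    by (intro osc i block_bounds m)
  moreover have "\<bar>z t - z (real i / m)\<bar> \<le> \<delta>"
  proof (rule mod)
    show "real i / m \<in> {0..1}" using i(1) m by simp
    have "t - real i / m \<le> real (Suc i) / m - real i / m" using i by simp
    also have "\<dots> = 1 / m" by (simp add: diff_divide_distrib[symmetric])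
    finally show "\<bar>t - real i / m\<bar> \<le> 1 / m" using i by simp
  qed (use t in auto)
  ultimately show "\<bar>step_path n A t - z t\<bar> \<le> 3 * \<delta>"
    using t by (simp add: step_path_def)
qed

section \<open>Moderate deviations for triangular arrays\<close>

text \<open>\<open>G n \<theta>\<close> is the common logarithmic moment generating function of the row \<open>W n\<close> at \<open>\<theta> / a n\<close>.\<close>

locale mdp_array = prob_space M for M :: "'a measure" +
  fixes W :: "nat \<Rightarrow> nat \<Rightarrow> 'a \<Rightarrow> real" and a :: "nat \<Rightarrow> real" and c :: real
    and G :: "nat \<Rightarrow> real \<Rightarrow> real"
  assumes indep: "\<And>n. indep_vars (\<lambda>_. borel) (W n) UNIV"
    and integrable_W: "\<And>n k. integrable M (W n k)"
    and mean_0: "\<And>n k. expectation (W n k) = 0"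
    and a_lim: "a \<longlonglongrightarrow> 0" and a_pos: "\<forall>\<^sub>F n in sequentially. 0 < a n" and c_nonneg: "0 \<le> c"
    and mgf: "\<And>\<theta>. \<forall>\<^sub>F n in sequentially. \<forall>k. integrable M (\<lambda>\<omega>. exp (\<theta> / a n * W n k \<omega>)) \<and>
      expectation (\<lambda>\<omega>. exp (\<theta> / a n * W n k \<omega>)) = exp (G n \<theta>)"
    and mgf_lim: "\<And>\<theta>. (\<lambda>n. a n * real n * G n \<theta>) \<longlonglongrightarrow> c * \<theta>\<^sup>2 / 2"
begin

definition walk :: "nat \<Rightarrow> nat \<Rightarrow> 'a \<Rightarrow> real" where
  "walk n j \<omega> = (\<Sum>k<j. W n k \<omega>)"

definition walk_path :: "nat \<Rightarrow> 'a \<Rightarrow> real \<Rightarrow> real" where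
  "walk_path n \<omega> = step_path n (\<lambda>j. walk n j \<omega>)"

lemma W_measurable [measurable]: "W n k \<in> borel_measurable M"
  using integrable_W by (rule borel_measurable_integrable)

lemma walk_measurable [measurable]: "walk n j \<in> borel_measurable M"
  unfolding walk_def by measurable

lemma walk_0: "walk n 0 \<omega> = 0"
  by (simp add: walk_def)

lemma walk_diff: "p \<le> q \<Longrightarrow> walk n q \<omega> - walk n p \<omega> = (\<Sum>k\<in>{p..<q}. W n k \<omega>)"
  using sum.atLeastLessThan_concat[of 0 p q "\<lambda>k. W n k \<omega>"]
  by (simp add: walk_def lessThan_atLeast0)

lemma walk_path_measurable: "0 < n \<Longrightarrow> walk_path n \<in> measurable M D01_borel"
  unfolding walk_path_def
  by (rule measurable_compose[OF measurable_coordinatewise_then_product step_path_measurable]) simp_all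

lemma block_mgf:
  shows "\<forall>\<^sub>F n in sequentially. integrable M (\<lambda>\<omega>. exp (\<theta> / a n * (\<Sum>k\<in>{p n..<q n}. W n k \<omega>))) \<and>
      expectation (\<lambda>\<omega>. exp (\<theta> / a n * (\<Sum>k\<in>{p n..<q n}. W n k \<omega>))) = exp (real (q n - p n) * G n \<theta>)"
  using mgf[of \<theta>]
proof eventually_elim
  case (elim n)
  have "indep_vars (\<lambda>_. borel) (\<lambda>k \<omega>. \<theta> / a n * W n k \<omega>) UNIV"
    by (rule indep_vars_compose2[OF indep]) simp
  from indep_vars_exp_sum[OF this, of "{p n..<q n}"] elim show ?case
    by (simp add: sum_distrib_left exp_of_nat_mult)
qed

lemma block_mgf_lim:
  assumes \<Delta>: "(\<lambda>n. real (q n - p n) / real n) \<longlonglongrightarrow> \<Delta>"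
  shows "(\<lambda>n. a n * (real (q n - p n) * G n \<theta>)) \<longlonglongrightarrow> c * \<Delta> * \<theta>\<^sup>2 / 2"
proof -
  have "(\<lambda>n. (a n * real n * G n \<theta>) * (real (q n - p n) / real n)) \<longlonglongrightarrow> c * \<theta>\<^sup>2 / 2 * \<Delta>"
    by (intro tendsto_mult mgf_lim \<Delta>)
  moreover have "\<forall>\<^sub>F n in sequentially. (a n * real n * G n \<theta>) * (real (q n - p n) / real n)
      = a n * (real (q n - p n) * G n \<theta>)"
    using eventually_gt_at_top[of 0] by eventually_elim simp
  ultimately have "(\<lambda>n. a n * (real (q n - p n) * G n \<theta>)) \<longlonglongrightarrow> c * \<theta>\<^sup>2 / 2 * \<Delta>"
    by (rule Lim_transform_eventually)
  then show ?thesis by (simp add: mult_ac)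
qed

text \<open>Applied with \<open>t = \<theta>\<close> and \<open>t = - \<theta>\<close>, the
  exponential maximal inequality controls both signs, the quadratic limit being even in
  \<open>t\<close>. \<theta> remains free: it is optimized for the tails of increments and taken
  large for oscillations.\<close>

lemma maximal_deviation:
  fixes p q :: "nat \<Rightarrow> nat"
  assumes pq: "\<And>n. p n \<le> q n" and \<Delta>: "(\<lambda>n. real (q n - p n) / real n) \<longlonglongrightarrow> \<Delta>"
    and \<theta>: "0 \<le> \<theta>" and \<eta>: "0 < \<eta>"
  shows "\<forall>\<^sub>F n in sequentially. prob {\<omega> \<in> space M. \<exists>j\<in>{p n..q n}. u \<le> \<bar>walk n j \<omega> - walk n (p n) \<omega>\<bar>}
    \<le> 2 * exp (- (\<theta> * u - c * \<Delta> * \<theta>\<^sup>2 / 2 - \<eta>) / a n)"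
proof -
  have one: "\<forall>\<^sub>F n in sequentially. prob {\<omega> \<in> space M. \<exists>j\<in>{p n..q n}. \<theta> * u \<le> t * (walk n j \<omega> - walk n (p n) \<omega>)}
    \<le> exp (- (\<theta> * u - c * \<Delta> * t\<^sup>2 / 2 - \<eta>) / a n)" for t
  proof -
    have "\<forall>\<^sub>F n in sequentially. a n * (real (q n - p n) * G n t) < c * \<Delta> * t\<^sup>2 / 2 + \<eta>"
      using block_mgf_lim[where q = q and p = p, OF \<Delta>, of t] \<eta> by (intro order_tendstoD(2)) auto
    with mgf[of t] a_pos show ?thesis
    proof eventually_elim
      case (elim n)
      have ind: "indep_vars (\<lambda>_. borel) (\<lambda>k \<omega>. t / a n * W n k \<omega>) UNIV"
        by (rule indep_vars_compose2[OF indep]) simp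
      \<comment> \<open>Centering enters here, through \<open>exp y \<ge> 1 + y\<close>.\<close>
      have ge1: "1 \<le> expectation (\<lambda>\<omega>. exp (t / a n * W n k \<omega>))" for k
      proof -
        have "expectation (\<lambda>\<omega>. 1 + t / a n * W n k \<omega>) \<le> expectation (\<lambda>\<omega>. exp (t / a n * W n k \<omega>))"
          using elim(1) integrable_W by (intro integral_mono) (auto simp: exp_ge_add_one_self)
        then show ?thesis using integrable_W[of n k] mean_0[of n k] by (simp add: prob_space)
      qed
      have eq: "(\<theta> * u \<le> t * (walk n j \<omega> - walk n (p n) \<omega>)) \<longleftrightarrow>
          (\<theta> * u / a n \<le> (\<Sum>k\<in>{p n..<j}. t / a n * W n k \<omega>))" if "j \<in> {p n..q n}" for j \<omega>
      proof -
        have "(\<Sum>k\<in>{p n..<j}. t / a n * W n k \<omega>) = t * (walk n j \<omega> - walk n (p n) \<omega>) / a n"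
          using that by (simp add: walk_diff sum_distrib_left sum_divide_distrib)
        then show ?thesis using elim(2) by (simp add: divide_le_cancel)
      qed
      have "prob {\<omega> \<in> space M. \<exists>j\<in>{p n..q n}. \<theta> * u \<le> t * (walk n j \<omega> - walk n (p n) \<omega>)} =
          prob {\<omega> \<in> space M. \<exists>j\<in>{p n..q n}. \<theta> * u / a n \<le> (\<Sum>k\<in>{p n..<j}. t / a n * W n k \<omega>)}"
        using eq by (intro arg_cong[where f = prob] Collect_cong conj_cong bex_cong refl) auto
      also have "\<dots> \<le> exp (- (\<theta> * u / a n)) * (\<Prod>k\<in>{p n..<q n}. expectation (\<lambda>\<omega>. exp (t / a n * W n k \<omega>)))"
        using elim(1) ge1 by (intro exp_sum_maximal_inequality[OF ind pq]) auto
      also have "(\<Prod>k\<in>{p n..<q n}. expectation (\<lambda>\<omega>. exp (t / a n * W n k \<omega>))) = exp (real (q n - p n) * G n t)"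
        using elim(1) by (simp add: exp_of_nat_mult)
      also have "exp (- (\<theta> * u / a n)) * exp (real (q n - p n) * G n t)
          = exp ((- (\<theta> * u) + a n * (real (q n - p n) * G n t)) / a n)"
        using elim(2) by (simp add: diff_divide_distrib flip: exp_add)
      also have "\<dots> \<le> exp (- (\<theta> * u - c * \<Delta> * t\<^sup>2 / 2 - \<eta>) / a n)"
        using elim by (simp only: exp_le_cancel_iff) (intro divide_right_mono, auto)
      finally show ?case .
    qed
  qed
  show ?thesis
    using one[of \<theta>] one[of "- \<theta>"]
  proof eventually_elim
    case (elim n)
    let ?D = "\<lambda>t. {\<omega> \<in> space M. \<exists>j\<in>{p n..q n}. \<theta> * u \<le> t * (walk n j \<omega> - walk n (p n) \<omega>)}"
    have [measurable]: "?D t \<in> sets M" for t by measurable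
    have "{\<omega> \<in> space M. \<exists>j\<in>{p n..q n}. u \<le> \<bar>walk n j \<omega> - walk n (p n) \<omega>\<bar>} \<subseteq> ?D \<theta> \<union> ?D (- \<theta>)"
    proof
      fix \<omega> assume "\<omega> \<in> {\<omega> \<in> space M. \<exists>j\<in>{p n..q n}. u \<le> \<bar>walk n j \<omega> - walk n (p n) \<omega>\<bar>}"
      then obtain j where j: "\<omega> \<in> space M" "j \<in> {p n..q n}" "u \<le> \<bar>walk n j \<omega> - walk n (p n) \<omega>\<bar>" by blast
      from mult_left_mono[OF j(3) \<theta>]
      have "\<theta> * u \<le> \<theta> * (walk n j \<omega> - walk n (p n) \<omega>) \<or> \<theta> * u \<le> - \<theta> * (walk n j \<omega> - walk n (p n) \<omega>)"
        by (auto simp: abs_if algebra_simps split: if_splits)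
      with j show "\<omega> \<in> ?D \<theta> \<union> ?D (- \<theta>)" by blast
    qed
    then have "prob {\<omega> \<in> space M. \<exists>j\<in>{p n..q n}. u \<le> \<bar>walk n j \<omega> - walk n (p n) \<omega>\<bar>} \<le> prob (?D \<theta> \<union> ?D (- \<theta>))"
      by (intro finite_measure_mono) auto
    also have "\<dots> \<le> prob (?D \<theta>) + prob (?D (- \<theta>))" by (intro measure_Un_le) auto
    also have "\<dots> \<le> 2 * exp (- (\<theta> * u - c * \<Delta> * \<theta>\<^sup>2 / 2 - \<eta>) / a n)" using elim by simp
    finally show ?case .
  qed
qed

section \<open>Increments over blocks and oscillation within blocks\<close>

definition increment :: "nat \<Rightarrow> nat \<Rightarrow> nat \<Rightarrow> 'a \<Rightarrow> real" where
  "increment m n i \<omega> = walk n (block n m (Suc i)) \<omega> - walk n (block n m i) \<omega>"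

lemma increment_measurable [measurable]: "increment m n i \<in> borel_measurable M"
  unfolding increment_def by measurable

lemma block_Suc: "block n m i \<le> block n m (Suc i)"
  by (rule block_mono) simp

lemma increment_eq_sum: "increment m n i = (\<lambda>\<omega>. \<Sum>k\<in>{block n m i..<block n m (Suc i)}. W n k \<omega>)"
  by (rule ext) (simp add: increment_def walk_diff[OF block_Suc])

lemma indep_increments: "indep_vars (\<lambda>_. borel) (increment m n) {..<m}"
proof -
  let ?K = "\<lambda>i. {block n m i..<block n m (Suc i)}"
  have "disjoint_family_on ?K {..<m}"
  proof -
    have "?K i \<inter> ?K j = {}" if "i < j" for i j using block_mono[of "Suc i" j n m] that by auto
    then show ?thesis unfolding disjoint_family_on_def by (metis Int_commute linorder_neqE_nat)
  qed
  then have "indep_vars (\<lambda>i. PiM (?K i) (\<lambda>_. borel)) (\<lambda>i \<omega>. restrict (\<lambda>k. W n k \<omega>) (?K i)) {..<m}"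
    by (intro indep_vars_restrict[OF indep]) auto
  then have "indep_vars (\<lambda>_. borel) (\<lambda>i \<omega>. \<Sum>k\<in>?K i. restrict (\<lambda>k. W n k \<omega>) (?K i) k) {..<m}"
    by (rule indep_vars_compose2) (intro borel_measurable_sum measurable_component_singleton)
  then show ?thesis
    by (subst indep_vars_cong[OF refl _ refl]) (auto simp: increment_eq_sum)
qed

text \<open>At speed \<open>a\<close> the increment behaves like a Gaussian variable of variance
  \<open>c / m\<close>, so its square over twice the variance has a tail of exponential rate 1. A
  positive \<open>c'\<close> stands in for \<open>c\<close>, which may be 0.\<close>

lemma exp_tail_increment_square:
  assumes m: "0 < m" and c': "0 < c'" "c \<le> c'"
  shows "exp_tail a (\<lambda>n \<omega>. real m * (increment m n i \<omega>)\<^sup>2 / (2 * c'))"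
proof (rule exp_tailI[OF a_pos])
  fix s s' :: real assume s: "0 < s" "s' < s"
  define u where "u = sqrt (2 * c' * s / m)"
  \<comment> \<open>Maximizes \<open>\<theta> * u - c' * \<theta>\<^sup>2 / (2 * m)\<close>; the
    maximum is \<open>u\<^sup>2 * m / (2 * c') = s\<close>.\<close>
  define \<theta> where "\<theta> = u * m / c'"
  define \<eta> where "\<eta> = (s - s') / 2"
  have eta: "0 < \<eta>" and s'_eq: "s' = s - 2 * \<eta>" using s by (simp_all add: \<eta>_def field_simps)
  have u2: "u\<^sup>2 = 2 * c' * s / m" using c' s by (simp add: u_def)
  have u0: "0 \<le> u" using c' s by (simp add: u_def)
  have \<theta>0: "0 \<le> \<theta>" using u0 c' by (simp add: \<theta>_def)
  have \<theta>u: "\<theta> * u = 2 * s"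
  proof -
    have "\<theta> * u = u\<^sup>2 * m / c'" by (simp add: \<theta>_def power2_eq_square)
    also have "\<dots> = 2 * s" using c' m by (simp add: u2)
    finally show ?thesis .
  qed
  have \<theta>2: "c * (1 / m) * \<theta>\<^sup>2 / 2 \<le> s"
  proof -
    have "c * (1 / m) * \<theta>\<^sup>2 / 2 = c * (u\<^sup>2 * m / c') / (2 * c')"
      using m by (simp add: \<theta>_def power2_eq_square)
    also have "\<dots> = c / c' * s" using c' m by (simp add: u2)
    also have "\<dots> \<le> s" using c' s by (simp add: divide_le_eq mult.commute)
    finally show ?thesis .
  qed
  have dev: "\<forall>\<^sub>F n in sequentially. prob {\<omega> \<in> space M. \<exists>j\<in>{block n m i..block n m (Suc i)}.
      u \<le> \<bar>walk n j \<omega> - walk n (block n m i) \<omega>\<bar>} \<le> 2 * exp (- (\<theta> * u - c * (1 / m) * \<theta>\<^sup>2 / 2 - \<eta>) / a n)"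
    by (rule maximal_deviation[OF block_Suc block_asymptotics[OF m] \<theta>0 eta])
  show "\<forall>\<^sub>F n in sequentially. prob {\<omega> \<in> space M. s \<le> real m * (increment m n i \<omega>)\<^sup>2 / (2 * c')} \<le> exp (- s' / a n)"
    using dev
      eventually_exp_absorb[OF a_lim a_pos eta, of 2] a_pos
  proof eventually_elim
    case (elim n)
    have "prob {\<omega> \<in> space M. s \<le> real m * (increment m n i \<omega>)\<^sup>2 / (2 * c')} \<le>
      prob {\<omega> \<in> space M. \<exists>j\<in>{block n m i..block n m (Suc i)}. u \<le> \<bar>walk n j \<omega> - walk n (block n m i) \<omega>\<bar>}"
    proof (intro finite_measure_mono Collect_mono impI)
      fix \<omega> assume w: "\<omega> \<in> space M \<and> s \<le> real m * (increment m n i \<omega>)\<^sup>2 / (2 * c')"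
      then have "u\<^sup>2 \<le> (increment m n i \<omega>)\<^sup>2" using c' m by (simp add: u2 field_simps)
      then have "u \<le> \<bar>increment m n i \<omega>\<bar>" by (simp add: abs_le_square_iff[symmetric])
      then show "\<omega> \<in> space M \<and> (\<exists>j\<in>{block n m i..block n m (Suc i)}. u \<le> \<bar>walk n j \<omega> - walk n (block n m i) \<omega>\<bar>)"
        using w block_Suc[of n m i] unfolding increment_def by (intro conjI bexI[of _ "block n m (Suc i)"]) auto
    qed measurable
    also have "\<dots> \<le> 2 * exp (- (\<theta> * u - c * (1 / m) * \<theta>\<^sup>2 / 2 - \<eta>) / a n)" by (rule elim(1))
    also have "\<dots> \<le> exp (\<eta> / a n) * exp (- (s - \<eta>) / a n)"
    proof (intro mult_mono elim(2))
      have "- (\<theta> * u - c * (1 / m) * \<theta>\<^sup>2 / 2 - \<eta>) \<le> - (s - \<eta>)" using \<theta>u \<theta>2 by linarith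
      then show "exp (- (\<theta> * u - c * (1 / m) * \<theta>\<^sup>2 / 2 - \<eta>) / a n) \<le> exp (- (s - \<eta>) / a n)"
        using elim(3) by (simp only: exp_le_cancel_iff) (intro divide_right_mono, auto)
    qed auto
    also have "\<dots> = exp (- s' / a n)"
      by (simp add: s'_eq add_divide_distrib[symmetric] flip: exp_add)
    finally show ?case .
  qed
qed

definition oscillation :: "nat \<Rightarrow> real \<Rightarrow> nat \<Rightarrow> 'a set" where
  "oscillation m \<delta> n = {\<omega> \<in> space M. \<exists>i\<in>{..<m}. \<exists>j\<in>{block n m i..block n m (Suc i)}.
     \<delta> \<le> \<bar>walk n j \<omega> - walk n (block n m i) \<omega>\<bar>}"

lemma oscillation_measurable [measurable]: "oscillation m \<delta> n \<in> sets M"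
  unfolding oscillation_def by measurable

text \<open>The tilt \<theta> is fixed first, by the required rate \<open>L\<close>; then
  \<open>m\<close> is taken so large that the block variance \<open>c / m\<close> makes the
  quadratic term harmless.\<close>

lemma oscillation_superexponential:
  assumes \<delta>: "0 < \<delta>"
  obtains m where "m0 \<le> m" "0 < m" "\<forall>\<^sub>F n in sequentially. prob (oscillation m \<delta> n) \<le> exp (- L / a n)"
proof -
  \<comment> \<open>Of the surplus 3, one unit pays for the quadratic term, one for the error
    \<open>\<eta> = 1\<close> of the limit, and one for the factor \<open>2 * m\<close>.\<close>
  define \<theta> where "\<theta> = (\<bar>L\<bar> + 3) / \<delta>"
  have \<theta>: "0 \<le> \<theta>" "\<theta> * \<delta> = \<bar>L\<bar> + 3" using \<delta> by (auto simp: \<theta>_def)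
  define m where "m = m0 + nat \<lceil>c * \<theta>\<^sup>2\<rceil> + 1"
  have m: "m0 \<le> m" "0 < m" by (auto simp: m_def)
  have "c * \<theta>\<^sup>2 \<le> real m" unfolding m_def by linarith
  then have small: "c * (1 / m) * \<theta>\<^sup>2 / 2 \<le> 1" using m(2) by (simp add: divide_le_eq)
  have "\<forall>\<^sub>F n in sequentially. \<forall>i\<in>{..<m}.
      prob {\<omega> \<in> space M. \<exists>j\<in>{block n m i..block n m (Suc i)}. \<delta> \<le> \<bar>walk n j \<omega> - walk n (block n m i) \<omega>\<bar>}
      \<le> 2 * exp (- (\<theta> * \<delta> - c * (1 / m) * \<theta>\<^sup>2 / 2 - 1) / a n)"
    by (intro eventually_ball_finite ballI maximal_deviation block_Suc block_asymptotics m \<theta>) auto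
  moreover have "\<forall>\<^sub>F n in sequentially. real m * 2 \<le> exp (1 / a n)"
    by (rule eventually_exp_absorb[OF a_lim a_pos]) simp
  ultimately have "\<forall>\<^sub>F n in sequentially. prob (oscillation m \<delta> n) \<le> exp (- L / a n)"
    using a_pos
  proof eventually_elim
    case (elim n)
    let ?O = "\<lambda>i. {\<omega> \<in> space M. \<exists>j\<in>{block n m i..block n m (Suc i)}. \<delta> \<le> \<bar>walk n j \<omega> - walk n (block n m i) \<omega>\<bar>}"
    have "oscillation m \<delta> n = (\<Union>i\<in>{..<m}. ?O i)" by (auto simp: oscillation_def)
    then have "prob (oscillation m \<delta> n) \<le> (\<Sum>i\<in>{..<m}. prob (?O i))"
      by (simp only:) (rule finite_measure_subadditive_finite, auto)
    also have "\<dots> \<le> (\<Sum>i\<in>{..<m}. 2 * exp (- (\<bar>L\<bar> + 1) / a n))"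
    proof (rule sum_mono)
      fix i assume i: "i \<in> {..<m}"
      have "prob (?O i) \<le> 2 * exp (- (\<theta> * \<delta> - c * (1 / m) * \<theta>\<^sup>2 / 2 - 1) / a n)" by (rule bspec[OF elim(1) i])
      also have "\<dots> \<le> 2 * exp (- (\<bar>L\<bar> + 1) / a n)"
      proof -
        have "- (\<theta> * \<delta> - c * (1 / m) * \<theta>\<^sup>2 / 2 - 1) \<le> - (\<bar>L\<bar> + 1)" using \<theta>(2) small by linarith
        then have "- (\<theta> * \<delta> - c * (1 / m) * \<theta>\<^sup>2 / 2 - 1) / a n \<le> - (\<bar>L\<bar> + 1) / a n"
          using elim(3) by (intro divide_right_mono) auto
        then show ?thesis by simp
      qed
      finally show "prob (?O i) \<le> 2 * exp (- (\<bar>L\<bar> + 1) / a n)" .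
    qed
    also have "\<dots> = (real m * 2) * exp (- (\<bar>L\<bar> + 1) / a n)" by simp
    also have "\<dots> \<le> exp (1 / a n) * exp (- (\<bar>L\<bar> + 1) / a n)" by (intro mult_right_mono elim(2)) simp
    also have "\<dots> = exp (- \<bar>L\<bar> / a n)" by (simp add: add_divide_distrib[symmetric] flip: exp_add)
    also have "\<dots> \<le> exp (- L / a n)" using elim(3) by (simp add: divide_right_mono)
    finally show ?case .
  qed
  with m show thesis by (intro that)
qed

lemma upper_bound:
  assumes F: "closedin D01_top F" and \<alpha>: "0 < \<alpha>" and disj: "F \<inter> energy_level (2 * \<alpha> * c) = {}"
  shows "\<forall>\<^sub>F n in sequentially. prob {\<omega> \<in> space M. walk_path n \<omega> \<in> F} \<le> 2 * exp (- \<alpha> / a n)"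
proof -
  obtain \<delta> E where \<delta>: "0 < \<delta>" and E: "2 * \<alpha> * c < E" and
    sep: "\<And>w z. w \<in> F \<Longrightarrow> z \<in> D01 \<Longrightarrow> z 0 = 0 \<Longrightarrow> sup_dist w z < \<delta> \<Longrightarrow> \<not> energy_le z E"
    using closed_energy_level_separation[OF F disj] by blast
  have "0 \<le> 2 * \<alpha> * c" using \<alpha> c_nonneg by simp
  then have E0: "0 < E" using E by simp
  \<comment> \<open>Midpoint of \<open>c\<close> and \<open>E / (2 * \<alpha>)\<close>. Being
    positive it may be a divisor even if \<open>c = 0\<close>; being below
    \<open>E / (2 * \<alpha>)\<close> it leaves the exponent \<open>E / (2 * c')\<close> above
    \<alpha>.\<close>
  define c' where "c' = (c + E / (2 * \<alpha>)) / 2"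
  have "c < E / (2 * \<alpha>)" using E \<alpha> by (simp add: less_divide_eq mult_ac)
  then have c': "0 < c'" "c \<le> c'" "c' < E / (2 * \<alpha>)" using c_nonneg by (auto simp: c'_def)
  have s: "\<alpha> < E / (2 * c')"
    using c' \<alpha> by (simp add: less_divide_eq mult_ac)
  \<comment> \<open>Oscillation below \<open>\<delta> / 3\<close> puts the polygon within
    \<open>2 * \<delta> / 3\<close> of the path, strictly closer than the separation \<delta>, so
    its energy is at least \<open>E\<close>.\<close>
  have "0 < \<delta> / 3" using \<delta> by simp
  then obtain m where m: "0 < m"
    and osc: "\<forall>\<^sub>F n in sequentially. prob (oscillation m (\<delta> / 3) n) \<le> exp (- \<alpha> / a n)"
    using oscillation_superexponential[of "\<delta> / 3" 0 \<alpha>] by blast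
  have "exp_tail a (\<lambda>n \<omega>. \<Sum>i<m. real m * (increment m n i \<omega>)\<^sup>2 / (2 * c'))"
  proof (rule exp_tail_sum[OF a_lim a_pos])
    show "exp_tail a (\<lambda>n \<omega>. real m * (increment m n i \<omega>)\<^sup>2 / (2 * c'))" for i
      by (rule exp_tail_increment_square[OF m c'(1,2)])
    show "indep_vars (\<lambda>_. borel) (\<lambda>i \<omega>. real m * (increment m n i \<omega>)\<^sup>2 / (2 * c')) {..<m}" for n
      by (rule indep_vars_compose2[OF indep_increments]) simp
  qed (use c' in auto)
  then have "\<forall>\<^sub>F n in sequentially. prob {\<omega> \<in> space M. E / (2 * c') \<le> (\<Sum>i<m. real m * (increment m n i \<omega>)\<^sup>2 / (2 * c'))}
      \<le> exp (- \<alpha> / a n)"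
    using s unfolding exp_tail_def by blast
  with osc show ?thesis using eventually_gt_at_top[of 0]
  proof eventually_elim
    case (elim n)
    let ?T = "{\<omega> \<in> space M. E / (2 * c') \<le> (\<Sum>i<m. real m * (increment m n i \<omega>)\<^sup>2 / (2 * c'))}"
    have [measurable]: "?T \<in> sets M" by measurable
    have "{\<omega> \<in> space M. walk_path n \<omega> \<in> F} \<subseteq> oscillation m (\<delta> / 3) n \<union> ?T"
    proof
      fix \<omega> assume w: "\<omega> \<in> {\<omega> \<in> space M. walk_path n \<omega> \<in> F}"
      show "\<omega> \<in> oscillation m (\<delta> / 3) n \<union> ?T"
      proof (cases "\<omega> \<in> oscillation m (\<delta> / 3) n")
        case False
        with w have "\<And>i j. i < m \<Longrightarrow> j \<in> {block n m i..block n m (Suc i)} \<Longrightarrow>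
            \<bar>walk n j \<omega> - walk n (block n m i) \<omega>\<bar> \<le> \<delta> / 3"
          unfolding oscillation_def by (force simp: not_le)
        then obtain p where p: "p \<in> D01" "p 0 = 0" "sup_dist (walk_path n \<omega>) p \<le> 2 * (\<delta> / 3)"
          "energy_le p (\<Sum>i<m. real m * (increment m n i \<omega>)\<^sup>2)"
          using step_path_near_polygon[OF elim(3) m, of "\<lambda>j. walk n j \<omega>" "\<delta> / 3"] walk_0
          unfolding walk_path_def increment_def by blast
        have "\<not> energy_le p E" using w p(3) \<delta> by (intro sep[of "walk_path n \<omega>"] p) auto
        then have "E \<le> (\<Sum>i<m. real m * (increment m n i \<omega>)\<^sup>2)" using energy_le_mono[OF p(4)] by (meson linear)
        then have "E / (2 * c') \<le> (\<Sum>i<m. real m * (increment m n i \<omega>)\<^sup>2) / (2 * c')"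
          using c' by (intro divide_right_mono) auto
        then show ?thesis using w by (simp add: sum_divide_distrib)
      qed simp
    qed
    then have "prob {\<omega> \<in> space M. walk_path n \<omega> \<in> F} \<le> prob (oscillation m (\<delta> / 3) n \<union> ?T)"
      by (intro finite_measure_mono) auto
    also have "\<dots> \<le> prob (oscillation m (\<delta> / 3) n) + prob ?T"
      by (intro measure_Un_le) auto
    also have "\<dots> \<le> 2 * exp (- \<alpha> / a n)" using elim by simp
    finally show ?case .
  qed
qed

lemma energy_le_grid:
  assumes E: "energy_le z E" and m: "0 < m"
  shows "(\<Sum>i<m. real m * (z (real (Suc i) / m) - z (real i / m))\<^sup>2) \<le> E"
proof -
  have "interval_family 0 1 {..<m} (\<lambda>i. real i / m) (\<lambda>i. real (Suc i) / m)"
  proof (rule interval_familyI)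
    fix i j :: nat and x assume "real i / m < x" "x < real (Suc i) / m" "real j / m < x" "x < real (Suc j) / m"
    then have "real i / m < real (Suc j) / m" "real j / m < real (Suc i) / m" by linarith+
    then show "i = j" using m by (simp add: divide_less_cancel)
  qed (use m in \<open>auto simp: divide_right_mono\<close>)
  with E have "(\<Sum>i<m. (z (real (Suc i) / m) - z (real i / m))\<^sup>2 / (real (Suc i) / m - real i / m)) \<le> E"
    unfolding energy_le_def by blast
  then show ?thesis by (simp add: diff_divide_distrib[symmetric] mult.commute)
qed

text \<open>The block increments are steered to those of \<open>z\<close> at a cost of at most
  \<open>\<alpha> + \<eta> / 2\<close>; large oscillation has the strictly faster rate
  \<open>\<alpha> + \<eta>\<close>, so its probability can be subtracted.\<close>

lemma lower_bound:
  assumes z: "z \<in> D01" "z 0 = 0" "energy_le z (2 * \<alpha> * c)" and \<alpha>: "0 \<le> \<alpha>"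
    and \<delta>: "0 < \<delta>" and \<eta>: "0 < \<eta>"
  shows "\<forall>\<^sub>F n in sequentially. exp (- (\<alpha> + \<eta>) / a n) \<le> prob {\<omega> \<in> space M. walk_path n \<omega> \<in> D01.mball z \<delta>}"
proof -
  define E where "E = 2 * \<alpha> * c"
  have E: "energy_le z E" "0 \<le> E" using z energy_le_nonneg unfolding E_def by auto
  \<comment> \<open>The three errors of \<open>step_path_near_path\<close> add up to
    \<open>3 * d\<close>, below \<delta>.\<close>
  define d where "d = \<delta> / 4"
  have d: "0 < d" using \<delta> by (simp add: d_def)
  \<comment> \<open>For \<open>m \<ge> m0\<close> the modulus \<open>sqrt (E / m)\<close> of
    \<open>z\<close> over one block is at most \<open>d\<close>.\<close>
  define m0 where "m0 = nat \<lceil>E / d\<^sup>2\<rceil>"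
  obtain m where m: "m0 \<le> m" "0 < m"
    and osc: "\<forall>\<^sub>F n in sequentially. prob (oscillation m d n) \<le> exp (- (\<alpha> + \<eta>) / a n)"
    using oscillation_superexponential[OF d] by blast
  have mod: "\<bar>z t - z s\<bar> \<le> d" if st: "s \<in> {0..1}" "t \<in> {0..1}" "\<bar>t - s\<bar> \<le> 1 / m" for s t
  proof -
    have "\<bar>z t - z s\<bar> \<le> sqrt (E * \<bar>t - s\<bar>)" by (rule energy_le_modulus[OF E(1) st(1,2)])
    also have "\<dots> \<le> sqrt (d\<^sup>2)"
    proof (rule real_sqrt_le_mono)
      have "E / d\<^sup>2 \<le> real m0" unfolding m0_def by linarith
      also have "\<dots> \<le> real m" using m by simp
      finally have "E / m \<le> d\<^sup>2" using d m by (simp add: divide_le_eq mult.commute)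
      moreover have "E * \<bar>t - s\<bar> \<le> E * (1 / m)" by (intro mult_left_mono st E)
      ultimately show "E * \<bar>t - s\<bar> \<le> d\<^sup>2" by simp
    qed
    finally show ?thesis using d by simp
  qed
  define u where "u i = z (real (Suc i) / m) - z (real i / m)" for i
  \<comment> \<open>The tilt whose limiting mean \<open>c / m * \<theta> i\<close> is the target
    increment. If \<open>c = 0\<close>, the energy bound is 0 and every target increment vanishes,
    so that 0 fits.\<close>
  define \<theta> where "\<theta> i = (if c = 0 then 0 else m * u i / c)" for i
  have u\<theta>: "u i = c * (1 / m) * \<theta> i" if i: "i < m" for i
  proof (cases "c = 0")
    case True
    have "(u i)\<^sup>2 \<le> E * (real (Suc i) / m - real i / m)"
      unfolding u_def using i m(2) by (intro energy_leD[OF E(1)]) (auto simp: divide_right_mono)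
    then show ?thesis using True by (simp add: E_def \<theta>_def)
  qed (use m in \<open>simp add: \<theta>_def\<close>)
  have sum\<theta>: "(\<Sum>i<m. c * (1 / m) * (\<theta> i)\<^sup>2 / 2) \<le> \<alpha>"
  proof (cases "c = 0")
    case False
    then have c: "0 < c" using c_nonneg by simp
    have "(\<Sum>i<m. c * (1 / m) * (\<theta> i)\<^sup>2 / 2) = (\<Sum>i<m. real m * (u i)\<^sup>2) / (2 * c)"
      using c m(2) by (simp add: \<theta>_def power2_eq_square sum_divide_distrib mult_ac)
    also have "\<dots> \<le> E / (2 * c)"
      using energy_le_grid[OF E(1) m(2)] c unfolding u_def by (intro divide_right_mono) auto
    also have "\<dots> = \<alpha>" using c by (simp add: E_def)
    finally show ?thesis .
  qed (use \<alpha> in simp)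
  \<comment> \<open>Each block may lose \<open>\<eta> / (2 * m)\<close>, in all
    \<open>\<eta> / 2\<close>; the other half of \<eta> is kept for the oscillation.\<close>
  let ?e = "\<lambda>i. c * (1 / m) * (\<theta> i)\<^sup>2 / 2 + \<eta> / (2 * m)"
  have "\<forall>\<^sub>F n in sequentially. \<forall>i\<in>{..<m}. exp (- ?e i / a n) \<le>
      prob {\<omega> \<in> space M. \<bar>increment m n i \<omega> - c * (1 / m) * \<theta> i\<bar> < d / m}"
  proof (intro eventually_ball_finite ballI)
    fix i
    show "\<forall>\<^sub>F n in sequentially. exp (- ?e i / a n) \<le>
      prob {\<omega> \<in> space M. \<bar>increment m n i \<omega> - c * (1 / m) * \<theta> i\<bar> < d / m}"
    proof (rule gaussian_log_mgf_lower_bound[OF _ a_lim a_pos])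
      show "(\<lambda>n. a n * (real (block n m (Suc i) - block n m i) * G n \<theta>)) \<longlonglongrightarrow> c * (1 / m) * \<theta>\<^sup>2 / 2" for \<theta>
        by (rule block_mgf_lim[OF block_asymptotics[OF m(2)]])
      show "\<forall>\<^sub>F n in sequentially. integrable M (\<lambda>\<omega>. exp (\<theta> / a n * increment m n i \<omega>)) \<and>
        expectation (\<lambda>\<omega>. exp (\<theta> / a n * increment m n i \<omega>)) = exp (real (block n m (Suc i) - block n m i) * G n \<theta>)" for \<theta>
        unfolding increment_eq_sum by (rule block_mgf)
    qed (use c_nonneg d m \<eta> in auto)
  qed simp
  moreover have "\<forall>\<^sub>F n in sequentially. 2 \<le> exp ((\<eta> / 2) / a n)"
    by (rule eventually_exp_absorb[OF a_lim a_pos]) (use \<eta> in simp)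
  ultimately show ?thesis using osc a_pos eventually_gt_at_top[of 0]
  proof eventually_elim
    case (elim n)
    let ?I = "\<lambda>i. {\<omega> \<in> space M. \<bar>increment m n i \<omega> - c * (1 / m) * \<theta> i\<bar> < d / m}"
    let ?B = "{\<omega> \<in> space M. walk_path n \<omega> \<in> D01.mball z \<delta>}"
    have Bm: "?B \<in> sets M"
    proof -
      have "D01.mball z \<delta> \<in> sets D01_borel"
        unfolding sets_D01_borel D01_top_def by (intro sigma_sets.Basic) simp
      from measurable_sets[OF walk_path_measurable[OF elim(5)] this] show ?thesis
        by (simp add: vimage_def Int_def conj_commute)
    qed
    have Im [measurable]: "(\<Inter>i\<in>{..<m}. ?I i) \<in> sets M"
      using m(2) by (intro sets.finite_INT) auto
    have "exp (- (\<alpha> + \<eta> / 2) / a n) \<le> exp (\<Sum>i<m. - ?e i / a n)"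
    proof -
      have "(\<Sum>i<m. c * (1 / m) * (\<theta> i)\<^sup>2 / 2 + \<eta> / (2 * m)) \<le> \<alpha> + \<eta> / 2"
        using sum\<theta> m(2) by (simp add: sum.distrib)
      then have "- (\<alpha> + \<eta> / 2) / a n \<le> - (\<Sum>i<m. c * (1 / m) * (\<theta> i)\<^sup>2 / 2 + \<eta> / (2 * m)) / a n"
        using elim(4) by (intro divide_right_mono) auto
      also have "\<dots> = (\<Sum>i<m. - ?e i / a n)"
        by (simp only: sum_negf[symmetric] sum_divide_distrib)
      finally show ?thesis by (simp only: exp_le_cancel_iff)
    qed
    also have "\<dots> = (\<Prod>i<m. exp (- ?e i / a n))"
      by (rule exp_sum) simp
    also have "\<dots> \<le> (\<Prod>i<m. prob (?I i))"
      using elim(1) by (intro prod_mono conjI) auto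
    also have "\<dots> = prob (\<Inter>i\<in>{..<m}. ?I i)"
    proof -
      have "prob (\<Inter>i\<in>{..<m}. increment m n i -` {c * (1 / m) * \<theta> i - d / m<..<c * (1 / m) * \<theta> i + d / m} \<inter> space M) =
          (\<Prod>i\<in>{..<m}. prob (increment m n i -` {c * (1 / m) * \<theta> i - d / m<..<c * (1 / m) * \<theta> i + d / m} \<inter> space M))"
        using m(2) by (intro indep_varsD_finite[OF indep_increments]) auto
      moreover have "increment m n i -` {c * (1 / m) * \<theta> i - d / m<..<c * (1 / m) * \<theta> i + d / m} \<inter> space M = ?I i" for i
        by (auto simp: abs_less_iff)
      ultimately show ?thesis by (simp only:)
    qed
    also have "\<dots> \<le> prob (?B \<union> oscillation m d n)"
    proof (intro finite_measure_mono subsetI)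
      fix \<omega> assume w: "\<omega> \<in> (\<Inter>i\<in>{..<m}. ?I i)"
      then have ws: "\<omega> \<in> space M" using m(2) by auto
      show "\<omega> \<in> ?B \<union> oscillation m d n"
      proof (cases "\<omega> \<in> oscillation m d n")
        case False
        have "sup_dist (walk_path n \<omega>) z \<le> 3 * d"
          unfolding walk_path_def
        proof (rule step_path_near_path[OF elim(5) m(2) _ z(1,2)])
          show "walk n 0 \<omega> = 0" by (rule walk_0)
          show "\<bar>walk n j \<omega> - walk n (block n m i) \<omega>\<bar> \<le> d" if "i < m" "j \<in> {block n m i..block n m (Suc i)}" for i j
            using False ws that unfolding oscillation_def by (force simp: not_le)
          show "\<bar>walk n (block n m (Suc i)) \<omega> - walk n (block n m i) \<omega> - (z (real (Suc i) / m) - z (real i / m))\<bar> \<le> d / m"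
            if "i < m" for i
            using w that u\<theta>[OF that] unfolding increment_def u_def by (force intro: less_imp_le)
        qed (rule mod)
        then have "sup_dist z (walk_path n \<omega>) < \<delta>" using d by (subst D01.commute) (simp add: d_def)
        then show ?thesis using ws z(1) step_path_in_D01[OF elim(5)] by (simp add: walk_path_def D01.in_mball)
      qed simp
    qed (use Bm in auto)
    also have "\<dots> \<le> prob ?B + prob (oscillation m d n)"
      using Bm by (intro measure_Un_le) auto
    finally have "exp (- (\<alpha> + \<eta> / 2) / a n) \<le> prob ?B + exp (- (\<alpha> + \<eta>) / a n)" using elim(3) by simp
    \<comment> \<open>Subtracting the oscillation thus removes at most half of the bound.\<close>
    moreover have "2 * exp (- (\<alpha> + \<eta>) / a n) \<le> exp ((\<eta> / 2) / a n) * exp (- (\<alpha> + \<eta>) / a n)"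
      by (intro mult_right_mono elim(2)) simp
    moreover have "exp ((\<eta> / 2) / a n) * exp (- (\<alpha> + \<eta>) / a n) = exp (- (\<alpha> + \<eta> / 2) / a n)"
      using elim(4) by (simp add: field_simps flip: exp_add)
    ultimately show ?case by linarith
  qed
qed

end

section \<open>Passage to logarithmic limits over open and closed sets\<close>

lemma ln_ext_le:
  assumes "0 \<le> p" "p \<le> q" "0 < q"
  shows "ln_ext p \<le> ereal (ln q)"
  using assms by (simp add: ln_ext_def)

context mdp_array
begin

text \<open>The rate enters only through its level sets, the form in which both exponential bounds
  are stated. \<open>L\<close> is prescribed eventually, since finitely many members of the family
  do not affect the limits.\<close>

lemma functional_MDP_bounds:
  fixes J :: "(real \<Rightarrow> real) \<Rightarrow> ereal"
  assumes J: "\<And>z \<alpha>. J z \<le> ereal \<alpha> \<longleftrightarrow> 0 \<le> \<alpha> \<and> z 0 = 0 \<and> energy_le z (2 * \<alpha> * c)"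
    and \<Gamma>: "\<Gamma> \<in> sets D01_borel"
    and L: "\<forall>\<^sub>F n in sequentially. L n = ereal (a n) * ln_ext (prob {\<omega> \<in> space M. walk_path n \<omega> \<in> \<Gamma>})"
  shows "- (INF z\<in>D01_top interior_of \<Gamma>. J z) \<le> liminf L"
    and "limsup L \<le> - (INF z\<in>D01_top closure_of \<Gamma>. J z)"
proof -
  have \<Gamma>m: "{\<omega> \<in> space M. walk_path n \<omega> \<in> V} \<in> sets M" if "0 < n" "V \<in> sets D01_borel" for n V
    using measurable_sets[OF walk_path_measurable[OF that(1)] that(2)] by (simp add: vimage_def Int_def conj_commute)
  have J0: "0 \<le> J z" for z
  proof (rule ccontr)
    assume "\<not> 0 \<le> J z"
    then obtain r where "J z < ereal r" "ereal r < 0" by (meson ereal_dense2 not_le)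
    then have "J z \<le> ereal r" "r < 0" by (auto simp: zero_ereal_def)
    then show False using J by fastforce
  qed
  have reorder: "x \<le> - y \<longleftrightarrow> y \<le> - x" for x y :: ereal
    using ereal_uminus_le_reorder[of "- x" "- y"] by simp
  show "- (INF z\<in>D01_top interior_of \<Gamma>. J z) \<le> liminf L"
  proof (rule ereal_uminus_le_reorder[THEN iffD1], rule INF_greatest)
    fix z assume "z \<in> D01_top interior_of \<Gamma>"
    then obtain \<delta> where z: "z \<in> D01" and \<delta>: "0 < \<delta>" "D01.mball z \<delta> \<subseteq> \<Gamma>"
      unfolding D01_top_def D01.metric_interior_of by blast
    show "- liminf L \<le> J z"
    proof (cases "J z")
      case (real \<alpha>)
      then have z': "z 0 = 0" "energy_le z (2 * \<alpha> * c)" and \<alpha>: "0 \<le> \<alpha>" using J[of z \<alpha>] by auto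
      have "ereal (- (\<alpha> + \<eta>)) \<le> liminf L" if \<eta>: "0 < \<eta>" for \<eta>
      proof (rule Liminf_bounded)
        show "\<forall>\<^sub>F n in sequentially. ereal (- (\<alpha> + \<eta>)) \<le> L n"
          using L lower_bound[OF z z' \<alpha> \<delta>(1) \<eta>] a_pos eventually_gt_at_top[of 0]
        proof eventually_elim
          case (elim n)
          let ?P = "prob {\<omega> \<in> space M. walk_path n \<omega> \<in> \<Gamma>}"
          have "prob {\<omega> \<in> space M. walk_path n \<omega> \<in> D01.mball z \<delta>} \<le> ?P"
            using \<delta>(2) \<Gamma>m[OF elim(4) \<Gamma>] by (intro finite_measure_mono) auto
          with elim(2) have P: "exp (- (\<alpha> + \<eta>) / a n) \<le> ?P" by simp
          then have P0: "0 < ?P" by (rule less_le_trans[OF exp_gt_zero])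
          have "- (\<alpha> + \<eta>) / a n \<le> ln ?P" using P P0 by (simp add: ln_ge_iff)
          then have "- (\<alpha> + \<eta>) \<le> a n * ln ?P" using elim(3) by (simp add: divide_le_eq mult.commute)
          then show ?case using elim(1) P0 by (simp add: ln_ext_def)
        qed
      qed
      then have lim: "- ereal (\<alpha> + \<eta>) \<le> liminf L" if "0 < \<eta>" for \<eta> using that by simp
      have "- liminf L \<le> ereal (\<alpha> + \<eta>)" if "0 < \<eta>" for \<eta>
        using lim[OF that] by (rule ereal_uminus_le_reorder[THEN iffD1])
      then show ?thesis unfolding real by (intro ereal_le_epsilon2[of "- liminf L" "ereal \<alpha>"]) simp_all
    qed (use J0[of z] in auto)
  qed
  show "limsup L \<le> - (INF z\<in>D01_top closure_of \<Gamma>. J z)"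
  proof (rule reorder[THEN iffD1], rule dense_le)
    \<comment> \<open>For a positive real \<open>y\<close> strictly below the infimum, the
      corresponding energy level set misses the closure, whether or not the infimum is attained. For
      \<open>y \<le> 0\<close> it is enough that logarithms of probabilities are not
      positive.\<close>
    fix y assume y: "y < (INF z\<in>D01_top closure_of \<Gamma>. J z)"
    have le0: "limsup L \<le> 0"
    proof (rule Limsup_bounded)
      show "\<forall>\<^sub>F n in sequentially. L n \<le> 0" using L a_pos
      proof eventually_elim
        case (elim n)
        have "ln_ext (prob {\<omega> \<in> space M. walk_path n \<omega> \<in> \<Gamma>}) \<le> 0"
          using ln_ext_le[of "prob {\<omega> \<in> space M. walk_path n \<omega> \<in> \<Gamma>}" 1] by (simp add: zero_ereal_def)
        then show ?case using elim by (simp add: ereal_mult_le_0_iff)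
      qed
    qed
    show "y \<le> - limsup L"
    proof (cases y)
      case (real \<alpha>)
      show ?thesis
      proof (cases "0 < \<alpha>")
        case True
        let ?F = "D01_top closure_of \<Gamma>"
        have "?F \<inter> energy_level (2 * \<alpha> * c) = {}"
        proof (rule ccontr)
          assume "\<not> ?thesis"
          then obtain z where z: "z \<in> ?F" "z 0 = 0" "energy_le z (2 * \<alpha> * c)" by (auto simp: energy_level_def)
          then have "J z \<le> ereal \<alpha>" using J True by simp
          moreover have "(INF z\<in>?F. J z) \<le> J z" using z(1) by (rule INF_lower)
          ultimately show False using y real by simp
        qed
        then have up: "\<forall>\<^sub>F n in sequentially. prob {\<omega> \<in> space M. walk_path n \<omega> \<in> ?F} \<le> 2 * exp (- \<alpha> / a n)"
          by (intro upper_bound closedin_closure_of True)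
        have Fm: "?F \<in> sets D01_borel"
        proof -
          have "openin D01_top (D01 - ?F)"
            using openin_diff[OF openin_topspace closedin_closure_of, of D01_top \<Gamma>] by (simp add: D01_top_def)
          then have "D01 - ?F \<in> sets D01_borel" unfolding sets_D01_borel by (intro sigma_sets.Basic) simp
          from sets.compl_sets[OF this] have "D01 - (D01 - ?F) \<in> sets D01_borel" by (simp add: space_D01_borel)
          moreover have "?F \<subseteq> D01" using closure_of_subset_topspace[of D01_top \<Gamma>] by (simp add: D01_top_def)
          ultimately show ?thesis by (simp add: double_diff)
        qed
        have sub: "\<Gamma> \<subseteq> ?F"
          using sets.sets_into_space[OF \<Gamma>] by (intro closure_of_subset) (simp add: space_D01_borel D01_top_def)
        have "\<forall>\<^sub>F n in sequentially. L n \<le> ereal (a n * ln 2 - \<alpha>)"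
          using L up a_pos eventually_gt_at_top[of 0]
        proof eventually_elim
          case (elim n)
          let ?P = "prob {\<omega> \<in> space M. walk_path n \<omega> \<in> \<Gamma>}"
          have "?P \<le> prob {\<omega> \<in> space M. walk_path n \<omega> \<in> ?F}"
            using sub \<Gamma>m[OF elim(4) Fm] by (intro finite_measure_mono) auto
          then have "ln_ext ?P \<le> ereal (ln (2 * exp (- \<alpha> / a n)))" using elim(2) by (intro ln_ext_le) auto
          then have "L n \<le> ereal (a n) * ereal (ln (2 * exp (- \<alpha> / a n)))"
            unfolding elim(1) using elim(3) by (intro ereal_mult_left_mono) auto
          also have "\<dots> = ereal (a n * ln 2 - \<alpha>)"
            using elim(3) by (simp add: ln_mult right_diff_distrib)
          finally show ?case .
        qed
        then have "limsup L \<le> limsup (\<lambda>n. ereal (a n * ln 2 - \<alpha>))" by (rule Limsup_mono)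
        also have "\<dots> = ereal (- \<alpha>)"
        proof (rule lim_imp_Limsup)
          have "(\<lambda>n. a n * ln 2 - \<alpha>) \<longlonglongrightarrow> 0 * ln 2 - \<alpha>" by (intro tendsto_intros a_lim)
          then show "(\<lambda>n. ereal (a n * ln 2 - \<alpha>)) \<longlonglongrightarrow> ereal (- \<alpha>)" by simp
        qed simp
        finally have "limsup L \<le> - ereal \<alpha>" by simp
        then show ?thesis unfolding real by (rule reorder[THEN iffD1])
      next
        case False
        then have "y \<le> 0" using real by (simp add: zero_ereal_def)
        also have "0 \<le> - limsup L" using le0 by simp
        finally show ?thesis .
      qed
    qed (use y in auto)
  qed
qed

end

section \<open>The kernel estimator\<close>

text \<open>Stated in \<open>ennreal\<close> so that integral and series can be interchanged before
  any integrability is known.\<close>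

lemma exp_remainder_bound:
  fixes y :: real
  shows "ennreal \<bar>exp y - 1 - y - y\<^sup>2 / 2\<bar> \<le> (\<Sum>k. ennreal (\<bar>y\<bar> ^ (k + 3) / fact (k + 3)))"
proof -
  have sm: "summable (\<lambda>n. y ^ n / fact n)"
    using summable_exp[of y] by (simp add: divide_inverse mult.commute)
  have sm': "summable (\<lambda>k. \<bar>y\<bar> ^ (k + 3) / fact (k + 3))"
    using summable_ignore_initial_segment[of "\<lambda>n. \<bar>y\<bar> ^ n / fact n" 3] summable_exp[of "\<bar>y\<bar>"]
    by (simp add: divide_inverse mult.commute)
  have "exp y = (\<Sum>n. y ^ n / fact n)" by (simp add: exp_def divide_inverse mult.commute)
  also have "\<dots> = (\<Sum>k. y ^ (k + 3) / fact (k + 3)) + (\<Sum>n<3. y ^ n / fact n)"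
    by (rule suminf_split_initial_segment[OF sm])
  also have "(\<Sum>n<3. y ^ n / fact n) = 1 + y + y\<^sup>2 / 2" by (simp add: eval_nat_numeral)
  finally have "exp y - 1 - y - y\<^sup>2 / 2 = (\<Sum>k. y ^ (k + 3) / fact (k + 3))" by simp
  also have "\<bar>\<dots>\<bar> \<le> (\<Sum>k. \<bar>y ^ (k + 3) / fact (k + 3)\<bar>)"
    using sm' by (intro summable_rabs) (simp add: power_abs)
  also have "\<dots> = (\<Sum>k. \<bar>y\<bar> ^ (k + 3) / fact (k + 3))" by (simp add: power_abs)
  finally have "ennreal \<bar>exp y - 1 - y - y\<^sup>2 / 2\<bar> \<le> ennreal (\<Sum>k. \<bar>y\<bar> ^ (k + 3) / fact (k + 3))"
    by (rule ennreal_leI)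
  also have "\<dots> = (\<Sum>k. ennreal (\<bar>y\<bar> ^ (k + 3) / fact (k + 3)))"
    using sm' by (intro suminf_ennreal2[symmetric]) auto
  finally show ?thesis .
qed

text \<open>Properties of single variables; independence enters only with the array. The moment
  bounds are in \<open>ennreal\<close>, so they include the finiteness of the integrals.\<close>

locale kernel_density = prob_space M for M :: "'w measure" +
  fixes X :: "int \<Rightarrow> 'w \<Rightarrow> real" and f K :: "real \<Rightarrow> real" and x B C :: real
  assumes f_nonneg: "\<And>y. 0 \<le> f y" and f_le: "\<And>y. f y \<le> B"
    and distr: "\<And>k. distributed M lborel (X k) (\<lambda>y. ennreal (f y))"
    and f_cont: "isCont f x" and K_int: "integrable lborel K"
    and C_pos: "0 < C"
    and moments: "\<And>m. 1 \<le> m \<Longrightarrow> (\<integral>\<^sup>+u. ennreal (\<bar>K u\<bar> ^ m) \<partial>lborel) \<le> ennreal (fact m * C ^ m)"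
begin

lemma B_nonneg: "0 \<le> B"
  using f_nonneg[of 0] f_le[of 0] by linarith

lemma f_measurable [measurable]: "f \<in> borel_measurable borel"
proof -
  have "(\<lambda>y. enn2real (ennreal (f y))) \<in> borel_measurable lborel"
    using distributed_borel_measurable[OF distr[of 0]] by measurable
  then show ?thesis using f_nonneg by simp
qed

lemma K_measurable [measurable]: "K \<in> borel_measurable borel"
  using borel_measurable_integrable[OF K_int] by simp

lemma X_measurable [measurable]: "X k \<in> borel_measurable M"
  using distributed_measurable[OF distr[of k]] by simp

definition \<xi> :: "real \<Rightarrow> int \<Rightarrow> 'w \<Rightarrow> real" where
  "\<xi> h k \<omega> = K ((x - X k \<omega>) / h)"

lemma \<xi>_measurable [measurable]: "\<xi> h k \<in> borel_measurable M"
  unfolding \<xi>_def by measurable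

lemma expectation_\<xi>_eq:
  assumes [measurable]: "\<phi> \<in> borel_measurable borel"
  shows "expectation (\<lambda>\<omega>. \<phi> (\<xi> h k \<omega>)) = (LINT y|lborel. f y * \<phi> (K ((x - y) / h)))"
  unfolding \<xi>_def by (rule distributed_integral[OF distr, symmetric]) (use f_nonneg in auto)

text \<open>The substitution \<open>y = x - h * u\<close> turns the kernel at scale \<open>h\<close>
  into \<open>K\<close> and produces the factor \<open>h\<close>; the density is replaced by its
  bound \<open>B\<close>.\<close>

lemma nn_moment:
  assumes h: "0 < h" and m: "1 \<le> m"
  shows "(\<integral>\<^sup>+\<omega>. ennreal (\<bar>\<xi> h k \<omega>\<bar> ^ m) \<partial>M) \<le> ennreal (h * B * (fact m * C ^ m))"
proof -
  have "(\<integral>\<^sup>+\<omega>. ennreal (\<bar>\<xi> h k \<omega>\<bar> ^ m) \<partial>M) = (\<integral>\<^sup>+y. ennreal (f y) * ennreal (\<bar>K ((x - y) / h)\<bar> ^ m) \<partial>lborel)"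
    unfolding \<xi>_def by (rule distributed_nn_integral[OF distr, symmetric]) measurable
  also have "\<dots> \<le> (\<integral>\<^sup>+y. ennreal B * ennreal (\<bar>K ((x - y) / h)\<bar> ^ m) \<partial>lborel)"
    by (intro nn_integral_mono mult_right_mono ennreal_leI f_le) simp
  also have "\<dots> = ennreal B * (\<integral>\<^sup>+y. ennreal (\<bar>K ((x - y) / h)\<bar> ^ m) \<partial>lborel)"
    by (rule nn_integral_cmult) measurable
  also have "(\<integral>\<^sup>+y. ennreal (\<bar>K ((x - y) / h)\<bar> ^ m) \<partial>lborel) =
      ennreal \<bar>- h\<bar> * (\<integral>\<^sup>+u. ennreal (\<bar>K ((x - (x + - h * u)) / h)\<bar> ^ m) \<partial>lborel)"
    by (rule nn_integral_real_affine) (use h in auto)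
  also have "\<dots> = ennreal h * (\<integral>\<^sup>+u. ennreal (\<bar>K u\<bar> ^ m) \<partial>lborel)" using h by simp
  also have "ennreal B * \<dots> \<le> ennreal B * (ennreal h * ennreal (fact m * C ^ m))"
    by (intro mult_left_mono moments m) auto
  also have "\<dots> = ennreal (h * B * (fact m * C ^ m))"
    using h B_nonneg C_pos by (simp add: ennreal_mult mult_ac)
  finally show ?thesis .
qed

lemma \<xi>_moment:
  assumes h: "0 < h" and m: "1 \<le> m"
  shows "integrable M (\<lambda>\<omega>. \<xi> h k \<omega> ^ m)" "\<bar>expectation (\<lambda>\<omega>. \<xi> h k \<omega> ^ m)\<bar> \<le> h * B * (fact m * C ^ m)"
proof -
  have nn: "(\<integral>\<^sup>+\<omega>. ennreal (norm (\<xi> h k \<omega> ^ m)) \<partial>M) \<le> ennreal (h * B * (fact m * C ^ m))"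
    using nn_moment[OF h m] by (simp add: power_abs)
  then show int: "integrable M (\<lambda>\<omega>. \<xi> h k \<omega> ^ m)"
    by (intro integrableI_bounded) (auto intro: le_less_trans)
  have "ennreal (norm (expectation (\<lambda>\<omega>. \<xi> h k \<omega> ^ m))) \<le> (\<integral>\<^sup>+\<omega>. ennreal (norm (\<xi> h k \<omega> ^ m)) \<partial>M)"
    by (rule integral_norm_bound_ennreal[OF int])
  also note nn
  finally show "\<bar>expectation (\<lambda>\<omega>. \<xi> h k \<omega> ^ m)\<bar> \<le> h * B * (fact m * C ^ m)"
    using h B_nonneg C_pos by (simp add: ennreal_le_iff)
qed

text \<open>The factorials in the moment bounds cancel those of the exponential series, leaving a
  geometric series in \<open>q = \<bar>s\<bar> * C\<close>. The constant 2 bounds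
  \<open>1 / (1 - q)\<close>.\<close>

lemma mgf_expansion:
  assumes h: "0 < h" and s: "\<bar>s\<bar> * C \<le> 1 / 2"
  shows "integrable M (\<lambda>\<omega>. exp (s * \<xi> h k \<omega>))"
    "\<bar>expectation (\<lambda>\<omega>. exp (s * \<xi> h k \<omega>)) - 1 - s * expectation (\<xi> h k)
       - s\<^sup>2 / 2 * expectation (\<lambda>\<omega>. (\<xi> h k \<omega>)\<^sup>2)\<bar> \<le> 2 * h * B * (\<bar>s\<bar> * C) ^ 3"
proof -
  define D where "D y = exp y - 1 - y - y\<^sup>2 / 2" for y :: real
  have [measurable]: "D \<in> borel_measurable borel" unfolding D_def by measurable
  define q where "q = \<bar>s\<bar> * C"
  have q: "0 \<le> q" "q \<le> 1 / 2" using s C_pos by (auto simp: q_def)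
  have "(\<integral>\<^sup>+\<omega>. ennreal (norm (D (s * \<xi> h k \<omega>))) \<partial>M) \<le>
      (\<integral>\<^sup>+\<omega>. (\<Sum>j. ennreal (\<bar>s * \<xi> h k \<omega>\<bar> ^ (j + 3) / fact (j + 3))) \<partial>M)"
    unfolding D_def real_norm_def by (intro nn_integral_mono exp_remainder_bound)
  also have "\<dots> = (\<Sum>j. \<integral>\<^sup>+\<omega>. ennreal (\<bar>s * \<xi> h k \<omega>\<bar> ^ (j + 3) / fact (j + 3)) \<partial>M)"
    by (rule nn_integral_suminf) measurable
  also have "\<dots> \<le> (\<Sum>j. ennreal (h * B * q ^ 3 * q ^ j))"
  proof (rule suminf_le)
    fix j
    have "(\<integral>\<^sup>+\<omega>. ennreal (\<bar>s * \<xi> h k \<omega>\<bar> ^ (j + 3) / fact (j + 3)) \<partial>M) =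
        (\<integral>\<^sup>+\<omega>. ennreal (\<bar>s\<bar> ^ (j + 3) / fact (j + 3)) * ennreal (\<bar>\<xi> h k \<omega>\<bar> ^ (j + 3)) \<partial>M)"
      by (intro nn_integral_cong) (simp add: abs_mult power_mult_distrib ennreal_mult'[symmetric])
    also have "\<dots> = ennreal (\<bar>s\<bar> ^ (j + 3) / fact (j + 3)) * (\<integral>\<^sup>+\<omega>. ennreal (\<bar>\<xi> h k \<omega>\<bar> ^ (j + 3)) \<partial>M)"
      by (rule nn_integral_cmult) measurable
    also have "\<dots> \<le> ennreal (\<bar>s\<bar> ^ (j + 3) / fact (j + 3)) * ennreal (h * B * (fact (j + 3) * C ^ (j + 3)))"
      by (intro mult_left_mono nn_moment h) auto
    also have "\<dots> = ennreal (\<bar>s\<bar> ^ (j + 3) / fact (j + 3) * (h * B * (fact (j + 3) * C ^ (j + 3))))"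
      by (rule ennreal_mult'[symmetric]) simp
    also have "\<bar>s\<bar> ^ (j + 3) / fact (j + 3) * (h * B * (fact (j + 3) * C ^ (j + 3))) = h * B * q ^ 3 * q ^ j"
      by (simp add: q_def power_mult_distrib power_add del: fact_Suc)
    finally show "(\<integral>\<^sup>+\<omega>. ennreal (\<bar>s * \<xi> h k \<omega>\<bar> ^ (j + 3) / fact (j + 3)) \<partial>M) \<le> ennreal (h * B * q ^ 3 * q ^ j)" .
  qed auto
  also have "\<dots> = ennreal (\<Sum>j. h * B * q ^ 3 * q ^ j)"
    using q h B_nonneg by (intro suminf_ennreal2 summable_mult summable_geometric) auto
  also have "(\<Sum>j. h * B * q ^ 3 * q ^ j) = h * B * q ^ 3 * (1 / (1 - q))"
    using q by (subst suminf_mult) (auto simp: suminf_geometric intro!: summable_geometric)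
  also have "ennreal (h * B * q ^ 3 * (1 / (1 - q))) \<le> ennreal (h * B * q ^ 3 * 2)"
    using q h B_nonneg by (intro ennreal_leI mult_left_mono) (auto simp: divide_le_eq)
  finally have nn: "(\<integral>\<^sup>+\<omega>. ennreal (norm (D (s * \<xi> h k \<omega>))) \<partial>M) \<le> ennreal (2 * h * B * q ^ 3)"
    by (simp add: mult_ac)
  have D_int: "integrable M (\<lambda>\<omega>. D (s * \<xi> h k \<omega>))"
    using nn by (intro integrableI_bounded) (auto intro: le_less_trans)
  have int1: "integrable M (\<xi> h k)" using \<xi>_moment(1)[OF h, of 1] by simp
  have int2: "integrable M (\<lambda>\<omega>. (\<xi> h k \<omega>)\<^sup>2)" using \<xi>_moment(1)[OF h, of 2] by simp
  have eq: "exp (s * \<xi> h k \<omega>) = D (s * \<xi> h k \<omega>) + 1 + s * \<xi> h k \<omega> + s\<^sup>2 / 2 * (\<xi> h k \<omega>)\<^sup>2" for \<omega>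
    by (simp add: D_def power_mult_distrib)
  show "integrable M (\<lambda>\<omega>. exp (s * \<xi> h k \<omega>))"
    unfolding eq by (intro Bochner_Integration.integrable_add integrable_mult_right D_int int1 int2) simp
  have "expectation (\<lambda>\<omega>. exp (s * \<xi> h k \<omega>)) = expectation (\<lambda>\<omega>. D (s * \<xi> h k \<omega>)) + 1 + s * expectation (\<xi> h k)
      + s\<^sup>2 / 2 * expectation (\<lambda>\<omega>. (\<xi> h k \<omega>)\<^sup>2)"
    unfolding eq using D_int int1 int2 by (simp add: prob_space)
  moreover have "ennreal (norm (expectation (\<lambda>\<omega>. D (s * \<xi> h k \<omega>)))) \<le> ennreal (2 * h * B * q ^ 3)"
    using integral_norm_bound_ennreal[OF D_int] nn by (rule order_trans)
  then have "\<bar>expectation (\<lambda>\<omega>. D (s * \<xi> h k \<omega>))\<bar> \<le> 2 * h * B * q ^ 3"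
    using h B_nonneg q by (simp add: ennreal_le_iff)
  ultimately show "\<bar>expectation (\<lambda>\<omega>. exp (s * \<xi> h k \<omega>)) - 1 - s * expectation (\<xi> h k)
       - s\<^sup>2 / 2 * expectation (\<lambda>\<omega>. (\<xi> h k \<omega>)\<^sup>2)\<bar> \<le> 2 * h * B * (\<bar>s\<bar> * C) ^ 3"
    by (simp add: q_def)
qed

text \<open>Belongs to the centered variable; index 0 stands for all, as the laws coincide.\<close>

definition log_mgf :: "real \<Rightarrow> real \<Rightarrow> real" where
  "log_mgf h s = ln (expectation (\<lambda>\<omega>. exp (s * \<xi> h 0 \<omega>))) - s * expectation (\<xi> h 0)"

text \<open>Centering removes the first-order term exactly. What remains is the cubic remainder of
  the exponential and \<open>ln (1 + y) - y\<close>, at most \<open>2 * y\<^sup>2\<close> in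
  absolute value; as \<open>y\<close> is of order \<open>h * s\<close>, its square has one more
  factor \<open>h\<close> than the main term, which is of order
  \<open>h * s\<^sup>2\<close>.\<close>

lemma centered_mgf:
  assumes h: "0 < h" and s: "\<bar>s\<bar> * C \<le> 1 / 2" and small: "2 * B * C * h * \<bar>s\<bar> \<le> 1 / 2"
  shows "integrable M (\<lambda>\<omega>. exp (s * (\<xi> h k \<omega> - expectation (\<xi> h k))))"
    "expectation (\<lambda>\<omega>. exp (s * (\<xi> h k \<omega> - expectation (\<xi> h k)))) = exp (log_mgf h s)"
    "\<bar>log_mgf h s - s\<^sup>2 / 2 * expectation (\<lambda>\<omega>. (\<xi> h 0 \<omega>)\<^sup>2)\<bar>
       \<le> h * s\<^sup>2 * (2 * B * C ^ 3 * \<bar>s\<bar> + 8 * B\<^sup>2 * C\<^sup>2 * h)"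
proof -
  define R where "R = expectation (\<lambda>\<omega>. exp (s * \<xi> h 0 \<omega>)) - 1 - s * expectation (\<xi> h 0)
       - s\<^sup>2 / 2 * expectation (\<lambda>\<omega>. (\<xi> h 0 \<omega>)\<^sup>2)"
  define e1 where "e1 = expectation (\<xi> h 0)"
  define e2 where "e2 = expectation (\<lambda>\<omega>. (\<xi> h 0 \<omega>)\<^sup>2)"
  have ek: "expectation (\<xi> h k) = e1" for k
    unfolding e1_def using expectation_\<xi>_eq[of "\<lambda>y. y" h] by simp
  have mk: "expectation (\<lambda>\<omega>. exp (s * \<xi> h k \<omega>)) = expectation (\<lambda>\<omega>. exp (s * \<xi> h 0 \<omega>))" for k
    using expectation_\<xi>_eq[of "\<lambda>y. exp (s * y)" h] by simp
  have R: "\<bar>R\<bar> \<le> 2 * h * B * (\<bar>s\<bar> * C) ^ 3" unfolding R_def by (rule mgf_expansion(2)[OF h s])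
  define y where "y = s * e1 + s\<^sup>2 / 2 * e2 + R"
  have mgf_y: "expectation (\<lambda>\<omega>. exp (s * \<xi> h 0 \<omega>)) = 1 + y"
    unfolding R_def y_def e1_def e2_def by simp
  define t where "t = \<bar>s\<bar> * C"
  have t: "0 \<le> t" "t \<le> 1 / 2" using s C_pos by (auto simp: t_def)
  have hB: "0 \<le> h * B" using h B_nonneg by simp
  have "\<bar>y\<bar> \<le> \<bar>s * e1\<bar> + \<bar>s\<^sup>2 / 2 * e2\<bar> + \<bar>R\<bar>" unfolding y_def by linarith
  also have "\<dots> \<le> h * B * t + h * B * t\<^sup>2 + 2 * (h * B * t ^ 3)"
  proof (intro add_mono)
    have "\<bar>s * e1\<bar> \<le> \<bar>s\<bar> * (h * B * C)"
      unfolding abs_mult using \<xi>_moment(2)[OF h, of 1 0] by (intro mult_left_mono) (auto simp: e1_def)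
    then show "\<bar>s * e1\<bar> \<le> h * B * t" by (simp add: t_def mult_ac)
    have "\<bar>e2\<bar> \<le> h * B * (2 * C\<^sup>2)"
      using \<xi>_moment(2)[OF h, of 2 0] by (simp only: e2_def fact_2 one_le_numeral)
    then have "s\<^sup>2 / 2 * \<bar>e2\<bar> \<le> s\<^sup>2 / 2 * (h * B * (2 * C\<^sup>2))" by (rule mult_left_mono) simp
    then have "\<bar>s\<^sup>2 / 2 * e2\<bar> \<le> s\<^sup>2 / 2 * (h * B * (2 * C\<^sup>2))" by (simp add: abs_mult)
    then show "\<bar>s\<^sup>2 / 2 * e2\<bar> \<le> h * B * t\<^sup>2" by (simp add: t_def power_mult_distrib mult_ac)
    show "\<bar>R\<bar> \<le> 2 * (h * B * t ^ 3)" using R by (simp add: t_def mult_ac)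
  qed
  also have "\<dots> = h * B * (t + t * t + 2 * t * (t * t))" by (simp add: power2_eq_square power3_eq_cube algebra_simps)
  also have "\<dots> \<le> h * B * (2 * t)"
  proof (rule mult_left_mono[OF _ hB])
    have "t * t \<le> t * (1 / 2)" using t by (intro mult_left_mono) auto
    moreover have "t * (t * t) \<le> t * (1 / 4)"
      using t mult_mono[of t "1/2" t "1/2"] by (intro mult_left_mono) auto
    ultimately show "t + t * t + 2 * t * (t * t) \<le> 2 * t" by simp
  qed
  finally have y: "\<bar>y\<bar> \<le> 2 * B * C * h * \<bar>s\<bar>" by (simp add: t_def mult_ac)
  with small have y2: "\<bar>y\<bar> \<le> 1 / 2" by simp
  then have pos: "0 < 1 + y" by (simp add: abs_le_iff)
  have lm: "log_mgf h s = ln (1 + y) - s * e1" by (simp add: log_mgf_def mgf_y e1_def)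
  have split: "exp (s * (\<xi> h k \<omega> - expectation (\<xi> h k))) = exp (s * \<xi> h k \<omega>) * exp (- s * e1)" for \<omega>
    unfolding ek by (simp add: right_diff_distrib exp_diff exp_minus divide_inverse)
  show "integrable M (\<lambda>\<omega>. exp (s * (\<xi> h k \<omega> - expectation (\<xi> h k))))"
    unfolding split by (intro integrable_mult_left mgf_expansion(1)[OF h s])
  have "expectation (\<lambda>\<omega>. exp (s * (\<xi> h k \<omega> - expectation (\<xi> h k)))) = (1 + y) * exp (- s * e1)"
    unfolding split using mk[of k] mgf_y by simp
  also have "\<dots> = exp (log_mgf h s)" using pos unfolding lm by (simp add: exp_diff exp_minus divide_inverse)
  finally show "expectation (\<lambda>\<omega>. exp (s * (\<xi> h k \<omega> - expectation (\<xi> h k)))) = exp (log_mgf h s)" .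
  have "log_mgf h s - s\<^sup>2 / 2 * e2 = R + (ln (1 + y) - y)" unfolding lm y_def by simp
  also have "\<bar>\<dots>\<bar> \<le> \<bar>R\<bar> + \<bar>ln (1 + y) - y\<bar>" by (rule abs_triangle_ineq)
  also have "\<bar>ln (1 + y) - y\<bar> \<le> 2 * y\<^sup>2" by (rule abs_ln_one_plus_x_minus_x_bound[OF y2])
  also have "y\<^sup>2 \<le> (2 * B * C * h * \<bar>s\<bar>)\<^sup>2" using y by (metis abs_ge_zero power2_abs power_mono)
  also note R
  finally have "\<bar>log_mgf h s - s\<^sup>2 / 2 * e2\<bar> \<le> 2 * h * B * (\<bar>s\<bar> * C) ^ 3 + 2 * (2 * B * C * h * \<bar>s\<bar>)\<^sup>2" by simp
  also have "\<dots> = h * s\<^sup>2 * (2 * B * C ^ 3 * \<bar>s\<bar> + 8 * B\<^sup>2 * C\<^sup>2 * h)"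
  proof -
    have "\<bar>s\<bar> ^ 3 = s\<^sup>2 * \<bar>s\<bar>" by (simp add: power3_eq_cube power2_eq_square)
    then show ?thesis by (simp add: power_mult_distrib distrib_left mult_ac power2_eq_square[of h])
  qed
  finally show "\<bar>log_mgf h s - s\<^sup>2 / 2 * expectation (\<lambda>\<omega>. (\<xi> h 0 \<omega>)\<^sup>2)\<bar>
       \<le> h * s\<^sup>2 * (2 * B * C ^ 3 * \<bar>s\<bar> + 8 * B\<^sup>2 * C\<^sup>2 * h)"
    unfolding e2_def .
qed

lemma K_square_integrable: "integrable lborel (\<lambda>u. (K u)\<^sup>2)"
  by (rule integrableI_nonneg) (use moments[of 2] in \<open>auto intro: le_less_trans\<close>)

text \<open>After the substitution \<open>y = x - h n * u\<close> the density is evaluated at points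
  tending to \<open>x\<close> for every fixed \<open>u\<close>, so continuity at \<open>x\<close>
  alone is enough; \<open>B * (K u)\<^sup>2\<close> dominates.\<close>

lemma second_moment_asymptotics:
  assumes h: "h \<longlonglongrightarrow> 0" "\<forall>\<^sub>F n in sequentially. 0 < h n"
  shows "(\<lambda>n. expectation (\<lambda>\<omega>. (\<xi> (h n) 0 \<omega>)\<^sup>2) / h n) \<longlonglongrightarrow> f x * (\<integral>u. (K u)\<^sup>2 \<partial>lborel)"
proof -
  have "(\<lambda>n. LINT u|lborel. f (x - h n * u) * (K u)\<^sup>2) \<longlonglongrightarrow> (LINT u|lborel. f x * (K u)\<^sup>2)"
  proof (rule integral_dominated_convergence[where w = "\<lambda>u. B * (K u)\<^sup>2"])
    show "integrable lborel (\<lambda>u. B * (K u)\<^sup>2)" by (intro integrable_mult_right K_square_integrable)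
    show "AE u in lborel. (\<lambda>n. f (x - h n * u) * (K u)\<^sup>2) \<longlonglongrightarrow> f x * (K u)\<^sup>2"
    proof (rule AE_I2)
      fix u
      have "(\<lambda>n. x - h n * u) \<longlonglongrightarrow> x - 0 * u" by (intro tendsto_intros h)
      then have "(\<lambda>n. f (x - h n * u)) \<longlonglongrightarrow> f x"
        using isCont_tendsto_compose[OF f_cont] by simp
      then show "(\<lambda>n. f (x - h n * u) * (K u)\<^sup>2) \<longlonglongrightarrow> f x * (K u)\<^sup>2" by (intro tendsto_mult tendsto_const)
    qed
    show "AE u in lborel. norm (f (x - h n * u) * (K u)\<^sup>2) \<le> B * (K u)\<^sup>2" for n
      using f_nonneg f_le by (intro AE_I2) (simp add: abs_mult mult_right_mono)
  qed measurable
  moreover have "\<forall>\<^sub>F n in sequentially. (LINT u|lborel. f (x - h n * u) * (K u)\<^sup>2)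
      = expectation (\<lambda>\<omega>. (\<xi> (h n) 0 \<omega>)\<^sup>2) / h n"
    using h(2)
  proof eventually_elim
    case (elim n)
    have "expectation (\<lambda>\<omega>. (\<xi> (h n) 0 \<omega>)\<^sup>2) = (LINT y|lborel. f y * (K ((x - y) / h n))\<^sup>2)"
      by (rule expectation_\<xi>_eq) simp
    also have "\<dots> = \<bar>- h n\<bar> *\<^sub>R (LINT u|lborel. f (x + - h n * u) * (K ((x - (x + - h n * u)) / h n))\<^sup>2)"
      by (rule lborel_integral_real_affine) (use elim in simp)
    also have "\<dots> = h n * (LINT u|lborel. f (x - h n * u) * (K u)\<^sup>2)" using elim by simp
    finally show ?case using elim by simp
  qed
  ultimately have "(\<lambda>n. expectation (\<lambda>\<omega>. (\<xi> (h n) 0 \<omega>)\<^sup>2) / h n) \<longlonglongrightarrow> (LINT u|lborel. f x * (K u)\<^sup>2)"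
    by (rule Lim_transform_eventually)
  then show ?thesis by simp
qed

end

context kernel_density
begin

text \<open>By \<open>a n * real n * (h n * (s n)\<^sup>2) = \<theta>\<^sup>2\<close> the main term
  becomes \<open>\<theta>\<^sup>2 / 2\<close> times the second moment over \<open>h n\<close>, and
  the remainder in \<open>centered_mgf\<close> becomes \<open>\<theta>\<^sup>2\<close> times terms
  of order \<open>s n\<close> and \<open>h n\<close>, which both vanish.\<close>

lemma scaled_mgf_asymptotics:
  fixes h a :: "nat \<Rightarrow> real" and \<theta> :: real
  defines "s \<equiv> \<lambda>n. \<theta> / a n * sqrt (a n / (real n * h n))"
  assumes h: "h \<longlonglongrightarrow> 0" "\<And>n. 1 \<le> n \<Longrightarrow> 0 < h n" and a: "\<And>n. 1 \<le> n \<Longrightarrow> 0 < a n"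
    and lim: "filterlim (\<lambda>n. a n * (real n * h n)) at_top sequentially"
  shows "\<forall>\<^sub>F n in sequentially. \<bar>s n\<bar> * C \<le> 1 / 2 \<and> 2 * B * C * h n * \<bar>s n\<bar> \<le> 1 / 2"
    and "(\<lambda>n. a n * real n * log_mgf (h n) (s n)) \<longlonglongrightarrow> f x * (\<integral>u. (K u)\<^sup>2 \<partial>lborel) * \<theta>\<^sup>2 / 2"
proof -
  have s_eq: "s n = \<theta> * inverse (sqrt (a n * (real n * h n)))" if "1 \<le> n" for n
  proof -
    have "sqrt (a n / (real n * h n)) / a n = inverse (sqrt (a n * (real n * h n)))"
      using a[OF that] h(2)[OF that] that by (simp add: real_sqrt_divide real_sqrt_mult field_simps)
    moreover have "s n = \<theta> * (sqrt (a n / (real n * h n)) / a n)" by (simp add: s_def)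
    ultimately show ?thesis by simp
  qed
  have "(\<lambda>n. inverse (sqrt (a n * (real n * h n)))) \<longlonglongrightarrow> 0"
    by (intro tendsto_inverse_0_at_top filterlim_compose[OF sqrt_at_top lim])
  then have "(\<lambda>n. \<theta> * inverse (sqrt (a n * (real n * h n)))) \<longlonglongrightarrow> \<theta> * 0"
    by (intro tendsto_mult tendsto_const)
  moreover have "\<forall>\<^sub>F n in sequentially. \<theta> * inverse (sqrt (a n * (real n * h n))) = s n"
    using eventually_ge_at_top[of 1] by eventually_elim (simp add: s_eq)
  ultimately have s0: "s \<longlonglongrightarrow> 0" by (simp add: Lim_transform_eventually)
  have "(\<lambda>n. \<bar>s n\<bar> * C) \<longlonglongrightarrow> \<bar>0\<bar> * C" by (intro tendsto_intros s0)
  then have ev1: "\<forall>\<^sub>F n in sequentially. \<bar>s n\<bar> * C < 1 / 2" by (rule order_tendstoD) simp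
  have "(\<lambda>n. 2 * B * C * h n * \<bar>s n\<bar>) \<longlonglongrightarrow> 2 * B * C * 0 * \<bar>0\<bar>" by (intro tendsto_intros s0 h)
  then have ev2: "\<forall>\<^sub>F n in sequentially. 2 * B * C * h n * \<bar>s n\<bar> < 1 / 2" by (rule order_tendstoD) simp
  show ev: "\<forall>\<^sub>F n in sequentially. \<bar>s n\<bar> * C \<le> 1 / 2 \<and> 2 * B * C * h n * \<bar>s n\<bar> \<le> 1 / 2"
    using ev1 ev2 by eventually_elim simp
  define v where "v n = expectation (\<lambda>\<omega>. (\<xi> (h n) 0 \<omega>)\<^sup>2)" for n
  define r where "r n = \<theta>\<^sup>2 * (2 * B * C ^ 3 * \<bar>s n\<bar> + 8 * B\<^sup>2 * C\<^sup>2 * h n)" for n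
  have "r \<longlonglongrightarrow> \<theta>\<^sup>2 * (2 * B * C ^ 3 * \<bar>0\<bar> + 8 * B\<^sup>2 * C\<^sup>2 * 0)"
    unfolding r_def by (intro tendsto_intros s0 h)
  then have r0: "r \<longlonglongrightarrow> 0" by simp
  have diff0: "(\<lambda>n. a n * real n * log_mgf (h n) (s n) - \<theta>\<^sup>2 / 2 * (v n / h n)) \<longlonglongrightarrow> 0"
  proof (rule Lim_null_comparison[OF _ r0])
    show "\<forall>\<^sub>F n in sequentially. norm (a n * real n * log_mgf (h n) (s n) - \<theta>\<^sup>2 / 2 * (v n / h n)) \<le> r n"
      using ev eventually_ge_at_top[of 1]
    proof eventually_elim
      case (elim n)
      have hn: "0 < h n" and an: "0 < a n" using h a elim by auto
      have s2: "(s n)\<^sup>2 = \<theta>\<^sup>2 / (a n * (real n * h n))"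
        using an hn by (simp add: s_eq[OF elim(2)] power_mult_distrib power_inverse divide_inverse)
      have key: "a n * real n * (h n * (s n)\<^sup>2) = \<theta>\<^sup>2" using an hn elim(2) by (simp add: s2)
      have "a n * real n * log_mgf (h n) (s n) - \<theta>\<^sup>2 / 2 * (v n / h n)
          = a n * real n * (log_mgf (h n) (s n) - (s n)\<^sup>2 / 2 * v n)"
        using an hn elim(2) by (simp add: s2 field_simps)
      also have "norm \<dots> = a n * real n * \<bar>log_mgf (h n) (s n) - (s n)\<^sup>2 / 2 * v n\<bar>"
        using an by (simp add: abs_mult)
      also have "\<dots> \<le> a n * real n * (h n * (s n)\<^sup>2 * (2 * B * C ^ 3 * \<bar>s n\<bar> + 8 * B\<^sup>2 * C\<^sup>2 * h n))"
        unfolding v_def using elim an by (intro mult_left_mono centered_mgf(3) hn) auto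
      also have "\<dots> = a n * real n * (h n * (s n)\<^sup>2) * (2 * B * C ^ 3 * \<bar>s n\<bar> + 8 * B\<^sup>2 * C\<^sup>2 * h n)"
        by (simp only: mult.assoc)
      also have "\<dots> = r n" unfolding key r_def ..
      finally show ?case .
    qed
  qed
  have "\<forall>\<^sub>F n in sequentially. 0 < h n"
    using eventually_ge_at_top[of 1] by eventually_elim (rule h)
  then have "(\<lambda>n. \<theta>\<^sup>2 / 2 * (v n / h n)) \<longlonglongrightarrow> \<theta>\<^sup>2 / 2 * (f x * (\<integral>u. (K u)\<^sup>2 \<partial>lborel))"
    unfolding v_def by (intro tendsto_mult tendsto_const second_moment_asymptotics h(1))
  from tendsto_add[OF diff0 this]
  show "(\<lambda>n. a n * real n * log_mgf (h n) (s n)) \<longlonglongrightarrow> f x * (\<integral>u. (K u)\<^sup>2 \<partial>lborel) * \<theta>\<^sup>2 / 2"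
    by (simp add: mult_ac)
qed

section \<open>The process as a scaled random walk\<close>

lemma sum_\<xi>_shift: "(\<Sum>k=1..int j. g k) = (\<Sum>k<j. g (int k + 1))"
  by (rule sum.reindex_bij_witness[of _ "\<lambda>k. int k + 1" "\<lambda>k. nat (k - 1)"]) auto

lemma kde_process_step_path:
  "kde_process M K h X x n \<omega> = step_path n (\<lambda>j. sqrt (real n * h n) *
     (kde K h X x n (int j) \<omega> - (\<integral>\<omega>'. kde K h X x n (int j) \<omega>' \<partial>M)))"
  unfolding kde_process_def step_path_def by (intro restrict_ext) simp

lemma kde_process_measurable:
  assumes "1 \<le> n"
  shows "kde_process M K h X x n \<in> measurable M D01_borel"
proof -
  have [measurable]: "kde K h X x n j \<in> borel_measurable M" for j
    unfolding kde_def by measurable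
  have "(\<lambda>\<omega>. step_path n (\<lambda>j. sqrt (real n * h n) *
     (kde K h X x n (int j) \<omega> - (\<integral>\<omega>'. kde K h X x n (int j) \<omega>' \<partial>M)))) \<in> measurable M D01_borel"
    using assms
    by (intro measurable_compose[OF measurable_coordinatewise_then_product step_path_measurable]) auto
  then show ?thesis unfolding kde_process_step_path[symmetric] .
qed

lemma scaled_kde_process:
  assumes n: "1 \<le> n" and h: "0 < h n"
  shows "(\<lambda>t\<in>{0..1}. sqrt b * kde_process M K h X x n \<omega> t) =
    step_path n (\<lambda>j. \<Sum>k<j. sqrt (b / (real n * h n)) *
      (\<xi> (h n) (int k + 1) \<omega> - expectation (\<xi> (h n) (int k + 1))))"
proof -
  have int: "integrable M (\<xi> (h n) k)" for k using \<xi>_moment(1)[OF h, of 1] by simp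
  have kde_eq: "kde K h X x n (int j) = (\<lambda>\<omega>. 1 / (real n * h n) * (\<Sum>k<j. \<xi> (h n) (int k + 1) \<omega>))" for j
    by (rule ext) (simp only: kde_def sum_\<xi>_shift \<xi>_def)
  have eq: "sqrt b * (sqrt (real n * h n) * (kde K h X x n (int j) \<omega> - (\<integral>\<omega>'. kde K h X x n (int j) \<omega>' \<partial>M))) =
      (\<Sum>k<j. sqrt (b / (real n * h n)) * (\<xi> (h n) (int k + 1) \<omega> - expectation (\<xi> (h n) (int k + 1))))" for j
  proof -
    define d where "d = (\<Sum>k<j. \<xi> (h n) (int k + 1) \<omega> - expectation (\<xi> (h n) (int k + 1)))"
    have nh: "0 < real n * h n" using n h by simp
    have "kde K h X x n (int j) \<omega> - (\<integral>\<omega>'. kde K h X x n (int j) \<omega>' \<partial>M) = 1 / (real n * h n) * d"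
      unfolding kde_eq d_def using int by (simp add: sum_subtractf diff_divide_distrib)
    moreover have "sqrt y * (1 / y) = 1 / sqrt y" if "0 < y" for y :: real
      using that by (simp add: field_simps)
    from this[OF nh] have "sqrt (real n * h n) * (1 / (real n * h n)) = 1 / sqrt (real n * h n)" .
    ultimately have "sqrt b * (sqrt (real n * h n) * (kde K h X x n (int j) \<omega> - (\<integral>\<omega>'. kde K h X x n (int j) \<omega>' \<partial>M)))
        = sqrt (b / (real n * h n)) * d"
      by (simp only: mult.assoc[symmetric]) (simp add: real_sqrt_divide)
    then show ?thesis unfolding d_def by (simp only: sum_distrib_left)
  qed
  show ?thesis
    unfolding kde_process_step_path step_path_def by (intro restrict_ext) (simp only: restrict_apply' eq)
qed

end

theorem proposition12:
  fixes M :: "'w measure"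
    and X :: "int \<Rightarrow> 'w \<Rightarrow> real"
    and f K :: "real \<Rightarrow> real"
    and x :: real
    and h a :: "nat \<Rightarrow> real"
  assumes "prob_space M"
    and "prob_space.indep_vars M (\<lambda>_. borel) X UNIV"
    and "\<And>y. 0 \<le> f y"
    and "\<And>k. distributed M lborel (X k) (\<lambda>y. ennreal (f y))"
    and "bounded (range f)"
    and "isCont f x"
    and "integrable lborel K"
    and "(\<integral>u. K u \<partial>lborel) = 1"
    and "\<exists>C>0. \<forall>m\<ge>1. (\<integral>\<^sup>+u. ennreal (\<bar>K u\<bar> ^ m) \<partial>lborel) \<le> ennreal (fact m * C ^ m)"
    and "\<And>n. n \<ge> 1 \<Longrightarrow> 0 < h n"
    and "h \<longlonglongrightarrow> 0"
    and "\<And>n. n \<ge> 1 \<Longrightarrow> 0 < a n"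
    and "a \<longlonglongrightarrow> 0"
    and "filterlim (\<lambda>n. a n * (real n * h n)) at_top sequentially"
  shows "functional_MDP M (kde_process M K h X x) a (rate_If f K x)"
proof -
  interpret prob_space M by (rule assms(1))
  obtain B where B: "\<And>y. f y \<le> B"
    using assms(5) unfolding bounded_iff by (auto simp: abs_le_iff)
  obtain C where C: "0 < C"
    "\<And>m. 1 \<le> m \<Longrightarrow> (\<integral>\<^sup>+u. ennreal (\<bar>K u\<bar> ^ m) \<partial>lborel) \<le> ennreal (fact m * C ^ m)"
    using assms(9) by blast
  interpret D: kernel_density M X f K x B C
    by unfold_locales (use assms B C in auto)
  define c where "c = f x * (\<integral>u. (K u)\<^sup>2 \<partial>lborel)"
  have c: "0 \<le> c" unfolding c_def using assms(3) by (intro mult_nonneg_nonneg Bochner_Integration.integral_nonneg) auto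
  \<comment> \<open>Combines the factor \<open>sqrt (a n)\<close> of the principle with
    \<open>sqrt (real n * h n) / (real n * h n)\<close> from the process.\<close>
  define \<sigma> where "\<sigma> n = sqrt (a n / (real n * h n))" for n
  define Y where "Y n k \<omega> = D.\<xi> (h n) (int k + 1) \<omega> - expectation (D.\<xi> (h n) (int k + 1))" for n k \<omega>
  define W where "W n k \<omega> = \<sigma> n * Y n k \<omega>" for n k \<omega>
  have Y_int: "integrable M (Y n k)" "expectation (Y n k) = 0" if "1 \<le> n" for n k
    unfolding Y_def using D.\<xi>_moment(1)[OF assms(10)[OF that], of 1] by (simp_all add: prob_space)
  \<comment> \<open>Nothing is known of \<open>h 0\<close> and \<open>a 0\<close>, but division by 0
    makes \<open>\<sigma> 0 = 0\<close>; row 0 vanishes and so meets the assumptions that the array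
    imposes on every row.\<close>
  have W_0: "W 0 k = (\<lambda>\<omega>. 0)" for k by (rule ext) (simp add: W_def \<sigma>_def)
  have a_pos: "\<forall>\<^sub>F n in sequentially. 0 < a n"
    using eventually_ge_at_top[of 1] by eventually_elim (rule assms(12))
  have small: "\<forall>\<^sub>F n in sequentially. \<bar>\<theta> / a n * \<sigma> n\<bar> * C \<le> 1 / 2 \<and>
      2 * B * C * h n * \<bar>\<theta> / a n * \<sigma> n\<bar> \<le> 1 / 2" for \<theta>
    using assms(11,10,12,14) unfolding \<sigma>_def by (rule D.scaled_mgf_asymptotics(1))
  have log_mgf_lim: "(\<lambda>n. a n * real n * D.log_mgf (h n) (\<theta> / a n * \<sigma> n)) \<longlonglongrightarrow> c * \<theta>\<^sup>2 / 2" for \<theta>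
    using assms(11,10,12,14) unfolding \<sigma>_def c_def by (rule D.scaled_mgf_asymptotics(2))
  interpret mdp: mdp_array M W a c "\<lambda>n \<theta>. D.log_mgf (h n) (\<theta> / a n * \<sigma> n)"
  proof
    show "indep_vars (\<lambda>_. borel) (W n) UNIV" for n
    proof -
      \<comment> \<open>Restriction to disjoint singletons carries independence from the
        integer-indexed \<open>X\<close> to rows indexed from 0, with a shift by one.\<close>
      have "indep_vars (\<lambda>k. PiM {int k + 1} (\<lambda>_. borel)) (\<lambda>k \<omega>. restrict (\<lambda>i. X i \<omega>) {int k + 1}) (UNIV :: nat set)"
        by (rule indep_vars_restrict[OF assms(2)]) (auto simp: disjoint_family_on_def)
      then have "indep_vars (\<lambda>_. borel) (\<lambda>k \<omega>. \<sigma> n * (K ((x - restrict (\<lambda>i. X i \<omega>) {int k + 1} (int k + 1)) / h n)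
          - expectation (D.\<xi> (h n) (int k + 1)))) (UNIV :: nat set)"
        by (rule indep_vars_compose2) measurable
      moreover have "(\<lambda>k \<omega>. \<sigma> n * (K ((x - restrict (\<lambda>i. X i \<omega>) {int k + 1} (int k + 1)) / h n)
          - expectation (D.\<xi> (h n) (int k + 1)))) = W n"
        by (intro ext) (simp add: W_def Y_def D.\<xi>_def)
      ultimately show ?thesis by simp
    qed
    show "integrable M (W n k)" "expectation (W n k) = 0" for n k
      unfolding atomize_conj
    proof (cases "n = 0")
      case False
      then have n: "1 \<le> n" by simp
      show "integrable M (W n k) \<and> expectation (W n k) = 0"
        unfolding W_def using Y_int[OF n, of k] by simp
    qed (simp add: W_0)
    show "\<forall>\<^sub>F n in sequentially. \<forall>k. integrable M (\<lambda>\<omega>. exp (\<theta> / a n * W n k \<omega>)) \<and>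
        expectation (\<lambda>\<omega>. exp (\<theta> / a n * W n k \<omega>)) = exp (D.log_mgf (h n) (\<theta> / a n * \<sigma> n))" for \<theta>
      using small[of \<theta>] eventually_ge_at_top[of 1]
    proof eventually_elim
      case (elim n)
      then show ?case
        using D.centered_mgf(1,2)[OF assms(10)[OF elim(2)], of "\<theta> / a n * \<sigma> n"]
        unfolding W_def Y_def mult.assoc[symmetric] by blast
    qed
    show "(\<lambda>n. a n * real n * D.log_mgf (h n) (\<theta> / a n * \<sigma> n)) \<longlonglongrightarrow> c * \<theta>\<^sup>2 / 2" for \<theta>
      by (rule log_mgf_lim)
  qed (use assms(13) a_pos c in auto)
  have rate: "rate_If f K x z \<le> ereal \<alpha> \<longleftrightarrow> 0 \<le> \<alpha> \<and> z 0 = 0 \<and> energy_le z (2 * \<alpha> * c)" for z \<alpha>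
    using c unfolding c_def by (rule rate_If_le_iff)
  have path: "(\<lambda>t\<in>{0..1}. sqrt (a n) * kde_process M K h X x n \<omega> t) = mdp.walk_path n \<omega>" if n: "1 \<le> n" for n \<omega>
    unfolding D.scaled_kde_process[where h = h, OF n assms(10)[OF n]] mdp.walk_path_def mdp.walk_def W_def Y_def \<sigma>_def ..
  \<comment> \<open>For negative \<alpha> the level set is empty, whereas
    \<open>energy_level (2 * \<alpha> * c)\<close> would contain the zero path if
    \<open>c = 0\<close>; hence the case distinction.\<close>
  have level: "compactin D01_top {z \<in> D01. rate_If f K x z \<le> ereal \<alpha>}" for \<alpha>
  proof (cases "0 \<le> \<alpha>")
    case True
    then have "{z \<in> D01. rate_If f K x z \<le> ereal \<alpha>} = energy_level (2 * \<alpha> * c)"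
      by (auto simp: rate energy_level_def)
    then show ?thesis by (simp add: compactin_energy_level)
  qed (simp add: rate)
  show ?thesis
    unfolding functional_MDP_def Let_def
  proof (intro conjI allI ballI impI level D.kde_process_measurable)
    fix \<Gamma> assume \<Gamma>: "\<Gamma> \<in> sets D01_borel"
    let ?L = "\<lambda>n. ereal (a n) * ln_ext (prob {\<omega> \<in> space M. (\<lambda>t\<in>{0..1}. sqrt (a n) * kde_process M K h X x n \<omega> t) \<in> \<Gamma>})"
    have "\<forall>\<^sub>F n in sequentially. ?L n = ereal (a n) * ln_ext (prob {\<omega> \<in> space M. mdp.walk_path n \<omega> \<in> \<Gamma>})"
      using eventually_ge_at_top[of 1] by eventually_elim (simp add: path)
    from mdp.functional_MDP_bounds[OF rate \<Gamma> this]
    show "- (INF z\<in>D01_top interior_of \<Gamma>. rate_If f K x z) \<le> liminf ?L"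
      "limsup ?L \<le> - (INF z\<in>D01_top closure_of \<Gamma>. rate_If f K x z)" .
    show "liminf ?L \<le> limsup ?L" by (rule Liminf_le_Limsup) simp
  qed
qed

end
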